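(* Let $\beta>0$ and let $V,W\colon\mathbb T^d\to\mathbb R$ satisfy: (i) $V,W\in\mathcal C^2(\mathbb T^d)$; (ii) $W$ is even; (iii) $W$ is either $H$-stable (i.e. it has nonnegative Fourier modes) or satisfies $\|W\|_{L^\infty(\mathbb T^d)}<\beta^{-1}$. Let $f_t$ be the solution of the McKean–Vlasov PDE on $\mathbb T^d$ with initial probability density $f_0$, and $f_\infty$ the unique invariant density. Then for $i=1,2$ and all $t\ge0$ $$\|f_t-f_\infty\|_{L^1(\mathbb T^d)}\le c_ie^{-a_it},$$ with $a_1=\zeta$, $a_2=\eta/2$, $c_1=\|f_0-f_\infty\|_{L^2(\mathbb T^d)}$, $c_2=2\sqrt{2\mathcal H(f_0|f_\infty)}$, where $$\zeta=\frac{\pi^2}{4\beta}-\beta\big(\|\nabla V\|_{L^\infty}+(1+\Gamma)\|\nabla W\|_{L^\infty}\big)^2,$$ $$\eta=8\left(\frac{\pi^2}{\beta\Gamma}-\|\Delta W\|_{L^\infty}-\beta\|\nabla W\|_{L^\infty}(\|\nabla V\|_{L^\infty}+\|\nabla W\|_{L^\infty})\right),\qquad\Gamma=e^{2\beta(\|V\|_{L^\infty}+\|W\|_{L^\infty})}.$$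
   Context: $\mathbb T^d$ is the $d$-dimensional torus of side length $1$; all $L^\infty$ norms are over $\mathbb T^d$. The McKean–Vlasov PDE is $\partial_tf_t=\nabla\cdot(\nabla Vf_t+(\nabla W*f_t)f_t)+\beta^{-1}\Delta f_t$. Under the stated hypotheses it has a unique stationary probability density $f_\infty$, which is the unique probability density on $\mathbb T^d$ solving $f_\infty=\frac1Ze^{-\beta(V+W*f_\infty)}$, $Z=\int_{\mathbb T^d}e^{-\beta(V+W*f_\infty)}$. Relative entropy of densities: $\mathcal H(f|g)=\int_{\mathbb T^d}f\log(f/g)\,dx$. *)

theory Defs
  imports "HOL-Probability.Probability"
begin

text \<open>
  Functions on the torus \<open>T^d = R^d / Z^d\<close> (\<open>d = CARD('d)\<close>) are represented by
  \<open>Z^d\<close>-periodic functions on \<open>R^d\<close>; integrals and essential suprema over \<open>T^d\<close> are taken over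
  the fundamental domain \<open>[0,1]^d\<close>, whose doubled boundary is a null set.
\<close>

definition torus :: "(real^'d) measure" where
  "torus = lebesgue_on (cbox 0 1)"

definition periodic :: "(real^'d \<Rightarrow> 'b) \<Rightarrow> bool" where
  "periodic f \<longleftrightarrow> (\<forall>x i. f (x + axis i 1) = f x)"


subsection \<open>Differential operators\<close>

definition partial :: "'d \<Rightarrow> (real^'d \<Rightarrow> real) \<Rightarrow> real^'d \<Rightarrow> real" where
  "partial i f x = frechet_derivative f (at x) (axis i 1)"

definition grad :: "(real^'d \<Rightarrow> real) \<Rightarrow> real^'d \<Rightarrow> real^'d" where
  "grad f x = (\<chi> i. partial i f x)"

definition divergence :: "(real^'d \<Rightarrow> real^'d) \<Rightarrow> real^'d \<Rightarrow> real" where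
  "divergence F x = (\<Sum>i\<in>UNIV. partial i (\<lambda>y. F y $ i) x)"

definition laplacian :: "(real^'d \<Rightarrow> real) \<Rightarrow> real^'d \<Rightarrow> real" where
  "laplacian f x = (\<Sum>i\<in>UNIV. partial i (partial i f) x)"

definition C1 :: "(real^'d \<Rightarrow> real) \<Rightarrow> bool" where
  "C1 f \<longleftrightarrow> (\<forall>x. f differentiable (at x)) \<and> (\<forall>i. continuous_on UNIV (partial i f))"

definition C2 :: "(real^'d \<Rightarrow> real) \<Rightarrow> bool" where
  "C2 f \<longleftrightarrow> C1 f \<and> (\<forall>i. C1 (partial i f))"


subsection \<open>Norms, convolution, Fourier modes, densities\<close>

text \<open>For vector fields, the norm inside the essential supremum is the Euclidean one.\<close>

definition Linf_norm :: "(real^'d \<Rightarrow> 'b::real_normed_vector) \<Rightarrow> real" where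
  "Linf_norm f = real_of_ereal (esssup torus (\<lambda>x. ereal (norm (f x))))"

text \<open>\<open>L1_norm\<close>, \<open>L2_norm\<close> and \<open>rel_entropy\<close> are the usual quantities only when the integrand
  is integrable (otherwise the Bochner integral is the junk value 0).\<close>

definition L1_norm :: "(real^'d \<Rightarrow> real) \<Rightarrow> real" where
  "L1_norm f = (\<integral>x. \<bar>f x\<bar> \<partial>torus)"

definition L2_norm :: "(real^'d \<Rightarrow> real) \<Rightarrow> real" where
  "L2_norm f = sqrt (\<integral>x. (f x)\<^sup>2 \<partial>torus)"

definition in_L2 :: "(real^'d \<Rightarrow> real) \<Rightarrow> bool" where
  "in_L2 f \<longleftrightarrow> f \<in> borel_measurable torus \<and> integrable torus (\<lambda>x. (f x)\<^sup>2)"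

definition conv :: "(real^'d \<Rightarrow> 'b::{banach, second_countable_topology}) \<Rightarrow> (real^'d \<Rightarrow> real)
    \<Rightarrow> real^'d \<Rightarrow> 'b" where
  "conv K f x = (\<integral>y. f y *\<^sub>R K (x - y) \<partial>torus)"

definition fourier_coeff :: "(real^'d \<Rightarrow> real) \<Rightarrow> int^'d \<Rightarrow> complex" where
  "fourier_coeff W k =
     (\<integral>x. complex_of_real (W x) * cis (- 2 * pi * (\<Sum>i\<in>UNIV. real_of_int (k $ i) * x $ i)) \<partial>torus)"

definition H_stable :: "(real^'d \<Rightarrow> real) \<Rightarrow> bool" where
  "H_stable W \<longleftrightarrow> (\<forall>k. fourier_coeff W k \<in> \<real>\<^sub>\<ge>\<^sub>0)"

definition prob_density :: "(real^'d \<Rightarrow> real) \<Rightarrow> bool" where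
  "prob_density f \<longleftrightarrow> periodic f \<and> (\<forall>x. 0 \<le> f x) \<and> has_bochner_integral torus f 1"

text \<open>If \<open>f x = 0\<close>, the integrand is 0, as in the usual convention \<open>0 log 0 = 0\<close>.
  For probability densities with \<open>g > 0\<close> the negative part of the integrand is bounded by a
  multiple of \<open>g\<close>, so \<open>finite_entropy\<close> fails exactly when the entropy is \<open>+\<infinity>\<close>.\<close>

definition rel_entropy :: "(real^'d \<Rightarrow> real) \<Rightarrow> (real^'d \<Rightarrow> real) \<Rightarrow> real" where
  "rel_entropy f g = (\<integral>x. f x * ln (f x / g x) \<partial>torus)"

definition finite_entropy :: "(real^'d \<Rightarrow> real) \<Rightarrow> (real^'d \<Rightarrow> real) \<Rightarrow> bool" where
  "finite_entropy f g \<longleftrightarrow> integrable torus (\<lambda>x. f x * ln (f x / g x))"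


subsection \<open>The McKean--Vlasov equation\<close>

definition mckean_vlasov_rhs ::
  "real \<Rightarrow> (real^'d \<Rightarrow> real) \<Rightarrow> (real^'d \<Rightarrow> real) \<Rightarrow> (real^'d \<Rightarrow> real) \<Rightarrow> real^'d \<Rightarrow> real" where
  "mckean_vlasov_rhs \<beta> V W f x =
     divergence (\<lambda>y. f y *\<^sub>R grad V y + f y *\<^sub>R conv (grad W) f y) x + inverse \<beta> * laplacian f x"

text \<open>
  Classical (\<open>C^{1,2}\<close>) solutions on \<open>(0,\<infinity>) \<times> T^d\<close>. As \<open>f 0\<close> is merely integrable in general,
  the initial datum is attained in \<open>L^1\<close>.
\<close>

definition mckean_vlasov_solution ::
  "real \<Rightarrow> (real^'d \<Rightarrow> real) \<Rightarrow> (real^'d \<Rightarrow> real) \<Rightarrow> (real \<Rightarrow> real^'d \<Rightarrow> real) \<Rightarrow> bool" where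
  "mckean_vlasov_solution \<beta> V W f \<longleftrightarrow>
     (\<forall>t\<ge>0. periodic (f t)) \<and>
     (\<forall>t>0. C2 (f t)) \<and>
     continuous_on ({0<..} \<times> UNIV) (\<lambda>(t, x). f t x) \<and>
     continuous_on ({0<..} \<times> UNIV) (\<lambda>(t, x). deriv (\<lambda>s. f s x) t) \<and>
     (\<forall>i. continuous_on ({0<..} \<times> UNIV) (\<lambda>(t, x). partial i (f t) x)) \<and>
     (\<forall>i j. continuous_on ({0<..} \<times> UNIV) (\<lambda>(t, x). partial i (partial j (f t)) x)) \<and>
     (\<forall>t>0. \<forall>x. ((\<lambda>s. f s x) has_real_derivative mckean_vlasov_rhs \<beta> V W (f t) x) (at t)) \<and>
     integrable torus (f 0) \<and>
     ((\<lambda>t. L1_norm (\<lambda>x. f t x - f 0 x)) \<longlongrightarrow> 0) (at_right 0)"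

definition invariant_density ::
  "real \<Rightarrow> (real^'d \<Rightarrow> real) \<Rightarrow> (real^'d \<Rightarrow> real) \<Rightarrow> (real^'d \<Rightarrow> real) \<Rightarrow> bool" where
  "invariant_density \<beta> V W g \<longleftrightarrow>
     prob_density g \<and> mckean_vlasov_solution \<beta> V W (\<lambda>t. g)"


subsection \<open>Constants\<close>

definition Gamma_const :: "real \<Rightarrow> (real^'d \<Rightarrow> real) \<Rightarrow> (real^'d \<Rightarrow> real) \<Rightarrow> real" where
  "Gamma_const \<beta> V W = exp (2 * \<beta> * (Linf_norm V + Linf_norm W))"

definition zeta_const :: "real \<Rightarrow> (real^'d \<Rightarrow> real) \<Rightarrow> (real^'d \<Rightarrow> real) \<Rightarrow> real" where
  "zeta_const \<beta> V W = pi\<^sup>2 / (4 * \<beta>)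
     - \<beta> * (Linf_norm (grad V) + (1 + Gamma_const \<beta> V W) * Linf_norm (grad W))\<^sup>2"

definition eta_const :: "real \<Rightarrow> (real^'d \<Rightarrow> real) \<Rightarrow> (real^'d \<Rightarrow> real) \<Rightarrow> real" where
  "eta_const \<beta> V W = 8 * (pi\<^sup>2 / (\<beta> * Gamma_const \<beta> V W) - Linf_norm (laplacian W)
     - \<beta> * Linf_norm (grad W) * (Linf_norm (grad V) + Linf_norm (grad W)))"

end

theory Submission
  imports Defs "HOL-Real_Asymp.Real_Asymp"
begin

text \<open>
  The invariant density \<open>g\<close> is a Gibbs density, so its values lie between \<open>m\<close> and
  \<open>\<Gamma> m\<close> for some \<open>m \<le> 1\<close>. Differentiating \<open>\<integral> w j((f - p) / w)\<close> for convex \<open>j\<close> turns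
  the equation into dissipation estimates. With \<open>j = r\<^sup>2\<close>, \<open>w = 1\<close>, \<open>p = g\<close> the Poincare inequality
  gives the \<open>L\<^sup>2\<close> decay; with \<open>j = r ln r\<close>, \<open>w = g\<close>, \<open>p = 0\<close> the logarithmic Sobolev inequality,
  transferred from the uniform measure to \<open>g\<close> by the Holley--Stroock argument, gives the entropy decay, and
  the Hellinger distance bounds \<open>L\<^sup>1\<close> by the entropy. The sharp logarithmic Sobolev inequality of the circle
  follows from the monotonicity of entropy minus Fisher information along the heat flow, for which it
  suffices to consider trigonometric polynomials; it is tensorized to the torus.

  As the initial datum is attained in \<open>L\<^sup>1\<close> only, each estimate is first proved for Lipschitz
  approximations of \<open>j\<close>, whose functionals are continuous at time 0. The same computation with a smoothed
  absolute value shows that \<open>f t\<close> is nonnegative.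
\<close>

section \<open>Wirtinger inequalities\<close>

text \<open>The sharp constant of the circle matters: \<open>1 / (8 * pi\<^sup>2)\<close> times the
  oscillation factor \<open>\<Gamma>\<close> yields the rate
  \<open>8 * pi\<^sup>2 / (\<beta> * \<Gamma>)\<close>, which is exactly the leading term of
  \<open>eta_const\<close>. Relative to the equilibrium drift the nonlinearity enters only through
  \<open>conv (grad W) (u t)\<close> with \<open>u t = f t - g\<close>. In the entropy estimate it
  contributes a term quadratic in the \<open>L\<^sup>1\<close> distance, and the entropy controls
  the square of that distance. The Hellinger bound has the constant 4 up to the shift \<delta>, half
  of the 8 in the square of \<open>2 * sqrt (2 * rel_entropy (f 0) g)\<close>. The
  \<open>L\<^sup>2\<close> rate has slack too: after half of the diffusion has absorbed the drift,
  the Poincare inequality still gives \<open>4 * pi\<^sup>2 / \<beta>\<close>, while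
  \<open>2 * zeta_const\<close> asks for \<open>pi\<^sup>2 / (2 * \<beta>)\<close>. Each decay
  estimate uses Gronwall twice. A crude rate for the Lipschitz approximations gives a bound with the
  right limit at time 0; with that bound as initial information, the functional of interest gets the
  stated rate.\<close>

lemma wirtinger_dirichlet:
  fixes v v' :: "real \<Rightarrow> real"
  assumes L: "0 < L" and dv: "\<And>x. (v has_real_derivative v' x) (at x)"
    and cv': "continuous_on UNIV v'" and va: "v a = 0" and vb: "v (a + L) = 0"
  shows "(pi / L)\<^sup>2 * integral {a..a+L} (\<lambda>x. (v x)\<^sup>2) \<le> integral {a..a+L} (\<lambda>x. (v' x)\<^sup>2)"
proof -
  define k where "k = pi / L"
  \<comment> \<open>Jacobi's device: \<open>sin (k * (x - a))\<close> is the positive Dirichlet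
    eigenfunction of the interval. Subtracting the square of
    \<open>v' x - k * cot (k * (x - a)) * v x\<close> from
    \<open>(v' x)\<^sup>2 - k\<^sup>2 * (v x)\<^sup>2\<close> leaves the derivative of
    \<open>q\<close>, and \<open>q\<close> vanishes at both ends.\<close>
  define q where "q x = k * cot (k * (x - a)) * (v x)\<^sup>2" for x
  have k: "k > 0" using L by (simp add: k_def)
  have cv: "continuous_on UNIV v"
    using dv by (meson DERIV_continuous continuous_at_imp_continuous_on)
  have sin_pos: "sin (k * (x - a)) > 0" if "x \<in> {a<..<a+L}" for x
  proof (rule sin_gt_zero)
    show "0 < k * (x - a)" using k that by simp
    have "k * (x - a) < k * L" using k that by (intro mult_strict_left_mono) auto
    then show "k * (x - a) < pi" using L by (simp add: k_def)
  qed
  have q0: "q a = 0" "q (a + L) = 0"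
    by (simp_all add: q_def va vb)
  have dq: "(q has_real_derivative ((v' x)\<^sup>2 - k\<^sup>2 * (v x)\<^sup>2 - (v' x - k * cot (k * (x - a)) * v x)\<^sup>2)) (at x)"
    if x: "x \<in> {a<..<a+L}" for x
  proof -
    define s where "s = sin (k * (x - a))"
    define c where "c = cos (k * (x - a))"
    have s: "s \<noteq> 0" using sin_pos[OF x] by (simp add: s_def)
    have sc: "s\<^sup>2 + c\<^sup>2 = 1" by (simp add: s_def c_def)
    have "(q has_real_derivative (k * (- inverse (s\<^sup>2) * k) * (v x)\<^sup>2 + k * (c / s) * (2 * v x * v' x))) (at x)"
    proof -
      have "((\<lambda>x. cot (k * (x - a))) has_real_derivative (- inverse (s\<^sup>2) * k)) (at x)"
        unfolding s_def by (rule DERIV_chain2[OF DERIV_cot])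
          (use s in \<open>auto simp: s_def intro!: derivative_eq_intros\<close>)
      note dc = this
      have gen: "((\<lambda>x. k * C x * (v x)\<^sup>2) has_real_derivative k * D * (v x)\<^sup>2 + k * C x * (2 * v x * v' x)) (at x)"
        if "(C has_real_derivative D) (at x)" for C D
        using that dv[of x] by (auto intro!: derivative_eq_intros)
      have eq: "q = (\<lambda>x. k * cot (k * (x - a)) * (v x)\<^sup>2)" by (simp add: q_def[abs_def])
      have cs: "cot (k * (x - a)) = c / s" by (simp add: cot_def c_def s_def)
      show ?thesis using gen[OF dc] unfolding eq cs .
    qed
    moreover have "k * (- inverse (s\<^sup>2) * k) * (v x)\<^sup>2 + k * (c / s) * (2 * v x * v' x)
      = (v' x)\<^sup>2 - k\<^sup>2 * (v x)\<^sup>2 - (v' x - k * (c / s) * v x)\<^sup>2"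
    proof -
      have "inverse (s\<^sup>2) = 1 + (c / s)\<^sup>2"
        using s sc by (simp add: field_simps power2_eq_square)
      then show ?thesis by (simp add: algebra_simps power2_eq_square)
    qed
    ultimately show ?thesis by (simp add: cot_def s_def c_def)
  qed
  \<comment> \<open>The sine has a simple zero at \<open>p\<close> and \<open>v\<close> vanishes
    there too, so their quotient stays bounded and the second factor \<open>v\<close> sends
    \<open>q\<close> to 0.\<close>
  have lim: "(q \<longlongrightarrow> 0) (at p)"
    if p: "v p = 0" "sin (k * (p - a)) = 0" for p
  proof -
    have cp: "cos (k * (p - a)) \<noteq> 0"
      using p(2) sin_cos_squared_add[of "k * (p - a)"] by auto
    have 1: "((\<lambda>x. v x / (x - p)) \<longlongrightarrow> v' p) (at p)"
      using dv[of p] p by (simp add: has_field_derivative_iff)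
    have "((\<lambda>x. sin (k * (x - a))) has_real_derivative k * cos (k * (p - a))) (at p)"
      by (auto intro!: derivative_eq_intros)
    then have 2: "((\<lambda>x. sin (k * (x - a)) / (x - p)) \<longlongrightarrow> k * cos (k * (p - a))) (at p)"
      using p by (simp add: has_field_derivative_iff)
    have 3: "(v \<longlongrightarrow> 0) (at p)"
      using dv[of p] p DERIV_isCont isContD by metis
    have 4: "((\<lambda>x. cos (k * (x - a))) \<longlongrightarrow> cos (k * (p - a))) (at p)"
      by (intro tendsto_intros)
    have "((\<lambda>x. k * cos (k * (x - a)) * ((v x / (x - p)) / (sin (k * (x - a)) / (x - p))) * v x) \<longlongrightarrow>
       k * cos (k * (p - a)) * (v' p / (k * cos (k * (p - a)))) * 0) (at p)"
      using cp k by (intro tendsto_intros 1 2 3 4) auto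
    moreover have "\<forall>\<^sub>F x in at p. k * cos (k * (x - a)) * ((v x / (x - p)) / (sin (k * (x - a)) / (x - p))) * v x = q x"
      by (auto simp: eventually_at_filter q_def cot_def power2_eq_square)
    ultimately show ?thesis by (auto intro: Lim_transform_eventually)
  qed
  have "continuous_on {a..a+L} q"
  proof (intro continuous_at_imp_continuous_on ballI)
    fix x assume x: "x \<in> {a..a+L}"
    have kL: "k * L = pi" using L by (simp add: k_def)
    consider "x = a" | "x = a + L" | "x \<in> {a<..<a+L}" using x by fastforce
    then show "isCont q x"
    proof cases
      case 1 then show ?thesis using lim[of a] va q0 by (simp add: isCont_def)
    next
      case 2 then show ?thesis using lim[of "a+L"] vb q0 kL by (simp add: isCont_def)
    next
      case 3 then show ?thesis using dq DERIV_isCont by blast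
    qed
  qed
  then have hi: "((\<lambda>x. (v' x)\<^sup>2 - k\<^sup>2 * (v x)\<^sup>2 - (v' x - k * cot (k * (x - a)) * v x)\<^sup>2) has_integral (q (a + L) - q a)) {a..a+L}"
    using L dq by (intro fundamental_theorem_of_calculus_interior)
      (auto simp flip: has_real_derivative_iff_has_vector_derivative)
  have ci: "continuous_on {a..a+L} (\<lambda>x. (v' x)\<^sup>2)" "continuous_on {a..a+L} (\<lambda>x. (v x)\<^sup>2)"
    by (auto intro!: continuous_intros continuous_on_subset[OF cv'] continuous_on_subset[OF cv])
  have "((\<lambda>x. (v' x)\<^sup>2 - k\<^sup>2 * (v x)\<^sup>2) has_integral
      (integral {a..a+L} (\<lambda>x. (v' x)\<^sup>2) - k\<^sup>2 * integral {a..a+L} (\<lambda>x. (v x)\<^sup>2))) {a..a+L}"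
    by (intro has_integral_diff has_integral_mult_right integrable_integral integrable_continuous_real ci)
  from has_integral_le[OF hi this]
  show ?thesis by (simp add: q0 k_def)
qed

lemma period_frac:
  fixes F :: "real \<Rightarrow> 'a"
  assumes p: "\<And>x. F (x + 1) = F x"
  shows "F x = F (frac x)"
proof -
  have n: "F (x + of_int n) = F x" for x n
  proof (induction n rule: int_induct[of _ 0])
    case (step1 i) then show ?case using p[of "x + of_int i"] by (simp add: add.assoc)
  next
    case (step2 i) then show ?case using p[of "x + of_int i - 1"] by (simp add: algebra_simps)
  qed simp
  show ?thesis using n[of "frac x" "\<lfloor>x\<rfloor>"] by (simp add: frac_def)
qed

lemma integral_period:
  fixes F :: "real \<Rightarrow> real"
  assumes c: "continuous_on UNIV F" and p: "\<And>x. F (x + 1) = F x"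
  shows "integral {a..a+1} F = integral {0..1} F"
proof -
  have int: "F integrable_on {x..y}" for x y
    by (intro integrable_continuous_real continuous_on_subset[OF c]) auto
  define G where "G x = integral {x..x+1} F" for x
  have shift: "integral {x+1..y+1} F = integral {x..y} F" for x y
    using integral_shift_Icc_real[of x y F 1] p by (simp add: o_def add.commute)
  have step: "G y = G x" if "x \<le> y" "y \<le> x + 1" for x y
  proof -
    have "integral {x..y} F + integral {y..x+1} F = G x"
      unfolding G_def by (rule Henstock_Kurzweil_Integration.integral_combine) (use that int in auto)
    moreover have "integral {y..x+1} F + integral {x+1..y+1} F = G y"
      unfolding G_def by (rule Henstock_Kurzweil_Integration.integral_combine) (use that int in auto)
    ultimately show ?thesis using shift[of x y] by simp
  qed
  have per: "G (x + 1) = G x" for x using step[of x "x+1"] by simp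
  have "G a = G (frac a)" by (rule period_frac) (rule per)
  also have "\<dots> = G 0" using step[of 0 "frac a"] frac_lt_1[of a] by (simp add: frac_ge_0)
  finally show ?thesis by (simp add: G_def)
qed

text \<open>Subtracting a value taken at two points half a period apart leaves two Dirichlet
  problems on intervals of length 1/2, whose constant is already \<open>4 * pi\<^sup>2\<close>. As
  \<open>v\<close> has mean zero, the subtraction only adds \<open>(v a)\<^sup>2\<close> to the
  square integral.\<close>

lemma wirtinger_periodic:
  fixes v v' :: "real \<Rightarrow> real"
  assumes dv: "\<And>x. (v has_real_derivative v' x) (at x)"
    and cv': "continuous_on UNIV v'" and p: "\<And>x. v (x + 1) = v x"
    and mean: "integral {0..1} v = 0"
  shows "4 * pi\<^sup>2 * integral {0..1} (\<lambda>x. (v x)\<^sup>2) \<le> integral {0..1} (\<lambda>x. (v' x)\<^sup>2)"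
proof -
  have cv: "continuous_on UNIV v"
    using dv by (meson DERIV_continuous continuous_at_imp_continuous_on)
  have p': "v' (x + 1) = v' x" for x
  proof -
    have "((\<lambda>x. v (x + 1)) has_real_derivative v' (x + 1)) (at x)"
      using DERIV_shift dv by blast
    then show ?thesis using DERIV_unique[OF dv[of x]] p by simp
  qed
  define d where "d x = v x - v (x + 1/2)" for x
  have d: "continuous_on UNIV d" unfolding d_def
    by (intro continuous_intros continuous_on_compose2[OF cv]) auto
  \<comment> \<open>By periodicity \<open>d\<close> takes opposite values at 0 and 1/2.\<close>
  have "\<exists>a. d a = 0"
  proof -
    have e: "d (1/2) = - d 0" using p[of 0] by (simp add: d_def)
    have c: "continuous_on {0..1/2} d" using d continuous_on_subset by blast
    show ?thesis
    proof (cases "d 0 \<le> 0")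
      case True then show ?thesis using IVT'[of d 0 0 "1/2"] e c by auto
    next
      case False then show ?thesis using IVT2'[of d "1/2" 0 0] e c by auto
    qed
  qed
  then obtain a where a: "v (a + 1/2) = v a" by (metis d_def right_minus_eq)
  define w where "w x = v x - v a" for x
  have dw: "(w has_real_derivative v' x) (at x)" for x
    unfolding w_def using dv[of x] by (auto intro!: derivative_eq_intros)
  have cw: "continuous_on UNIV w" unfolding w_def by (intro continuous_intros cv)
  have i: "f integrable_on {x..y}" if "continuous_on UNIV f" for f :: "real \<Rightarrow> real" and x y
    by (intro integrable_continuous_real continuous_on_subset[OF that]) auto
  have h1: "(pi / (1/2))\<^sup>2 * integral {a..a+1/2} (\<lambda>x. (w x)\<^sup>2) \<le> integral {a..a+1/2} (\<lambda>x. (v' x)\<^sup>2)"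
    by (rule wirtinger_dirichlet[OF _ dw cv']) (auto simp: w_def a)
  have h2: "(pi / (1/2))\<^sup>2 * integral {a+1/2..(a+1/2)+1/2} (\<lambda>x. (w x)\<^sup>2) \<le> integral {a+1/2..(a+1/2)+1/2} (\<lambda>x. (v' x)\<^sup>2)"
    by (rule wirtinger_dirichlet[OF _ dw cv']) (use p[of a] in \<open>auto simp: w_def a add.commute\<close>)
  have sp: "integral {a..a+1/2} f + integral {a+1/2..(a+1/2)+1/2} f = integral {0..1} f"
    if "continuous_on UNIV f" "\<And>x. f (x + 1) = f x" for f :: "real \<Rightarrow> real"
    using Henstock_Kurzweil_Integration.integral_combine[of a "a+1/2" "a+1" f] i[OF that(1)] integral_period[OF that, of a] by (simp add: add.commute)
  have "4 * pi\<^sup>2 * integral {0..1} (\<lambda>x. (w x)\<^sup>2) \<le> integral {0..1} (\<lambda>x. (v' x)\<^sup>2)"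
  proof -
    have "integral {a..a+1/2} (\<lambda>x. (w x)\<^sup>2) + integral {a+1/2..(a+1/2)+1/2} (\<lambda>x. (w x)\<^sup>2) = integral {0..1} (\<lambda>x. (w x)\<^sup>2)"
      by (rule sp) (use cw in \<open>auto intro!: continuous_intros simp: w_def p\<close>)
    moreover have "integral {a..a+1/2} (\<lambda>x. (v' x)\<^sup>2) + integral {a+1/2..(a+1/2)+1/2} (\<lambda>x. (v' x)\<^sup>2) = integral {0..1} (\<lambda>x. (v' x)\<^sup>2)"
      by (rule sp) (auto intro!: continuous_intros cv' simp: p')
    moreover have "(pi / (1/2))\<^sup>2 = 4 * pi\<^sup>2" by (simp add: power_mult_distrib)
    ultimately show ?thesis using add_mono[OF h1 h2] by (simp only: distrib_left[symmetric])
  qed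
  moreover have "integral {0..1} (\<lambda>x. (w x)\<^sup>2) = integral {0..1} (\<lambda>x. (v x)\<^sup>2) + (v a)\<^sup>2"
  proof -
    have "integral {0..1} (\<lambda>x. (w x)\<^sup>2) = integral {0..1} (\<lambda>x. (v x)\<^sup>2 + (v a)\<^sup>2 - (2 * v a) * v x)"
      by (simp add: w_def power2_eq_square algebra_simps)
    also have "\<dots> = integral {0..1} (\<lambda>x. (v x)\<^sup>2 + (v a)\<^sup>2) - integral {0..1} (\<lambda>x. (2 * v a) * v x)"
      by (intro Henstock_Kurzweil_Integration.integral_diff i continuous_intros cv)
    also have "\<dots> = integral {0..1} (\<lambda>x. (v x)\<^sup>2) + (v a)\<^sup>2"
      using mean by (subst Henstock_Kurzweil_Integration.integral_add) (auto intro!: i continuous_intros cv)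
    finally show ?thesis .
  qed
  moreover have "0 \<le> 4 * pi\<^sup>2 * (v a)\<^sup>2" by simp
  ultimately show ?thesis by (simp only: distrib_left)
qed


section \<open>The logarithmic Sobolev inequality on the circle\<close>

text \<open>Explicit solutions of the heat equation with trigonometric data, so that no existence or
  smoothing theory is required. The phase \<open>c\<close> covers sines and makes the class closed
  under differentiation in space.\<close>

inductive_set heat :: "(real \<Rightarrow> real \<Rightarrow> real) set" where
  gen: "(\<lambda>t x. a * exp (- (2 * pi * of_int k)\<^sup>2 * t) * cos (2 * pi * of_int k * x + c)) \<in> heat"
| add: "u \<in> heat \<Longrightarrow> w \<in> heat \<Longrightarrow> (\<lambda>t x. u t x + w t x) \<in> heat"

lemma heat_derivs:
  assumes "u \<in> heat"
  shows "\<exists>u1\<in>heat. \<exists>u2\<in>heat. \<forall>t x. (u t has_real_derivative u1 t x) (at x)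
    \<and> (u1 t has_real_derivative u2 t x) (at x) \<and> ((\<lambda>s. u s x) has_real_derivative u2 t x) (at t)"
  using assms
proof induction
  case (gen a k c)
  define K :: real where "K = 2 * pi * of_int k"
  have "cos (x + pi/2) = - sin x" "cos (x + pi) = - cos x" for x :: real
    by (simp_all add: cos_add)
  then have e: "cos (K * x + (c + pi / 2)) = - sin (K * x + c)" "cos (K * x + (c + pi)) = - cos (K * x + c)" for x
    by (simp_all flip: add.assoc)
  define u where "u t x = a * exp (- K\<^sup>2 * t) * cos (K * x + c)" for t x
  define A where "A t x = (a * K) * exp (- K\<^sup>2 * t) * cos (K * x + (c + pi/2))" for t x
  define B where "B t x = (a * K\<^sup>2) * exp (- K\<^sup>2 * t) * cos (K * x + (c + pi))" for t x
  have "A \<in> heat" "B \<in> heat"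
    using heat.gen[of "a * K" k "c + pi/2"] heat.gen[of "a * K\<^sup>2" k "c + pi"]
    by (simp_all add: A_def[abs_def] B_def[abs_def] K_def)
  moreover have "(u t has_real_derivative A t x) (at x)" "(A t has_real_derivative B t x) (at x)"
    "((\<lambda>s. u s x) has_real_derivative B t x) (at t)" for t x
    unfolding u_def[abs_def] A_def[abs_def] B_def[abs_def] e
    by (auto intro!: derivative_eq_intros simp: power2_eq_square)
  ultimately have "\<exists>u1\<in>heat. \<exists>u2\<in>heat. \<forall>t x. (u t has_real_derivative u1 t x) (at x)
    \<and> (u1 t has_real_derivative u2 t x) (at x) \<and> ((\<lambda>s. u s x) has_real_derivative u2 t x) (at t)" by blast
  then show ?case unfolding u_def K_def .
next
  case (add u w)
  then obtain u1 u2 w1 w2 where "u1 \<in> heat" "u2 \<in> heat" "w1 \<in> heat" "w2 \<in> heat" and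
    d: "\<And>t x. (u t has_real_derivative u1 t x) (at x)" "\<And>t x. (u1 t has_real_derivative u2 t x) (at x)"
    "\<And>t x. ((\<lambda>s. u s x) has_real_derivative u2 t x) (at t)"
    "\<And>t x. (w t has_real_derivative w1 t x) (at x)" "\<And>t x. (w1 t has_real_derivative w2 t x) (at x)"
    "\<And>t x. ((\<lambda>s. w s x) has_real_derivative w2 t x) (at t)" by metis
  then show ?case
    by (intro bexI[of _ "\<lambda>t x. u1 t x + w1 t x"] bexI[of _ "\<lambda>t x. u2 t x + w2 t x"] allI conjI)
      (auto intro!: heat.add derivative_eq_intros)
qed

lemma heat_continuous: "u \<in> heat \<Longrightarrow> continuous_on A (\<lambda>p. u (fst p) (snd p))"
  by (induction rule: heat.induct) (auto intro!: continuous_intros)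

lemma heat_continuous_slice: "u \<in> heat \<Longrightarrow> continuous_on A (u t)"
proof -
  assume "u \<in> heat"
  then obtain u1 where "\<And>t x. (u t has_real_derivative u1 t x) (at x)" using heat_derivs[of u] by metis
  then show ?thesis by (intro continuous_at_imp_continuous_on ballI DERIV_isCont)
qed

lemma heat_periodic: "u \<in> heat \<Longrightarrow> u t (x + 1) = u t x"
proof (induction rule: heat.induct)
  case (gen a k c)
  have "cos (2 * pi * of_int k * x + c + 2 * pi * of_int k) = cos (2 * pi * of_int k * x + c)"
    by (metis (no_types, opaque_lifting) cos_add cos_int_2pin sin_int_2pin mult.right_neutral mult_zero_right diff_zero mult.commute)
  then show ?case by (simp add: algebra_simps)
qed auto

text \<open>Only the modes with \<open>k = 0\<close> survive. The constant limit is where the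
  monotone quantity in the logarithmic Sobolev inequality is evaluated.\<close>

lemma heat_limit: "u \<in> heat \<Longrightarrow> \<exists>c. uniform_limit UNIV u (\<lambda>x. c) at_top"
proof (induction rule: heat.induct)
  case (gen a k c)
  show ?case
  proof (cases "k = 0")
    case True then show ?thesis by (auto intro!: exI[of _ "a * cos c"] uniform_limit_const)
  next
    case False
    define K where "K = (2 * pi * real_of_int k)\<^sup>2"
    have K: "K > 0" using False by (simp add: K_def)
    have "((\<lambda>t. \<bar>a\<bar> * exp (- K * t)) \<longlongrightarrow> 0) at_top"
      using K by real_asymp
    then have l: "\<forall>\<^sub>F t in at_top. \<bar>a\<bar> * exp (- K * t) < e" if "e > 0" for e
      using that by (auto dest: order_tendstoD)
    have b: "\<bar>a * exp (- K * t) * cos y\<bar> \<le> \<bar>a\<bar> * exp (- K * t)" for t y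
      by (simp add: abs_mult mult_left_le)
    show ?thesis
    proof (intro exI[of _ 0] uniform_limitI)
      fix e :: real assume "e > 0"
      then show "\<forall>\<^sub>F t in at_top. \<forall>x\<in>UNIV. dist (a * exp (- (2 * pi * of_int k)\<^sup>2 * t) * cos (2 * pi * of_int k * x + c)) 0 < e"
        unfolding K_def[symmetric] by (rule eventually_mono[OF l])
          (use b in \<open>auto simp: dist_real_def intro: le_less_trans\<close>)
    qed
  qed
next
  case (add u w)
  then obtain c d where "uniform_limit UNIV u (\<lambda>x. c) at_top" "uniform_limit UNIV w (\<lambda>x. d) at_top" by blast
  from uniform_limit_add[OF this] show ?case by blast
qed

lemma integral_deriv_periodic:
  fixes G g :: "real \<Rightarrow> real"
  assumes "\<And>x. (G has_real_derivative g x) (at x)" "\<And>x. G (x + 1) = G x"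
  shows "integral {0..1} g = 0"
proof -
  have "(g has_integral (G 1 - G 0)) {0..1}"
    by (rule fundamental_theorem_of_calculus)
      (auto simp flip: has_real_derivative_iff_has_vector_derivative intro: has_field_derivative_at_within assms(1))
  then show ?thesis using assms(2)[of 0] by (simp add: integral_unique)
qed

text \<open>One-sided at time 0, because solutions of the heat equation are known to be positive,
  and their entropy differentiable, for nonnegative times only.\<close>

lemma integral_has_derivative_param:
  fixes F F' :: "real \<Rightarrow> real \<Rightarrow> real"
  assumes d: "\<And>t x. t \<ge> 0 \<Longrightarrow> ((\<lambda>s. F s x) has_real_derivative F' t x) (at t)"
    and c: "continuous_on ({0..} \<times> UNIV) (\<lambda>p. F (fst p) (snd p))"
    and c': "continuous_on ({0..} \<times> UNIV) (\<lambda>p. F' (fst p) (snd p))"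
    and t: "t \<ge> 0"
  shows "((\<lambda>t. integral {0..1} (F t)) has_real_derivative integral {0..1} (F' t)) (at t within {0..})"
proof -
  have "((\<lambda>t. integral (cbox 0 1) (F t)) has_real_derivative integral (cbox 0 1) (F' t)) (at t within {0..})"
  proof (rule leibniz_rule_field_derivative)
    show "F x integrable_on cbox 0 1" if "x \<in> {0..}" for x
      using that by (intro integrable_continuous continuous_on_compose2[OF c, of _ "\<lambda>y. (x, y)", simplified])
        (auto intro!: continuous_intros)
    show "continuous_on ({0..} \<times> cbox 0 1) (\<lambda>(x, t). F' x t)"
      unfolding case_prod_beta by (rule continuous_on_subset[OF c']) auto
  qed (use d t in \<open>auto intro: has_field_derivative_at_within\<close>)
  then show ?thesis by simp
qed

lemma nondecreasing_from_deriv: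
  fixes \<phi> \<phi>' :: "real \<Rightarrow> real"
  assumes d: "\<And>t. t \<ge> 0 \<Longrightarrow> (\<phi> has_real_derivative \<phi>' t) (at t within {0..})"
    and nn: "\<And>t. t \<ge> 0 \<Longrightarrow> \<phi>' t \<ge> 0" and t: "t \<ge> 0"
  shows "\<phi> 0 \<le> \<phi> t"
proof (rule DERIV_nonneg_imp_increasing_open[OF t])
  show "\<exists>y. (\<phi> has_real_derivative y) (at s) \<and> 0 \<le> y" if "0 < s" for s
    using d[of s] nn[of s] that at_within_interior[of s "{0..}"] by auto
  have "continuous_on {0..} \<phi>"
    using d by (meson DERIV_continuous atLeast_iff continuous_on_eq_continuous_within)
  then show "continuous_on {0..t} \<phi>" by (rule continuous_on_subset) auto
qed

lemma DERIV_pos_part_power: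
  fixes r :: real
  shows "((\<lambda>r. (max 0 r) ^ Suc (Suc n)) has_real_derivative real (Suc (Suc n)) * (max 0 r) ^ Suc n) (at r)"
proof -
  consider "r > 0" | "r < 0" | "r = 0" by linarith
  then show ?thesis
  proof cases
    case 1
    have "((\<lambda>r. r ^ Suc (Suc n)) has_real_derivative real (Suc (Suc n)) * (max 0 r) ^ Suc n) (at r)"
      using 1 DERIV_pow[of "Suc (Suc n)" r] by simp
    then show ?thesis
      by (rule has_field_derivative_transform_within_open[of _ _ _ "{0<..}"]) (use 1 in auto)
  next
    case 2
    have "((\<lambda>r. 0) has_real_derivative real (Suc (Suc n)) * (max 0 r) ^ Suc n) (at r)"
      using 2 by simp
    then show ?thesis
      by (rule has_field_derivative_transform_within_open[of _ _ _ "{..<0}"]) (use 2 in auto)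
  next
    case 3
    have "((\<lambda>x::real. (max 0 x) ^ Suc n) \<longlongrightarrow> (max 0 0) ^ Suc n) (at 0)"
      by (intro tendsto_intros)
    moreover have "\<forall>\<^sub>F x::real in at 0. (max 0 x) ^ Suc n = (max 0 x) ^ Suc (Suc n) / x"
      by (auto simp: eventually_at_filter max_def)
    ultimately have "((\<lambda>x::real. (max 0 x) ^ Suc (Suc n) / x) \<longlongrightarrow> (max 0 0) ^ Suc n) (at 0)"
      by (rule Lim_transform_eventually)
    then show ?thesis using 3 by (simp add: has_field_derivative_iff)
  qed
qed

lemmas DERIV_pos_part_square = DERIV_pos_part_power[of 0, folded numeral_2_eq_2, unfolded of_nat_numeral, simplified]
lemmas DERIV_pos_part_cube = DERIV_pos_part_power[of "Suc 0", folded numeral_3_eq_3 numeral_2_eq_2, unfolded of_nat_numeral]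

text \<open>Minimum principle by an energy argument: the integral of the cubed positive part of
  \<open>m - u t x\<close> cannot grow and is 0 at time 0. The cube makes it possible to
  differentiate once in time and to integrate by parts once in space within classical
  calculus.\<close>

lemma heat_lower_bound:
  assumes u: "u \<in> heat" and m: "\<And>x. m \<le> u 0 x" and t: "t \<ge> 0"
  shows "m \<le> u t x"
proof -
  obtain u1 u2 where h: "u1 \<in> heat" "u2 \<in> heat" and
    d: "\<And>t x. (u t has_real_derivative u1 t x) (at x)" "\<And>t x. (u1 t has_real_derivative u2 t x) (at x)"
    "\<And>t x. ((\<lambda>s. u s x) has_real_derivative u2 t x) (at t)" using heat_derivs[OF u] by metis
  define P where "P t = integral {0..1} (\<lambda>x. (max 0 (m - u t x)) ^ 3)" for t
  have cI: "f integrable_on {0..1}" if "continuous_on UNIV f" for f :: "real \<Rightarrow> real"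
    by (intro integrable_continuous_real continuous_on_subset[OF that]) auto
  note cs = heat_continuous_slice[OF u] heat_continuous_slice[OF h(1)] heat_continuous_slice[OF h(2)]
  note cc = heat_continuous[OF u] heat_continuous[OF h(1)] heat_continuous[OF h(2)]
  have dP: "((\<lambda>t. - P t) has_real_derivative integral {0..1} (\<lambda>x. 3 * (max 0 (m - u t x))\<^sup>2 * u2 t x)) (at t within {0..})"
    if "t \<ge> 0" for t
  proof -
    have "((\<lambda>t. integral {0..1} (\<lambda>x. - ((max 0 (m - u t x)) ^ 3))) has_real_derivative
       integral {0..1} (\<lambda>x. 3 * (max 0 (m - u t x))\<^sup>2 * u2 t x)) (at t within {0..})"
    proof (rule integral_has_derivative_param[OF _ _ _ that])
      fix t x
      have "((\<lambda>s. max 0 (m - u s x) ^ 3) has_real_derivative 3 * (max 0 (m - u t x))\<^sup>2 * (0 - u2 t x)) (at t)"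
        by (rule DERIV_chain2[OF DERIV_pos_part_cube]) (intro derivative_intros d)
      from DERIV_minus[OF this] show "((\<lambda>s. - (max 0 (m - u s x) ^ 3)) has_real_derivative 3 * (max 0 (m - u t x))\<^sup>2 * u2 t x) (at t)"
        by simp
    qed (intro continuous_intros cc)+
    then show ?thesis by (simp add: P_def)
  qed
  have nn: "integral {0..1} (\<lambda>x. 3 * (max 0 (m - u t x))\<^sup>2 * u2 t x) \<ge> 0" for t
  proof -
    have "integral {0..1} (\<lambda>x. 3 * (max 0 (m - u t x))\<^sup>2 * u2 t x - 6 * max 0 (m - u t x) * (u1 t x)\<^sup>2) = 0"
    proof (rule integral_deriv_periodic)
      fix x
      have "((\<lambda>x. max 0 (m - u t x) ^ 2) has_real_derivative 2 * max 0 (m - u t x) * (0 - u1 t x)) (at x)"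
        by (rule DERIV_chain2[OF DERIV_pos_part_square]) (intro derivative_intros d)
      from DERIV_mult[OF DERIV_cmult[OF this, of 3] d(2)[of t x]]
      show "((\<lambda>x. 3 * (max 0 (m - u t x))\<^sup>2 * u1 t x) has_real_derivative
          3 * (max 0 (m - u t x))\<^sup>2 * u2 t x - 6 * max 0 (m - u t x) * (u1 t x)\<^sup>2) (at x)"
        by (simp add: power2_eq_square algebra_simps)
    qed (simp add: heat_periodic u h)
    moreover have "integral {0..1} (\<lambda>x. 3 * (max 0 (m - u t x))\<^sup>2 * u2 t x - 6 * max 0 (m - u t x) * (u1 t x)\<^sup>2)
      = integral {0..1} (\<lambda>x. 3 * (max 0 (m - u t x))\<^sup>2 * u2 t x) - integral {0..1} (\<lambda>x. 6 * max 0 (m - u t x) * (u1 t x)\<^sup>2)"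
      by (rule Henstock_Kurzweil_Integration.integral_diff; rule cI; intro continuous_intros cs)
    moreover have "0 \<le> integral {0..1} (\<lambda>x. 6 * max 0 (m - u t x) * (u1 t x)\<^sup>2)"
      by (intro integral_nonneg cI continuous_intros cs) auto
    ultimately show ?thesis by linarith
  qed
  have "- P 0 \<le> - P t" using nondecreasing_from_deriv[OF dP nn t] .
  moreover have "P 0 = 0" using m by (simp add: P_def max_absorb1)
  moreover have "0 \<le> P t" unfolding P_def by (intro integral_nonneg cI continuous_intros cs) auto
  ultimately have P0: "P t = 0" by linarith
  have ge: "m \<le> u t x" if "x \<in> {0..1}" for x
  proof -
    have c: "continuous_on {0..1} (\<lambda>x. (max 0 (m - u t x)) ^ 3)"
      by (intro continuous_intros continuous_on_subset[OF cs(1)]) auto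
    have "\<forall>x\<in>{0..1}. (max 0 (m - u t x)) ^ 3 = 0"
      using integral_eq_0_iff[OF c] P0 by (simp add: P_def)
    then show ?thesis using that by (force simp: max_def split: if_splits)
  qed
  have "u t x = u t (frac x)" by (rule period_frac) (rule heat_periodic[OF u])
  then show ?thesis using ge[of "frac x"] frac_lt_1[of x] by (simp add: frac_ge_0 less_imp_le)
qed


lemma periodic_pos_lower_bound:
  fixes g :: "real \<Rightarrow> real"
  assumes c: "continuous_on UNIV g" and p: "\<And>x. g (x + 1) = g x" and pos: "\<And>x. 0 < g x"
  obtains m where "m > 0" "\<And>x. m \<le> g x"
proof -
  have "\<exists>x\<in>{0..1}. \<forall>y\<in>{0..1}. g x \<le> g y"
    by (intro continuous_attains_inf continuous_on_subset[OF c]) auto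
  then obtain x0 where x0: "\<And>y. y \<in> {0..1} \<Longrightarrow> g x0 \<le> g y" by metis
  have "frac y \<in> {0..1}" for y :: real by (simp add: frac_ge_0 less_imp_le frac_lt_1)
  then have "g x0 \<le> g y" for y using x0[of "frac y"] period_frac[of g y, OF p] by simp
  then show ?thesis using that pos by blast
qed

lemma periodic_bound:
  fixes g :: "real \<Rightarrow> real"
  assumes c: "continuous_on UNIV g" and p: "\<And>x. g (x + 1) = g x"
  obtains B where "\<And>x. \<bar>g x\<bar> \<le> B"
proof -
  have "\<exists>x\<in>{0..1}. \<forall>y\<in>{0..1}. \<bar>g y\<bar> \<le> \<bar>g x\<bar>"
    by (intro continuous_attains_sup continuous_intros continuous_on_subset[OF c]) auto
  then obtain x0 where x0: "\<And>y. y \<in> {0..1} \<Longrightarrow> \<bar>g y\<bar> \<le> \<bar>g x0\<bar>" by metis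
  have "frac y \<in> {0..1}" for y :: real by (simp add: frac_ge_0 less_imp_le frac_lt_1)
  then have "\<bar>g y\<bar> \<le> \<bar>g x0\<bar>" for y using x0[of "frac y"] period_frac[of g y, OF p] by simp
  then show ?thesis using that by blast
qed

lemma continuous_UNIV_integrable_on:
  fixes f :: "real \<Rightarrow> real"
  assumes "continuous_on UNIV f"
  shows "f integrable_on {a..b}"
  using integrable_continuous_real[OF continuous_on_subset[OF assms]] by blast

text \<open>Emery and Yukich: with \<open>v = (\<surd>u)'\<close> the derivative of the Fisher information along the heat
  flow is \<open>-8 \<integral> v'\<^sup>2 - (1/6) \<integral> u'\<^sup>4 / u\<^sup>3\<close>, which Wirtinger's inequality compares with
  the Fisher information \<open>4 \<integral> v\<^sup>2\<close> itself.\<close>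

lemma heat_log_sobolev:
  assumes u: "u \<in> heat" and pos0: "\<And>x. 0 < u 0 x" and dg: "\<And>x. (u 0 has_real_derivative g x) (at x)"
  shows "integral {0..1} (\<lambda>x. u 0 x * ln (u 0 x)) - integral {0..1} (u 0) * ln (integral {0..1} (u 0))
    \<le> integral {0..1} (\<lambda>x. (g x)\<^sup>2 / u 0 x) / (8 * pi\<^sup>2)"
proof -
  obtain u1 u2 where h: "u1 \<in> heat" "u2 \<in> heat" and
    d: "\<And>t x. (u t has_real_derivative u1 t x) (at x)" "\<And>t x. (u1 t has_real_derivative u2 t x) (at x)"
    "\<And>t x. ((\<lambda>s. u s x) has_real_derivative u2 t x) (at t)" using heat_derivs[OF u] by metis
  obtain u2' u3 where h3: "u3 \<in> heat" and
    d': "\<And>t x. (u1 t has_real_derivative u2' t x) (at x)" "\<And>t x. (u2' t has_real_derivative u3 t x) (at x)"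
    "\<And>t x. ((\<lambda>s. u1 s x) has_real_derivative u3 t x) (at t)" using heat_derivs[OF h(1)] by metis
  have "u2' = u2" using DERIV_unique[OF d'(1) d(2)] by (intro ext)
  note d3 = d'(2,3)[unfolded this]
  note per = heat_periodic[OF u] heat_periodic[OF h(1)] heat_periodic[OF h(2)]
  note cs = heat_continuous_slice[OF u] heat_continuous_slice[OF h(1)] heat_continuous_slice[OF h(2)] heat_continuous_slice[OF h3]
  note cc = heat_continuous[OF u] heat_continuous[OF h(1)] heat_continuous[OF h(2)] heat_continuous[OF h3]
  have g: "g = u1 0" using DERIV_unique[OF dg d(1)] by (intro ext)
  obtain m0 where m0: "m0 > 0" "\<And>x. m0 \<le> u 0 x"
    using periodic_pos_lower_bound[of "u 0"] cs(1) per(1) pos0 by metis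
  have pos: "u t x > 0" if "t \<ge> 0" for t x
    using heat_lower_bound[OF u m0(2) that, of x] m0(1) by linarith
  define m where "m = integral {0..1} (u 0)"
  have m: "m > 0"
  proof -
    have "integral {0..1} (\<lambda>x::real. m0) \<le> m" unfolding m_def
      by (intro integral_le continuous_UNIV_integrable_on cs) (auto simp: m0)
    then show ?thesis using m0 by simp
  qed
  have mass: "integral {0..1} (u t) = m" if "t \<ge> 0" for t
  proof -
    have dm: "((\<lambda>t. integral {0..1} (u t)) has_real_derivative 0) (at t within {0..})" if "t \<ge> 0" for t
      using integral_has_derivative_param[of u u2 t, OF d(3) cc(1) cc(3) that]
        integral_deriv_periodic[of "u1 t" "u2 t", OF d(2) per(2)] by simp
    have "m \<le> integral {0..1} (u t)"
      unfolding m_def by (rule nondecreasing_from_deriv[OF dm _ that]) auto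
    moreover have "- m \<le> - integral {0..1} (u t)"
      unfolding m_def by (rule nondecreasing_from_deriv[OF _ _ that, of "\<lambda>t. - integral {0..1} (u t)" "\<lambda>t. 0"])
        (auto intro!: derivative_eq_intros dm)
    ultimately show ?thesis by simp
  qed
  define \<phi> where "\<phi> t = integral {0..1} (\<lambda>x. u t x * ln (u t x) - (u1 t x)\<^sup>2 / u t x / (8 * pi\<^sup>2))" for t
  define F' where "F' t x = (ln (u t x) + 1) * u2 t x
      - (2 * u1 t x * u3 t x / u t x - (u1 t x)\<^sup>2 * u2 t x / (u t x)\<^sup>2) / (8 * pi\<^sup>2)" for t x
  have d\<phi>: "(\<phi> has_real_derivative integral {0..1} (F' t)) (at t within {0..})" if "t \<ge> 0" for t
    unfolding \<phi>_def
  proof (rule integral_has_derivative_param[OF _ _ _ that])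
    fix t x :: real assume "t \<ge> 0"
    note p = pos[OF this, of x]
    show "((\<lambda>s. u s x * ln (u s x) - (u1 s x)\<^sup>2 / u s x / (8 * pi\<^sup>2)) has_real_derivative F' t x) (at t)"
      unfolding F'_def using p
      by (auto intro!: derivative_eq_intros d d3 simp: field_simps power2_eq_square)
  next
    have p: "u (fst z) (snd z) \<noteq> 0" "0 < u (fst z) (snd z)" if "z \<in> {0..} \<times> UNIV" for z using pos[of "fst z" "snd z"] that by auto
    show "continuous_on ({0..} \<times> UNIV) (\<lambda>p. u (fst p) (snd p) * ln (u (fst p) (snd p)) - (u1 (fst p) (snd p))\<^sup>2 / u (fst p) (snd p) / (8 * pi\<^sup>2))"
      by (intro continuous_intros cc) (use p in auto)
    show "continuous_on ({0..} \<times> UNIV) (\<lambda>p. F' (fst p) (snd p))"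
      unfolding F'_def by (intro continuous_intros cc) (use p in auto)
  qed
  have nn: "0 \<le> integral {0..1} (F' t)" if t: "t \<ge> 0" for t
  proof -
    note p = pos[OF t]
    define v where "v x = u1 t x / (2 * sqrt (u t x))" for x
    define v' where "v' x = u2 t x / (2 * sqrt (u t x)) - (u1 t x)\<^sup>2 / (4 * u t x * sqrt (u t x))" for x
    define k where "k = 1 / pi\<^sup>2"
    define i where "i x = inverse (u t x)" for x
    \<comment> \<open>All integrations by parts at once. The coefficient 1/3 of
      \<open>u1\<^sup>3 / u\<^sup>2\<close> turns the mixed terms into the square
      \<open>(v' x)\<^sup>2\<close>, leaving a nonnegative remainder in the fourth power of
      \<open>u1\<close>.\<close>
    define G where "G x = (ln (u t x) + 1) * u1 t x - k / 8 * (2 * u1 t x * u2 t x * i x - 1 / 3 * (u1 t x * u1 t x * u1 t x * (i x * i x)))" for x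
    define R where "R x = F' t x - (k * (v' x)\<^sup>2 - 4 * (v x)\<^sup>2 + k / 48 * (u1 t x) ^ 4 * (i x) ^ 3)" for x
    have ne: "u t x \<noteq> 0" "sqrt (u t x) \<noteq> 0" "u t x > 0" for x using p[of x] by auto
    have dsq: "((\<lambda>x. sqrt (u t x)) has_real_derivative u1 t x / (2 * sqrt (u t x))) (at x)" for x
      using p[of x] by (auto intro!: derivative_eq_intros d simp: field_simps)
    have dv: "(v has_real_derivative v' x) (at x)" for x
    proof -
      from DERIV_divide[OF d(2)[of t x] DERIV_cmult[OF dsq, of 2]] show ?thesis
        unfolding v_def v'_def using ne[of x]
        by (auto simp: field_simps power2_eq_square elim!: DERIV_cong)
    qed
    have cv': "continuous_on UNIV v'" and cv: "continuous_on UNIV v"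
      and ci: "continuous_on UNIV i"
      unfolding v'_def v_def i_def by (intro continuous_intros cs; use ne in simp)+
    have "integral {0..1} v = 0"
      by (rule integral_deriv_periodic[where G="\<lambda>x. sqrt (u t x)"])
        (auto simp: dsq v_def per)
    then have W: "4 * pi\<^sup>2 * integral {0..1} (\<lambda>x. (v x)\<^sup>2) \<le> integral {0..1} (\<lambda>x. (v' x)\<^sup>2)"
      by (intro wirtinger_periodic[OF dv cv']) (simp_all only: v_def per)
    have dG: "(G has_real_derivative R x) (at x)" for x
    proof -
      have v2: "4 * (v x)\<^sup>2 = (u1 t x)\<^sup>2 * i x"
        using p[of x] by (simp add: v_def i_def power_divide power_mult_distrib field_simps)
      have v'2: "(v' x)\<^sup>2 = (u2 t x - (u1 t x)\<^sup>2 * i x / 2)\<^sup>2 * i x / 4"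
      proof -
        have aux: "(b / (2 * r) - a / (4 * (r * r) * r))\<^sup>2 = (b - a * inverse (r * r) / 2)\<^sup>2 * inverse (r * r) / 4"
          if "r > 0" for a b r :: real
        proof -
          have "b / (2 * r) - a / (4 * (r * r) * r) = (b - a * inverse (r * r) / 2) / (2 * r)"
            using that by (simp add: field_simps)
          moreover have "(w / (2 * r))\<^sup>2 = w\<^sup>2 * inverse (r * r) / 4" for w
            using that by (simp add: field_simps power2_eq_square)
          ultimately show ?thesis by simp
        qed
        have "sqrt (u t x) * sqrt (u t x) = u t x" using p[of x] by simp
        with aux[of "sqrt (u t x)" "u2 t x" "(u1 t x)\<^sup>2"] show ?thesis
          using p[of x] by (simp add: v'_def i_def)
      qed
      have F': "F' t x = (ln (u t x) + 1) * u2 t x - k / 8 * (2 * u1 t x * u3 t x * i x - (u1 t x)\<^sup>2 * u2 t x * (i x)\<^sup>2)"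
        using ne(1)[of x] by (simp add: F'_def k_def i_def field_simps)
      have di: "(i has_real_derivative - (u1 t x * (i x)\<^sup>2)) (at x)"
        using DERIV_inverse_fun[OF d(1)[of t x]] ne[of x] by (simp add: i_def[abs_def] power2_eq_square mult_ac)
      have dl: "((\<lambda>x. ln (u t x)) has_real_derivative u1 t x * i x) (at x)"
        using DERIV_chain2[OF DERIV_ln[OF ne(3)[of x]] d(1)[of t x]] by (simp add: i_def mult.commute)
      have gen: "((\<lambda>y. (L y + 1) * A y - K * (2 * A y * B y * J y - c * (A y * A y * A y * (J y * J y)))) has_real_derivative
          L' * A x + (L x + 1) * B x - K * (2 * (B x * B x * J x + A x * C * J x + A x * B x * J')
            - c * (3 * (A x * A x * B x * (J x * J x)) + 2 * (A x * A x * A x * (J x * J'))))) (at x)"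
        if "(L has_real_derivative L') (at x)" "(A has_real_derivative B x) (at x)"
          "(B has_real_derivative C) (at x)" "(J has_real_derivative J') (at x)" for L A B J L' C J' K c
        by (rule DERIV_cong, (rule that derivative_intros)+) (simp add: algebra_simps)
      show ?thesis
        unfolding G_def by (rule DERIV_cong[OF gen[OF dl d(2) d3(1) di]])
          (simp only: R_def F' v2 v'2, simp add: power2_eq_square power3_eq_cube power4_eq_xxxx algebra_simps add_divide_distrib diff_divide_distrib)
    qed
    have "integral {0..1} R = 0"
      by (rule integral_deriv_periodic[OF dG]) (simp add: G_def i_def per)
    moreover have "integral {0..1} R = integral {0..1} (F' t) - integral {0..1} (\<lambda>x. k * (v' x)\<^sup>2 - 4 * (v x)\<^sup>2 + k / 48 * (u1 t x) ^ 4 * (i x) ^ 3)"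
      unfolding R_def F'_def
      by (intro Henstock_Kurzweil_Integration.integral_diff continuous_UNIV_integrable_on continuous_intros cs cv cv' ci) (simp_all add: ne)
    moreover have "0 \<le> integral {0..1} (\<lambda>x. k * (v' x)\<^sup>2 - 4 * (v x)\<^sup>2 + k / 48 * (u1 t x) ^ 4 * (i x) ^ 3)"
    proof -
      have "0 \<le> k * integral {0..1} (\<lambda>x. (v' x)\<^sup>2) - 4 * integral {0..1} (\<lambda>x. (v x)\<^sup>2)"
        using W by (simp add: k_def field_simps)
      also have "\<dots> = integral {0..1} (\<lambda>x. k * (v' x)\<^sup>2 - 4 * (v x)\<^sup>2)"
        by (subst Henstock_Kurzweil_Integration.integral_diff) (auto intro!: continuous_UNIV_integrable_on continuous_intros cv cv')
      also have "\<dots> \<le> integral {0..1} (\<lambda>x. k * (v' x)\<^sup>2 - 4 * (v x)\<^sup>2 + k / 48 * (u1 t x) ^ 4 * (i x) ^ 3)"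
        by (intro integral_le continuous_UNIV_integrable_on continuous_intros cv cv' ci cs) (use ne p in \<open>auto simp: i_def k_def less_imp_le\<close>)
      finally show ?thesis .
    qed
    ultimately show ?thesis by linarith
  qed
  obtain c where c: "uniform_limit UNIV u (\<lambda>x. c) at_top" using heat_limit[OF u] by auto
  have "\<phi> 0 \<le> m * ln m"
  proof (rule field_le_epsilon)
    fix \<epsilon> :: real assume \<epsilon>: "\<epsilon> > 0"
    \<comment> \<open>Both \<open>u t x\<close> and \<open>m\<close> lie within \<open>e\<close> of
      the limit \<open>c\<close>, hence within \<open>2 * e\<close> of each other, and this
      \<open>e\<close> makes \<open>(2 * e)\<^sup>2 / m\<close> equal to \<epsilon>.\<close>
    define e where "e = sqrt (\<epsilon> * m) / 2"
    have e: "e > 0" "(2 * e)\<^sup>2 = \<epsilon> * m" using \<epsilon> m by (auto simp: e_def)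
    obtain t where t: "t \<ge> 0" and uc: "\<And>x. \<bar>u t x - c\<bar> < e"
    proof -
      have "\<forall>\<^sub>F t in at_top. t \<ge> 0 \<and> (\<forall>x\<in>UNIV. dist (u t x) c < e)"
        using eventually_conj[OF eventually_ge_at_top[of 0] uniform_limitD[OF c e(1)]] .
      then show ?thesis using that by (auto simp: eventually_at_top_linorder dist_real_def)
    qed
    note cst = cs[of UNIV t]
    have p: "u t x > 0" "u t x \<noteq> 0" for x using pos[OF t, of x] by auto
    have "m \<le> integral {0..1} (\<lambda>x::real. c + e)" "integral {0..1} (\<lambda>x::real. c - e) \<le> m"
      unfolding mass[OF t, symmetric]
      by (intro integral_le continuous_UNIV_integrable_on continuous_intros cst; use uc in \<open>smt (verit)\<close>)+
    then have mc: "\<bar>m - c\<bar> \<le> e" by simp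
    have um: "(u t x - m)\<^sup>2 \<le> (2 * e)\<^sup>2" for x
      using uc[of x] mc by (intro power2_le_iff_abs_le[THEN iffD2]) auto
    have "\<phi> 0 \<le> \<phi> t" by (rule nondecreasing_from_deriv[OF d\<phi> nn t])
    \<comment> \<open>The Fisher information is dropped by its sign, so only \<open>u\<close>, and
      not its derivative, has to converge.\<close>
    also have "\<dots> \<le> integral {0..1} (\<lambda>x. (ln m + 1) * u t x + ((u t x - m)\<^sup>2 / m - m))"
      unfolding \<phi>_def
    proof (intro integral_le continuous_UNIV_integrable_on continuous_intros cst)
      fix x assume "x \<in> {0..1::real}"
      have "ln (u t x / m) \<le> u t x / m - 1" using ln_le_minus_one p m by simp
      then have "ln (u t x) \<le> ln m + (u t x / m - 1)" using p m by (simp add: ln_div)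
      then have "u t x * ln (u t x) \<le> u t x * (ln m + (u t x / m - 1))" using p[of x] by (intro mult_left_mono) auto
      also have "\<dots> = (ln m + 1) * u t x + ((u t x - m)\<^sup>2 / m - m)"
        using m by (simp add: field_simps power2_eq_square)
      finally show "u t x * ln (u t x) - (u1 t x)\<^sup>2 / u t x / (8 * pi\<^sup>2) \<le> (ln m + 1) * u t x + ((u t x - m)\<^sup>2 / m - m)"
        using p[of x] by (smt (verit) divide_nonneg_pos mult_pos_pos pi_gt_zero zero_le_power2 zero_less_power)
    qed (use p m in auto)
    also have "\<dots> \<le> integral {0..1} (\<lambda>x. (ln m + 1) * u t x + (\<epsilon> - m))"
      by (intro integral_le continuous_UNIV_integrable_on continuous_intros cst) (use um e m in \<open>auto simp: field_simps\<close>)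
    also have "\<dots> = (ln m + 1) * m + (\<epsilon> - m)"
      by (subst Henstock_Kurzweil_Integration.integral_add) (auto intro!: continuous_UNIV_integrable_on continuous_intros cst simp: mass t)
    finally show "\<phi> 0 \<le> m * ln m + \<epsilon>" by (simp add: algebra_simps)
  qed
  moreover have "\<phi> 0 = integral {0..1} (\<lambda>x. u 0 x * ln (u 0 x)) - integral {0..1} (\<lambda>x. (u1 0 x)\<^sup>2 / u 0 x) / (8 * pi\<^sup>2)"
    unfolding \<phi>_def integral_divide[symmetric]
    by (intro Henstock_Kurzweil_Integration.integral_diff continuous_UNIV_integrable_on continuous_intros cs)
      (use pos0 in \<open>auto simp: less_imp_neq[symmetric]\<close>)
  ultimately show ?thesis by (simp add: g m_def)
qed

section \<open>Density of trigonometric polynomials and passage to general periodic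
  functions\<close>

definition trig :: "(real \<Rightarrow> real) set" where
  "trig = (\<lambda>u. u 0) ` heat"

lemma trig_gen: "(\<lambda>x. a * cos (2 * pi * of_int k * x + c)) \<in> trig"
proof -
  have "(\<lambda>t x. a * exp (- (2 * pi * of_int k)\<^sup>2 * t) * cos (2 * pi * of_int k * x + c)) 0 \<in> trig"
    unfolding trig_def by (intro imageI heat.gen)
  then show ?thesis by simp
qed

lemma trig_const: "(\<lambda>x. a) \<in> trig"
  using trig_gen[of a 0 0] by simp

lemma trig_add: "p \<in> trig \<Longrightarrow> q \<in> trig \<Longrightarrow> (\<lambda>x. p x + q x) \<in> trig"
  unfolding trig_def using heat.add by (auto simp: image_iff)

lemma trig_induct [consumes 1, case_names gen add]:
  assumes "p \<in> trig" "\<And>a k c. P (\<lambda>x. a * cos (2 * pi * of_int k * x + c))"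
    "\<And>p q. p \<in> trig \<Longrightarrow> q \<in> trig \<Longrightarrow> P p \<Longrightarrow> P q \<Longrightarrow> P (\<lambda>x. p x + q x)"
  shows "P p"
proof -
  obtain u where "u \<in> heat" "p = u 0" using assms(1) by (auto simp: trig_def)
  from this(1) have "P (u 0)"
  proof induction
    case (gen a k c) then show ?case using assms(2)[of a k c] by simp
  next
    case (add u w) then show ?case by (intro assms(3)) (auto simp: trig_def)
  qed
  then show ?thesis using \<open>p = u 0\<close> by simp
qed

lemma trig_mult: "p \<in> trig \<Longrightarrow> q \<in> trig \<Longrightarrow> (\<lambda>x. p x * q x) \<in> trig"
proof (induction arbitrary: q rule: trig_induct)
  case (gen a k c)
  from gen show ?case
  proof (induction rule: trig_induct)
    case (gen b l d)
    have "(a * cos (2 * pi * of_int k * x + c)) * (b * cos (2 * pi * of_int l * x + d)) =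
      (a * b / 2) * cos (2 * pi * of_int (k - l) * x + (c - d)) + (a * b / 2) * cos (2 * pi * of_int (k + l) * x + (c + d))" for x
    proof -
      define \<theta> where "\<theta> = 2 * pi * of_int k * x + c"
      define \<eta> where "\<eta> = 2 * pi * of_int l * x + d"
      have "2 * pi * of_int (k - l) * x + (c - d) = \<theta> - \<eta>" "2 * pi * of_int (k + l) * x + (c + d) = \<theta> + \<eta>"
        by (simp_all add: \<theta>_def \<eta>_def algebra_simps)
      then show ?thesis unfolding \<theta>_def[symmetric] \<eta>_def[symmetric]
        by (simp only: cos_add cos_diff) (simp add: algebra_simps)
    qed
    then show ?case
      using trig_add[OF trig_gen[of "a * b / 2" "k - l" "c - d"] trig_gen[of "a * b / 2" "k + l" "c + d"]] by simp
  next
    case (add p q) then show ?case using trig_add by (simp add: distrib_left)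
  qed
next
  case (add p p') then show ?case using trig_add by (simp add: distrib_right)
qed

text \<open>The link to the Stone-Weierstrass theorem on the unit circle: linear functionals of
  \<open>cis (2 * pi * x)\<close> are combinations of a cosine and a sine, and \<open>trig\<close>
  is closed under sums and products.\<close>

lemma trig_polynomial_cis:
  assumes "real_polynomial_function p"
  shows "(\<lambda>x. p (cis (2 * pi * x))) \<in> trig"
  using assms
proof induction
  case (linear f)
  have "f (cis (2 * pi * x)) = f 1 * cos (2 * pi * of_int 1 * x + 0) + f \<i> * cos (2 * pi * of_int 1 * x + (- pi/2))" for x
  proof -
    have "cis (2 * pi * x) = cos (2 * pi * x) *\<^sub>R 1 + sin (2 * pi * x) *\<^sub>R \<i>"
      by (simp add: complex_eq_iff)
    then show ?thesis
      using linear by (simp add: linear_simps cos_diff mult.commute)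
  qed
  then show ?case using trig_add[OF trig_gen[of "f 1" 1 0] trig_gen[of "f \<i>" 1 "- pi/2"]] by simp
qed (auto intro: trig_const trig_add trig_mult)

text \<open>The constant mode has no periodic antiderivative, hence the correction
  \<open>c\<close>.\<close>

lemma trig_antiderivative:
  "p \<in> trig \<Longrightarrow> \<exists>P\<in>trig. \<exists>c. \<forall>x. (P has_real_derivative p x - c) (at x)"
proof (induction rule: trig_induct)
  case (gen a k c)
  show ?case
  proof (cases "k = 0")
    case True
    then show ?thesis using trig_const[of 0] by (intro bexI[of _ "\<lambda>x. 0"] exI[of _ "a * cos c"]) auto
  next
    case False
    have "sin y = cos (y + - pi/2)" for y :: real by (simp add: cos_diff)
    then have s: "sin (2 * pi * real_of_int k * x + c) = cos (2 * pi * of_int k * x + (c + - pi/2))" for x by (metis add.assoc)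
    have "((\<lambda>x. a / (2 * pi * of_int k) * sin (2 * pi * of_int k * x + c)) has_real_derivative a * cos (2 * pi * of_int k * x + c) - 0) (at x)" for x
      using False by (auto intro!: derivative_eq_intros)
    moreover have "(\<lambda>x. a / (2 * pi * of_int k) * sin (2 * pi * of_int k * x + c)) \<in> trig"
      unfolding s by (rule trig_gen)
    ultimately show ?thesis by blast
  qed
next
  case (add p q)
  then obtain P Q c d where PQ: "P \<in> trig" "Q \<in> trig" "\<And>x. (P has_real_derivative p x - c) (at x)"
    "\<And>x. (Q has_real_derivative q x - d) (at x)" by blast
  have "((\<lambda>x. P x + Q x) has_real_derivative (p x + q x) - (c + d)) (at x)" for x
    using DERIV_add[OF PQ(3,4)] by (simp add: algebra_simps)
  then show ?case using trig_add[OF PQ(1,2)] by blast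
qed

lemma trig_dense:
  fixes g :: "real \<Rightarrow> real"
  assumes c: "continuous_on UNIV g" and p: "\<And>x. g (x + 1) = g x" and e: "e > 0"
  obtains q where "q \<in> trig" "\<And>x. \<bar>g x - q x\<bar> < e"
proof -
  define Q where "Q z = g (Arg2pi z / (2 * pi))" for z
  have Q: "Q (cis (2 * pi * x)) = g x" for x
  proof -
    have "cis (2 * pi * x) = cis (2 * pi * frac x)"
    proof -
      have "cis (2 * pi * x) = cis (2 * pi * frac x + 2 * pi * of_int \<lfloor>x\<rfloor>)" by (simp add: frac_def algebra_simps)
      then show ?thesis by (simp flip: cis_mult)
    qed
    moreover have "Arg2pi (cis (2 * pi * frac x)) = 2 * pi * frac x"
      using frac_lt_1[of x] by (intro Arg2pi_unique[of 1]) (auto simp: frac_ge_0 cis_conv_exp)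
    ultimately show ?thesis using period_frac[of g x, OF p] by (simp add: Q_def)
  qed
  have S: "sphere 0 1 = (\<lambda>x. cis (2 * pi * x)) ` {0..1}"
  proof (intro equalityI subsetI)
    fix z :: complex assume "z \<in> sphere 0 1"
    then have "z = cis (2 * pi * (Arg2pi z / (2 * pi)))"
      using Arg2pi_eq[of z] by (simp add: cis_conv_exp)
    moreover have "Arg2pi z / (2 * pi) \<in> {0..1}" using Arg2pi_ge_0[of z] Arg2pi_lt_2pi[of z] by simp
    ultimately show "z \<in> (\<lambda>x. cis (2 * pi * x)) ` {0..1}" by blast
  qed auto
  \<comment> \<open>\<open>Arg2pi\<close> jumps across the positive real axis, so continuity comes
    from the parametrization: preimages of closed sets are images of compact subsets of the period
    interval.\<close>
  have "continuous_on (sphere 0 1) Q"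
  proof (subst continuous_on_closed_vimage[OF closed_sphere], intro allI impI)
    fix B :: "real set" assume B: "closed B"
    have "Q -` B \<inter> sphere 0 1 = (\<lambda>x. cis (2 * pi * x)) ` ({0..1} \<inter> g -` B)"
      unfolding S by (auto simp: Q)
    moreover have "compact ({0..1} \<inter> g -` B)"
      by (intro compact_Int_closed compact_Icc continuous_closed_vimage B)
         (use c in \<open>simp add: continuous_on_eq_continuous_at\<close>)
    ultimately show "closed (Q -` B \<inter> sphere 0 1)"
      by (auto intro!: compact_imp_closed compact_continuous_image continuous_intros)
  qed
  from Stone_Weierstrass_real_polynomial_function[OF compact_sphere this e]
  obtain P where P: "real_polynomial_function P" "\<And>z. z \<in> sphere 0 1 \<Longrightarrow> \<bar>Q z - P z\<bar> < e" by blast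
  show ?thesis
    by (rule that[OF trig_polynomial_cis[OF P(1)]]) (use P(2)[of "cis (2 * pi * _)"] in \<open>simp add: Q\<close>)
qed

text \<open>Approximating the derivative and integrating controls the function and its derivative
  together; the price is the mean \<open>k\<close>, which must be removed for the primitive to be
  periodic.\<close>

lemma trig_dense_C1:
  fixes g g' :: "real \<Rightarrow> real"
  assumes dg: "\<And>x. (g has_real_derivative g' x) (at x)" and c: "continuous_on UNIV g'"
    and p: "\<And>x. g (x + 1) = g x" and e: "e > 0"
  obtains u q where "u \<in> heat" "\<And>x. (u 0 has_real_derivative q x) (at x)" "\<And>x. \<bar>u 0 x - g x\<bar> \<le> e" "\<And>x. \<bar>q x - g' x\<bar> \<le> e"
proof -
  have p': "g' (x + 1) = g' x" for x
  proof -
    have "((\<lambda>x. g (x + 1)) has_real_derivative g' (x + 1)) (at x)" using DERIV_shift dg by blast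
    then show ?thesis using DERIV_unique[OF dg[of x]] p by simp
  qed
  obtain r where r: "r \<in> trig" "\<And>x. \<bar>g' x - r x\<bar> < e / 2" using trig_dense[OF c p', of "e/2"] e by auto
  obtain P k where P: "P \<in> trig" "\<And>x. (P has_real_derivative r x - k) (at x)" using trig_antiderivative[OF r(1)] by blast
  obtain w where w: "w \<in> heat" "P = w 0" using P(1) by (auto simp: trig_def)
  have perP: "P (x + 1) = P x" for x using heat_periodic[OF w(1)] w(2) by simp
  have dD: "((\<lambda>x. P x - g x) has_real_derivative (r x - g' x) - k) (at x)" for x
    using DERIV_diff[OF P(2) dg] by (simp add: algebra_simps)
  \<comment> \<open>\<open>P - g\<close> has equal values at 0 and 1, so by the mean value theorem
    \<open>k\<close> is a value of \<open>r - g'\<close>.\<close>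
  have "k \<in> {- (e/2) .. e/2}"
  proof -
    have "\<exists>z. z > 0 \<and> z < 1 \<and> (P 1 - g 1) - (P 0 - g 0) = (1 - 0) * ((r z - g' z) - k)"
      using MVT2[of 0 1 "\<lambda>x. P x - g x", OF _ dD] by auto
    then obtain z where "k = r z - g' z" using perP[of 0] p[of 0] by auto
    then show ?thesis using r(2)[of z] unfolding atLeastAtMost_iff by linarith
  qed
  then have small: "\<bar>(r x - k) - g' x\<bar> \<le> e" for x using r(2)[of x] unfolding atLeastAtMost_iff by linarith
  \<comment> \<open>Makes the error vanish at 0; on a period of length 1 it is then bounded by the
    error of the derivative.\<close>
  define b where "b = g 0 - P 0"
  have "(\<lambda>t x. w t x + b * exp (- (2 * pi * of_int 0)\<^sup>2 * t) * cos (2 * pi * of_int 0 * x + 0)) \<in> heat"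
    by (intro heat.add w heat.gen)
  then have u: "(\<lambda>t x. w t x + b) \<in> heat" by simp
  have close: "\<bar>P x + b - g x\<bar> \<le> e" for x
  proof -
    have *: "\<bar>P x + b - g x\<bar> \<le> e" if "x \<in> {0..1}" for x
    proof (cases "x = 0")
      case True then show ?thesis using e by (simp add: b_def)
    next
      case False
      then have "\<exists>z. z > 0 \<and> z < x \<and> (P x - g x) - (P 0 - g 0) = (x - 0) * ((r z - g' z) - k)"
        using that by (intro MVT2 dD) auto
      then obtain z where z: "P x + b - g x = x * ((r z - k) - g' z)" by (auto simp: b_def algebra_simps)
      have "\<bar>P x + b - g x\<bar> = \<bar>x\<bar> * \<bar>(r z - k) - g' z\<bar>" by (simp add: z abs_mult)
      also have "\<dots> \<le> 1 * e" using that by (intro mult_mono small) auto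
      finally show ?thesis by simp
    qed
    have "P x + b - g x = P (frac x) + b - g (frac x)"
      using period_frac[of "\<lambda>x. P x + b - g x" x] perP p by simp
    then show ?thesis using *[of "frac x"] by (simp add: frac_ge_0 frac_lt_1 less_imp_le)
  qed
  have du: "((\<lambda>x. w 0 x + b) has_real_derivative r x - k) (at x)" for x
    using P(2)[of x] w(2) by (auto intro!: derivative_eq_intros)
  show ?thesis by (rule that[OF u]) (use du close small w(2) in auto)
qed

text \<open>The functions \<open>h\<close> in question (a logarithm, a quotient) are unbounded near
  the boundary of their domain. Keeping all values in one compact set supplies the bound for
  dominated convergence.\<close>

lemma integral_tendsto_continuous_image:
  fixes h :: "real \<times> real \<Rightarrow> real"
  assumes K: "compact K" "continuous_on K h"
    and v: "\<And>n. continuous_on UNIV (v n)" "\<And>n x. v n x \<in> K" "\<And>x. w x \<in> K" "\<And>x. (\<lambda>n. v n x) \<longlonglongrightarrow> w x"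
  shows "(\<lambda>n. integral {0..1::real} (\<lambda>x. h (v n x))) \<longlonglongrightarrow> integral {0..1} (\<lambda>x. h (w x))"
proof -
  have "bounded (h ` K)" using compact_continuous_image[OF K(2,1)] compact_imp_bounded by blast
  then obtain B where B: "\<And>z. z \<in> K \<Longrightarrow> norm (h z) \<le> B" by (auto simp: bounded_iff)
  show ?thesis
  proof (rule dominated_convergence(2)[where h="\<lambda>x. B"])
    show "(\<lambda>x. h (v k x)) integrable_on {0..1}" for k
      by (intro continuous_UNIV_integrable_on continuous_on_compose2[OF K(2) v(1)]) (use v(2) in auto)
    show "(\<lambda>n. h (v n x)) \<longlonglongrightarrow> h (w x)" for x
      by (rule continuous_on_tendsto_compose[OF K(2) v(4,3)]) (use v(2) in auto)
  qed (use B v(2) in auto)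
qed

lemma circle_log_sobolev:
  fixes g g' :: "real \<Rightarrow> real"
  assumes dg: "\<And>x. (g has_real_derivative g' x) (at x)" and c: "continuous_on UNIV g'"
    and p: "\<And>x. g (x + 1) = g x" and pos: "\<And>x. 0 < g x"
  shows "integral {0..1} (\<lambda>x. g x * ln (g x)) - integral {0..1} g * ln (integral {0..1} g)
    \<le> integral {0..1} (\<lambda>x. (g' x)\<^sup>2 / g x) / (8 * pi\<^sup>2)"
proof -
  have cg: "continuous_on UNIV g" using dg by (intro continuous_at_imp_continuous_on ballI DERIV_isCont)
  have p': "g' (x + 1) = g' x" for x
  proof -
    have "((\<lambda>x. g (x + 1)) has_real_derivative g' (x + 1)) (at x)" using DERIV_shift dg by blast
    then show ?thesis using DERIV_unique[OF dg[of x]] p by simp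
  qed
  obtain m where m: "m > 0" "\<And>x. m \<le> g x" using periodic_pos_lower_bound[OF cg p pos] by blast
  obtain M where M: "\<And>x. \<bar>g x\<bar> \<le> M" using periodic_bound[OF cg p] by blast
  obtain B where B: "\<And>x. \<bar>g' x\<bar> \<le> B" using periodic_bound[OF c p'] by blast
  \<comment> \<open>At most \<open>m / 2\<close>, so that all approximants stay above
    \<open>m / 2\<close> and their logarithms are uniformly controlled.\<close>
  define e where "e n = (m / 2) / real (Suc n)" for n
  have e: "0 < e n" "e n \<le> m / 2" for n using m by (auto simp: e_def field_simps)
  have el: "e \<longlonglongrightarrow> 0" unfolding e_def by real_asymp
  have "\<exists>u q. u \<in> heat \<and> (\<forall>x. (u 0 has_real_derivative q x) (at x)) \<and> (\<forall>x. \<bar>u 0 x - g x\<bar> \<le> e n) \<and> (\<forall>x. \<bar>q x - g' x\<bar> \<le> e n)" for n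
    using trig_dense_C1[OF dg c p e(1)] by metis
  then obtain u q where u: "\<And>n. u n \<in> heat" "\<And>n x. (u n 0 has_real_derivative q n x) (at x)"
    "\<And>n x. \<bar>u n 0 x - g x\<bar> \<le> e n" "\<And>n x. \<bar>q n x - g' x\<bar> \<le> e n" by metis
  have cu: "continuous_on UNIV (u n 0)" for n by (rule heat_continuous_slice[OF u(1)])
  have cq: "continuous_on UNIV (q n)" for n
  proof -
    obtain u1 u2 where "u1 \<in> heat" "\<And>t x. (u n t has_real_derivative u1 t x) (at x)" using heat_derivs[OF u(1)] by metis
    then have "q n = u1 0" using DERIV_unique[OF u(2)] by blast
    then show ?thesis using heat_continuous_slice[OF \<open>u1 \<in> heat\<close>] by simp
  qed
  define K where "K = {m/2..M + m/2} \<times> {- B - m/2..B + m/2}"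
  have K: "compact K" unfolding K_def by (intro compact_Times compact_Icc)
  have v: "continuous_on UNIV (\<lambda>x. (u n 0 x, q n x))" for n by (intro continuous_intros cu cq)
  have vK: "(u n 0 x, q n x) \<in> K" for n x
    using u(3)[of n x] u(4)[of n x] m(2)[of x] M[of x] B[of x] e(2)[of n] by (auto simp: K_def abs_le_iff)
  have wK: "(g x, g' x) \<in> K" for x
    using m(1) m(2)[of x] M[of x] B[of x] by (auto simp: K_def abs_le_iff)
  have lim: "(\<lambda>n. (u n 0 x, q n x)) \<longlonglongrightarrow> (g x, g' x)" for x
  proof (intro tendsto_Pair)
    show "(\<lambda>n. u n 0 x) \<longlonglongrightarrow> g x" "(\<lambda>n. q n x) \<longlonglongrightarrow> g' x"
      by (rule LIM_zero_cancel, rule Lim_null_comparison[OF _ el], use u(3,4) in simp)+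
  qed
  note L = integral_tendsto_continuous_image[OF K _ v vK wK lim]
  have posK: "fst z > 0" if "z \<in> K" for z using that m by (auto simp: K_def)
  have "fst z \<noteq> 0" if "z \<in> K" for z using posK[OF that] by simp
  then have h1: "continuous_on K (\<lambda>z. fst z * ln (fst z))" and h2: "continuous_on K (\<lambda>z. (snd z)\<^sup>2 / fst z)"
    by (auto intro!: continuous_intros)
  have L1: "(\<lambda>n. integral {0..1} (\<lambda>x. u n 0 x * ln (u n 0 x))) \<longlonglongrightarrow> integral {0..1} (\<lambda>x. g x * ln (g x))"
    using L[of "\<lambda>z. fst z * ln (fst z)"] h1 by simp
  have L2: "(\<lambda>n. integral {0..1} (u n 0)) \<longlonglongrightarrow> integral {0..1} g"
    using L[of fst, OF continuous_on_fst[OF continuous_on_id]] by simp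
  have L3: "(\<lambda>n. integral {0..1} (\<lambda>x. (q n x)\<^sup>2 / u n 0 x)) \<longlonglongrightarrow> integral {0..1} (\<lambda>x. (g' x)\<^sup>2 / g x)"
    using L[of "\<lambda>z. (snd z)\<^sup>2 / fst z"] h2 by simp
  have "0 < m" by fact
  also have "m = integral {0..1::real} (\<lambda>x. m)" by simp
  also have "\<dots> \<le> integral {0..1} g" by (intro integral_le continuous_UNIV_integrable_on cg) (auto simp: m)
  finally have "integral {0..1} g \<noteq> 0" by simp
  then have "(\<lambda>n. integral {0..1} (\<lambda>x. u n 0 x * ln (u n 0 x)) - integral {0..1} (u n 0) * ln (integral {0..1} (u n 0)))
    \<longlonglongrightarrow> integral {0..1} (\<lambda>x. g x * ln (g x)) - integral {0..1} g * ln (integral {0..1} g)"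
    by (intro tendsto_intros L1 L2)
  moreover have "(\<lambda>n. integral {0..1} (\<lambda>x. (q n x)\<^sup>2 / u n 0 x) / (8 * pi\<^sup>2)) \<longlonglongrightarrow> integral {0..1} (\<lambda>x. (g' x)\<^sup>2 / g x) / (8 * pi\<^sup>2)"
    by (intro tendsto_intros L3) auto
  moreover have "0 < u n 0 x" for n x using posK[OF vK] by simp
  ultimately show ?thesis
    using heat_log_sobolev[OF u(1) _ u(2)] by (intro LIMSEQ_le) auto
qed

section \<open>Calculus on the torus\<close>

lemma torus_integrable:
  fixes f :: "real^'d \<Rightarrow> 'b::euclidean_space"
  assumes "continuous_on UNIV f"
  shows "integrable torus f"
  unfolding torus_def by (rule continuous_imp_integrable, rule continuous_on_subset[OF assms]) auto

lemma torus_integral_eq: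
  fixes f :: "real^'d \<Rightarrow> 'b::euclidean_space"
  assumes "continuous_on UNIV f"
  shows "(\<integral>x. f x \<partial>torus) = integral (cbox 0 1) f"
  using torus_integrable[OF assms] unfolding torus_def by (intro lebesgue_integral_eq_integral) auto

lemma space_torus: "space (torus :: (real^'d) measure) = cbox 0 1"
  by (simp add: torus_def)

lemma prob_space_torus: "prob_space (torus :: (real^'d) measure)"
proof
  have B: "(1 :: real^'d) \<bullet> b = 1" if "b \<in> Basis" for b
    using that by (auto simp: Basis_vec_def inner_axis)
  have "emeasure (torus :: (real^'d) measure) (cbox 0 1) = emeasure lborel (cbox 0 (1::real^'d))"
    by (simp add: torus_def emeasure_restrict_space)
  also have "\<dots> = 1"
    by (subst emeasure_lborel_cbox) (simp_all add: B)
  finally show "emeasure (torus :: (real^'d) measure) (space torus) = 1"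
    by (simp add: space_torus)
qed

interpretation torus: prob_space "torus :: (real^'d) measure"
  by (rule prob_space_torus)

lemma torus_mono:
  fixes f g :: "real^'d \<Rightarrow> real"
  assumes "continuous_on UNIV f" "continuous_on UNIV g" "\<And>x. f x \<le> g x"
  shows "(\<integral>x. f x \<partial>torus) \<le> (\<integral>x. g x \<partial>torus)"
  by (intro integral_mono torus_integrable assms)

section \<open>Translation invariance and averages over one coordinate\<close>

lemma mem_cbox_split_coordinate:
  fixes x :: "real^'d"
  shows "x \<in> cbox a b \<longleftrightarrow> a $ i \<le> x $ i \<and> x $ i \<le> b $ i \<and> (\<forall>j. j \<noteq> i \<longrightarrow> a $ j \<le> x $ j \<and> x $ j \<le> b $ j)"
proof
  assume R: "a $ i \<le> x $ i \<and> x $ i \<le> b $ i \<and> (\<forall>j. j \<noteq> i \<longrightarrow> a $ j \<le> x $ j \<and> x $ j \<le> b $ j)"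
  show "x \<in> cbox a b" unfolding mem_box_cart
  proof
    fix j show "a $ j \<le> x $ j \<and> x $ j \<le> b $ j" using R by (cases "j = i") auto
  qed
qed (simp add: mem_box_cart)

text \<open>The shifted cube is cut along the hyperplane where coordinate \<open>i\<close> equals 1,
  and the slab beyond it is moved back by one period.\<close>

lemma torus_shift:
  fixes f :: "real^'d \<Rightarrow> real"
  assumes c: "continuous_on UNIV f" and p: "periodic f" and s: "s \<in> {0..1}"
  shows "(\<integral>x. f (x + s *\<^sub>R axis i 1) \<partial>torus) = (\<integral>x. f x \<partial>torus)"
proof -
  let ?e = "axis i 1 :: real^'d"
  have int: "f integrable_on cbox a b" for a b
    by (intro integrable_continuous continuous_on_subset[OF c]) auto
  have B: "?e \<in> Basis" by simp
  have e: "?e $ j = (if j = i then 1 else 0)" "x \<bullet> ?e = x $ i" for j x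
    by (simp add: axis_def, simp add: inner_axis)
  have s1: "cbox (s *\<^sub>R ?e) (1 + s *\<^sub>R ?e) \<inter> {x. x \<bullet> ?e \<le> 1} = cbox (s *\<^sub>R ?e) 1"
    "cbox (s *\<^sub>R ?e) (1 + s *\<^sub>R ?e) \<inter> {x. x \<bullet> ?e \<ge> 1} = cbox ?e (1 + s *\<^sub>R ?e)"
    "cbox 0 1 \<inter> {x. x \<bullet> ?e \<le> s} = cbox 0 (1 + s *\<^sub>R ?e - ?e)"
    "cbox 0 1 \<inter> {x. x \<bullet> ?e \<ge> s} = cbox (s *\<^sub>R ?e) 1"
    using s by (auto simp: set_eq_iff mem_cbox_split_coordinate[of _ _ _ i] e)
  have "integral (cbox 0 1) (\<lambda>x. f (x + s *\<^sub>R ?e)) = integral (cbox (s *\<^sub>R ?e) (1 + s *\<^sub>R ?e)) f"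
    using integral_shift_cbox[of "s *\<^sub>R ?e" "s *\<^sub>R ?e" "1 + s *\<^sub>R ?e" f] by simp
  also have "\<dots> = integral (cbox (s *\<^sub>R ?e) 1) f + integral (cbox ?e (1 + s *\<^sub>R ?e)) f"
    using integral_split[OF int B, of "s *\<^sub>R ?e" "1 + s *\<^sub>R ?e" 1] unfolding s1 .
  also have "integral (cbox ?e (1 + s *\<^sub>R ?e)) f = integral (cbox 0 (1 + s *\<^sub>R ?e - ?e)) f"
    using integral_shift_cbox[of "?e" ?e "1 + s *\<^sub>R ?e" f] p by (simp add: periodic_def)
  also have "integral (cbox (s *\<^sub>R ?e) 1) f + integral (cbox 0 (1 + s *\<^sub>R ?e - ?e)) f = integral (cbox 0 1) f"
    using integral_split[OF int B, of 0 1 s] unfolding s1 by simp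
  finally show ?thesis
    using c by (subst (1 2) torus_integral_eq) (auto intro!: continuous_on_compose2[OF c] continuous_intros)
qed

text \<open>Integrates out one coordinate but keeps a function on the full torus, so that the
  tensorization never changes the dimension or splits the torus into a product.\<close>

definition line_average :: "'d \<Rightarrow> (real^'d \<Rightarrow> real) \<Rightarrow> real^'d \<Rightarrow> real" where
  "line_average i f x = integral {0..1} (\<lambda>s. f (x + s *\<^sub>R axis i 1))"

lemma line_continuous:
  fixes f :: "real^'d \<Rightarrow> 'b::topological_space"
  shows "continuous_on UNIV f \<Longrightarrow> continuous_on A (\<lambda>s::real. f (x + s *\<^sub>R axis i 1))"
  by (erule continuous_on_compose2) (auto intro!: continuous_intros)

lemma line_average_continuous:
  assumes c: "continuous_on UNIV f"
  shows "continuous_on UNIV (line_average i f)"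
proof -
  have "continuous_on UNIV (\<lambda>x. integral (cbox 0 1) (\<lambda>s. f (x + s *\<^sub>R axis i 1)))"
    by (rule integral_continuous_on_param)
      (auto simp: case_prod_beta intro!: continuous_on_compose2[OF c] continuous_intros)
  then show ?thesis by (simp add: line_average_def[abs_def])
qed

lemma line_average_periodic: "periodic f \<Longrightarrow> periodic (line_average i f)"
proof -
  assume p: "periodic f"
  have "f (x + axis k 1 + s *\<^sub>R axis i 1) = f (x + s *\<^sub>R axis i 1)" for x k s
  proof -
    have "x + axis k 1 + s *\<^sub>R axis i 1 = (x + s *\<^sub>R axis i 1) + axis k 1" by (simp only: add_ac)
    then show ?thesis using p by (simp only: periodic_def)
  qed
  then show ?thesis by (simp add: periodic_def line_average_def)
qed

text \<open>Swapping the integrals leaves integrals of translates of \<open>f\<close>, which all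
  agree by \<open>torus_shift\<close>.\<close>

lemma torus_line_average:
  assumes c: "continuous_on UNIV f" and p: "periodic f"
  shows "(\<integral>x. line_average i f x \<partial>torus) = (\<integral>x. f x \<partial>torus)"
proof -
  have cs: "continuous_on UNIV (\<lambda>x. f (x + s *\<^sub>R axis i 1))" for s
    by (auto intro!: continuous_on_compose2[OF c] continuous_intros)
  have "(\<integral>x. line_average i f x \<partial>torus) = integral (cbox 0 1) (\<lambda>x. integral (cbox 0 1) (\<lambda>s. f (x + s *\<^sub>R axis i 1)))"
    by (subst torus_integral_eq) (auto simp: line_average_def[abs_def] intro!: line_average_continuous[OF c, unfolded line_average_def[abs_def]])
  also have "\<dots> = integral (cbox 0 1) (\<lambda>s. integral (cbox 0 1) (\<lambda>x. f (x + s *\<^sub>R axis i 1)))"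
    by (rule integral_swap_continuous) (auto simp: case_prod_beta intro!: continuous_on_compose2[OF c] continuous_intros)
  also have "\<dots> = integral (cbox 0 1) (\<lambda>s::real. (\<integral>x. f x \<partial>torus))"
    proof (rule integral_cong)
    fix s :: real assume "s \<in> cbox 0 1"
    then show "integral (cbox 0 1) (\<lambda>x. f (x + s *\<^sub>R axis i 1)) = (\<integral>x. f x \<partial>torus)"
      using torus_shift[OF c p, of s i] torus_integral_eq[OF cs[of s]] by simp
  qed
  finally show ?thesis by simp
qed

text \<open>The gradient is carried along explicitly because \<open>partial\<close> is a junk value at points of
  non-differentiability.\<close>

definition torus_C1 :: "(real^'d \<Rightarrow> real) \<Rightarrow> (real^'d \<Rightarrow> real^'d) \<Rightarrow> bool" where
  "torus_C1 f G \<longleftrightarrow> periodic f \<and> continuous_on UNIV G \<and> (\<forall>x. GDERIV f x :> G x)"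

lemma torus_C1_D:
  assumes "torus_C1 f G"
  shows "periodic f" "continuous_on UNIV G" "GDERIV f x :> G x"
  using assms by (auto simp: torus_C1_def)

lemma torus_C1_continuous:
  assumes "torus_C1 f G" shows "continuous_on UNIV f"
  using assms unfolding torus_C1_def gderiv_def
  by (intro continuous_at_imp_continuous_on ballI has_derivative_continuous) blast

lemma GDERIV_unique:
  assumes "GDERIV f x :> a" "GDERIV f x :> b" shows "a = b"
proof -
  have "(\<lambda>h. h \<bullet> a) = (\<lambda>h. h \<bullet> b)"
    using assms unfolding gderiv_def by (rule has_derivative_unique)
  from fun_cong[OF this, of "a - b"] have "(a - b) \<bullet> (a - b) = 0" by (simp add: inner_diff_right)
  then show ?thesis by simp
qed

lemma torus_C1_periodic:
  assumes "torus_C1 f G" shows "periodic G"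
  unfolding periodic_def
proof (intro allI)
  fix x i
  have "(\<lambda>x. f (x + axis i 1)) = f" using assms by (auto simp: torus_C1_def periodic_def)
  moreover have "GDERIV (\<lambda>x. f (x + axis i 1)) x :> G (x + axis i 1)"
  proof -
    have "(f has_derivative (\<lambda>h. h \<bullet> G (x + axis i 1))) (at (x + axis i 1))"
      using torus_C1_D(3)[OF assms] by (simp add: gderiv_def)
    moreover have "((\<lambda>x. x + axis i 1) has_derivative (\<lambda>h. h)) (at x)"
      by (auto intro!: derivative_eq_intros)
    ultimately show ?thesis unfolding gderiv_def
      by (rule has_derivative_compose[rotated])
  qed
  ultimately have "GDERIV f x :> G (x + axis i 1)" by simp
  then show "G (x + axis i 1) = G x"
    by (rule GDERIV_unique) (rule torus_C1_D(3)[OF assms])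
qed

lemma torus_C1_line:
  assumes "torus_C1 f G"
  shows "((\<lambda>s. f (x + s *\<^sub>R axis i 1)) has_real_derivative G (x + s *\<^sub>R axis i 1) $ i) (at s)"
proof -
  have "(f has_derivative (\<lambda>h. h \<bullet> G (x + s *\<^sub>R axis i 1))) (at (x + s *\<^sub>R axis i 1))"
    using torus_C1_D(3)[OF assms] by (simp add: gderiv_def)
  moreover have "((\<lambda>s. x + s *\<^sub>R axis i 1) has_derivative (\<lambda>h. h *\<^sub>R axis i 1)) (at s)"
    by (auto intro!: derivative_eq_intros)
  ultimately have "((\<lambda>s. f (x + s *\<^sub>R axis i 1)) has_derivative (\<lambda>h. (h *\<^sub>R axis i 1) \<bullet> G (x + s *\<^sub>R axis i 1))) (at s)"
    by (rule has_derivative_compose[rotated])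
  moreover have "(\<lambda>h. (h *\<^sub>R axis i 1) \<bullet> G (x + s *\<^sub>R axis i 1)) = (*) (G (x + s *\<^sub>R axis i 1) $ i)"
    by (auto simp: fun_eq_iff inner_axis')
  ultimately show ?thesis by (simp only: has_field_derivative_def)
qed

lemma periodic_line:
  assumes "periodic f" shows "f (x + (s + 1) *\<^sub>R axis i 1) = f (x + s *\<^sub>R axis i 1)"
proof -
  have "x + (s + 1) *\<^sub>R axis i 1 = (x + s *\<^sub>R axis i 1) + axis i 1"
    by (simp only: scaleR_add_left scaleR_one add.assoc)
  then show ?thesis using assms by (simp only: periodic_def)
qed

lemma line_average_gradient:
  assumes "torus_C1 f G"
  shows "line_average i (\<lambda>x. G x $ i) x = 0"
  unfolding line_average_def
  by (rule integral_deriv_periodic[OF torus_C1_line[OF assms, of x i]])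
    (rule periodic_line[OF torus_C1_D(1)[OF assms]])

lemma torus_gradient:
  assumes "torus_C1 f G"
  shows "(\<integral>x. G x $ i \<partial>torus) = 0"
proof -
  have c: "continuous_on UNIV (\<lambda>x. G x $ i)" by (intro continuous_intros torus_C1_D(2)[OF assms])
  have p: "periodic (\<lambda>x. G x $ i)" using torus_C1_periodic[OF assms] by (simp add: periodic_def)
  show ?thesis using torus_line_average[OF c p, of i] line_average_gradient[OF assms, of i] by simp
qed

lemma torus_C1_mult:
  assumes "torus_C1 f F" "torus_C1 g G"
  shows "torus_C1 (\<lambda>x. f x * g x) (\<lambda>x. f x *\<^sub>R G x + g x *\<^sub>R F x)"
  using assms torus_C1_continuous[OF assms(1)] torus_C1_continuous[OF assms(2)]
  by (auto simp: torus_C1_def periodic_def intro!: continuous_intros GDERIV_mult)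

lemma torus_C1_add:
  assumes "torus_C1 f F" "torus_C1 g G"
  shows "torus_C1 (\<lambda>x. f x + g x) (\<lambda>x. F x + G x)"
  using assms by (auto simp: torus_C1_def periodic_def intro!: continuous_intros GDERIV_add)

lemma torus_C1_diff:
  assumes "torus_C1 f F" "torus_C1 g G"
  shows "torus_C1 (\<lambda>x. f x - g x) (\<lambda>x. F x - G x)"
  using assms by (auto simp: torus_C1_def periodic_def intro!: continuous_intros GDERIV_diff)

lemma torus_C1_const: "torus_C1 (\<lambda>x. c) (\<lambda>x. 0)"
  by (auto simp: torus_C1_def periodic_def GDERIV_const)

lemma torus_C1_cmult:
  assumes "torus_C1 f F"
  shows "torus_C1 (\<lambda>x. c * f x) (\<lambda>x. c *\<^sub>R F x)"
  using torus_C1_mult[OF torus_C1_const assms, of c] by simp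

lemma torus_C1_compose:
  assumes f: "torus_C1 f F" and j: "\<And>x. (j has_real_derivative j' (f x)) (at (f x))"
    and c: "continuous_on UNIV (\<lambda>x. j' (f x))"
  shows "torus_C1 (\<lambda>x. j (f x)) (\<lambda>x. j' (f x) *\<^sub>R F x)"
  unfolding torus_C1_def
proof (intro conjI allI)
  show "GDERIV (\<lambda>x. j (f x)) x :> j' (f x) *\<^sub>R F x" for x
    by (rule GDERIV_DERIV_compose[OF torus_C1_D(3)[OF f] j])
qed (use torus_C1_D[OF f] c in \<open>auto simp: periodic_def intro!: continuous_intros\<close>)

lemma torus_by_parts:
  assumes f: "torus_C1 f F" and g: "torus_C1 g G"
  shows "(\<integral>x. f x * G x $ i \<partial>torus) = - (\<integral>x. F x $ i * g x \<partial>torus)"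
proof -
  note c = torus_C1_continuous[OF f] torus_C1_continuous[OF g] torus_C1_D(2)[OF f] torus_C1_D(2)[OF g]
  have "0 = (\<integral>x. (f x * G x $ i + F x $ i * g x) \<partial>torus)"
    using torus_gradient[OF torus_C1_mult[OF f g], of i] by (simp add: mult.commute)
  also have "\<dots> = (\<integral>x. f x * G x $ i \<partial>torus) + (\<integral>x. F x $ i * g x \<partial>torus)"
    by (intro Bochner_Integration.integral_add torus_integrable continuous_intros c)
  finally show ?thesis by simp
qed

lemma torus_C1_line_average:
  fixes f :: "real^'d \<Rightarrow> real"
  assumes f: "torus_C1 f G"
  shows "torus_C1 (line_average i f) (\<lambda>x. \<chi> k. line_average i (\<lambda>y. G y $ k) x)"
  unfolding torus_C1_def
proof (intro conjI allI)
  note cG = torus_C1_D(2)[OF f]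
  have cs: "continuous_on S (\<lambda>s. G (x + s *\<^sub>R axis i 1))" for x S by (rule line_continuous[OF cG])
  show "periodic (line_average i f)" by (rule line_average_periodic[OF torus_C1_D(1)[OF f]])
  show "continuous_on UNIV (\<lambda>x. \<chi> k. line_average i (\<lambda>y. G y $ k) x)"
    by (intro continuous_on_vec_lambda line_average_continuous continuous_intros cG)
  fix x
  have "((\<lambda>x. integral (cbox 0 1) (\<lambda>s. f (x + s *\<^sub>R axis i 1))) has_derivative
     blinfun_apply (integral (cbox 0 1) (\<lambda>s. blinfun_inner_left (G (x + s *\<^sub>R axis i 1))))) (at x within UNIV)"
  proof (rule leibniz_rule)
    fix x s
    have "(f has_derivative (\<lambda>h. h \<bullet> G (x + s *\<^sub>R axis i 1))) (at (x + s *\<^sub>R axis i 1))"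
      using torus_C1_D(3)[OF f] by (simp add: gderiv_def)
    moreover have "((\<lambda>x. x + s *\<^sub>R axis i 1) has_derivative (\<lambda>h. h)) (at x)"
      by (auto intro!: derivative_eq_intros)
    ultimately have "((\<lambda>x. f (x + s *\<^sub>R axis i 1)) has_derivative (\<lambda>h. h \<bullet> G (x + s *\<^sub>R axis i 1))) (at x)"
      by (rule has_derivative_compose[rotated])
    then show "((\<lambda>x. f (x + s *\<^sub>R axis i 1)) has_derivative blinfun_apply (blinfun_inner_left (G (x + s *\<^sub>R axis i 1)))) (at x within UNIV)"
      by simp
  next
    show "(\<lambda>s. f (x + s *\<^sub>R axis i 1)) integrable_on cbox 0 1" for x
      by (intro integrable_continuous line_continuous torus_C1_continuous[OF f])
    show "continuous_on (UNIV \<times> cbox 0 1) (\<lambda>(x, s). blinfun_inner_left (G (x + s *\<^sub>R axis i 1)))"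
      by (auto simp: case_prod_beta intro!: bounded_linear.continuous_on[OF bounded_linear_blinfun_inner_left] continuous_on_compose2[OF cG] continuous_intros)
  qed auto
  moreover have "blinfun_apply (integral (cbox 0 1) (\<lambda>s. blinfun_inner_left (G (x + s *\<^sub>R axis i 1))))
      = (\<lambda>h. h \<bullet> (\<chi> k. line_average i (\<lambda>y. G y $ k) x))"
  proof -
    have I: "(\<lambda>s. G (x + s *\<^sub>R axis i 1)) integrable_on cbox 0 1" by (intro integrable_continuous cs)
    have v: "(\<chi> k. line_average i (\<lambda>y. G y $ k) x) = integral (cbox 0 1) (\<lambda>s. G (x + s *\<^sub>R axis i 1))"
      using integral_linear[OF I bounded_linear_vec_nth] by (simp add: vec_eq_iff line_average_def o_def)
    have "integral (cbox 0 1) (\<lambda>s. blinfun_inner_left (G (x + s *\<^sub>R axis i 1)))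
       = blinfun_inner_left (integral (cbox 0 1) (\<lambda>s. G (x + s *\<^sub>R axis i 1)))"
      using integral_linear[OF I bounded_linear_blinfun_inner_left] by (simp add: o_def)
    then show ?thesis by (simp add: v fun_eq_iff)
  qed
  ultimately show "GDERIV (line_average i f) x :> (\<chi> k. line_average i (\<lambda>y. G y $ k) x)"
    unfolding gderiv_def by (simp add: line_average_def[abs_def])
qed

section \<open>Functional inequalities on the torus\<close>

lemma periodic_unit_cube:
  fixes f :: "real^'d \<Rightarrow> 'b"
  assumes p: "periodic f"
  obtains y where "y \<in> cbox 0 1" "f y = f x"
proof -
  define z where "z S = (\<chi> i. if i \<in> S then frac (x $ i) else x $ i)" for S
  have "f (z S) = f x" if "finite S" for S
    using that
  proof induction
    case empty
    then show ?case by (simp add: z_def vec_lambda_unique)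
  next
    case (insert i S)
    define w where "w = z S - (x $ i) *\<^sub>R axis i 1"
    have a: "z S = w + (x $ i) *\<^sub>R axis i 1" by (simp add: w_def)
    have b: "z (insert i S) = w + frac (x $ i) *\<^sub>R axis i 1"
      using insert.hyps by (simp add: w_def z_def vec_eq_iff axis_def)
    have "f (w + (x $ i) *\<^sub>R axis i 1) = f (w + frac (x $ i) *\<^sub>R axis i 1)"
      by (rule period_frac[of "\<lambda>s. f (w + s *\<^sub>R axis i 1)"]) (rule periodic_line[OF p])
    then show ?case using insert.IH by (simp only: a b)
  qed
  then have "f (z UNIV) = f x" by simp
  moreover have "z UNIV \<in> cbox 0 1" by (simp add: z_def mem_box_cart frac_ge_0 frac_lt_1 less_imp_le)
  ultimately show ?thesis using that by blast
qed

lemma periodic_bounded: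
  fixes f :: "real^'d \<Rightarrow> 'b::real_normed_vector"
  assumes c: "continuous_on UNIV f" and p: "periodic f"
  obtains B where "B > 0" "\<And>x. norm (f x) \<le> B"
proof -
  have "compact (f ` cbox 0 1)"
    by (intro compact_continuous_image continuous_on_subset[OF c] compact_cbox) auto
  then obtain B where B: "B > 0" "\<And>y. y \<in> cbox 0 1 \<Longrightarrow> norm (f y) \<le> B"
    using compact_imp_bounded bounded_pos by (metis imageI)
  have "norm (f x) \<le> B" for x
  proof -
    obtain y where "y \<in> cbox 0 1" "f y = f x" using periodic_unit_cube[OF p] by blast
    then show ?thesis using B(2)[of y] by simp
  qed
  then show ?thesis using that B(1) by blast
qed

lemma periodic_positive_lower_bound:
  fixes f :: "real^'d \<Rightarrow> real"
  assumes c: "continuous_on UNIV f" and p: "periodic f" and pos: "\<And>x. 0 < f x"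
  obtains m where "m > 0" "\<And>x. m \<le> f x"
proof -
  have "cbox 0 (1::real^'d) \<noteq> {}" using space_torus torus.not_empty by metis
  then have "\<exists>x\<in>cbox 0 1. \<forall>y\<in>cbox 0 1. f x \<le> f y"
    by (intro continuous_attains_inf compact_cbox continuous_on_subset[OF c]) auto
  then obtain x0 where x0: "\<And>y. y \<in> cbox 0 1 \<Longrightarrow> f x0 \<le> f y" by metis
  have "f x0 \<le> f x" for x
  proof -
    obtain y where "y \<in> cbox 0 1" "f y = f x" using periodic_unit_cube[OF p] by blast
    then show ?thesis using x0[of y] by simp
  qed
  then show ?thesis using that pos by blast
qed

section \<open>Logarithmic Sobolev and Poincare inequalities\<close>

lemma integral_square_over_weight:
  fixes a f :: "real \<Rightarrow> real"
  assumes a: "continuous_on UNIV a" and f: "continuous_on UNIV f" and pos: "\<And>x. 0 < f x"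
  shows "(integral {0..1} a)\<^sup>2 / integral {0..1} f \<le> integral {0..1} (\<lambda>x. (a x)\<^sup>2 / f x)"
proof (cases "integral {0..1} f = 0")
  case True
  have "0 \<le> integral {0..1} (\<lambda>x. (a x)\<^sup>2 / f x)"
    by (intro integral_nonneg continuous_UNIV_integrable_on continuous_intros a f) (use pos in \<open>auto simp: less_imp_le less_imp_neq[symmetric]\<close>)
  then show ?thesis using True by simp
next
  case False
  \<comment> \<open>The value minimizing the integral of
    \<open>(a x - c * f x)\<^sup>2 / f x\<close>; its nonnegativity is then the weighted
    Cauchy-Schwarz inequality.\<close>
  define c where "c = integral {0..1} a / integral {0..1} f"
  have ne: "f x \<noteq> 0" for x using pos[of x] by simp
  have "0 \<le> integral {0..1} (\<lambda>x. (a x - c * f x)\<^sup>2 / f x)"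
    by (intro integral_nonneg continuous_UNIV_integrable_on continuous_intros a f) (use pos ne in \<open>auto simp: less_imp_le\<close>)
  also have "\<dots> = integral {0..1} (\<lambda>x. ((a x)\<^sup>2 / f x - (2 * c) * a x) + c\<^sup>2 * f x)"
  proof (rule integral_cong)
    fix x show "(a x - c * f x)\<^sup>2 / f x = ((a x)\<^sup>2 / f x - (2 * c) * a x) + c\<^sup>2 * f x"
      using ne[of x] by (simp add: field_simps power2_eq_square)
  qed
  also have "\<dots> = (integral {0..1} (\<lambda>x. (a x)\<^sup>2 / f x) - 2 * c * integral {0..1} a) + c\<^sup>2 * integral {0..1} f"
  proof -
    have i: "(\<lambda>x. (a x)\<^sup>2 / f x) integrable_on {0..1}" "(\<lambda>x. (2 * c) * a x) integrable_on {0..1}" "(\<lambda>x. c\<^sup>2 * f x) integrable_on {0..1}"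
      by (intro continuous_UNIV_integrable_on continuous_intros a f; use ne in simp)+
    show ?thesis
      using Henstock_Kurzweil_Integration.integral_add[OF Henstock_Kurzweil_Integration.integrable_diff[OF i(1,2)] i(3)]
        Henstock_Kurzweil_Integration.integral_diff[OF i(1,2)] by simp
  qed
  also have "\<dots> = integral {0..1} (\<lambda>x. (a x)\<^sup>2 / f x) - (integral {0..1} a)\<^sup>2 / integral {0..1} f"
    using False by (simp add: c_def field_simps power2_eq_square)
  finally show ?thesis by simp
qed

lemma line_average_mono:
  fixes f g :: "real^'d \<Rightarrow> real"
  assumes "continuous_on UNIV f" "continuous_on UNIV g" "\<And>x. f x \<le> g x"
  shows "line_average i f x \<le> line_average i g x"
  unfolding line_average_def by (intro integral_le continuous_UNIV_integrable_on line_continuous assms)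

lemma line_average_pos:
  fixes f :: "real^'d \<Rightarrow> real"
  assumes c: "continuous_on UNIV f" and p: "periodic f" and pos: "\<And>x. 0 < f x"
  shows "0 < line_average i f x"
proof -
  obtain m where m: "m > 0" "\<And>x. m \<le> f x" using periodic_positive_lower_bound[OF c p pos] by blast
  have "line_average i (\<lambda>x. m) x \<le> line_average i f x"
    by (intro line_average_mono c m(2) continuous_intros)
  then show ?thesis using m(1) by (simp add: line_average_def)
qed

lemma line_log_sobolev:
  fixes f :: "real^'d \<Rightarrow> real"
  assumes f: "torus_C1 f G" and pos: "\<And>x. 0 < f x"
  shows "(\<integral>x. f x * ln (f x) \<partial>torus) - (\<integral>x. line_average i f x * ln (line_average i f x) \<partial>torus)
    \<le> (\<integral>x. (G x $ i)\<^sup>2 / f x \<partial>torus) / (8 * pi\<^sup>2)"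
proof -
  note c = torus_C1_continuous[OF f] torus_C1_D(2)[OF f]
  note p = torus_C1_D(1)[OF f] torus_C1_periodic[OF f]
  have ne: "f x \<noteq> 0" for x using pos[of x] by simp
  have lpos: "0 < line_average i f x" for x by (rule line_average_pos[OF c(1) p(1) pos])
  then have lne: "line_average i f x \<noteq> 0" for x by (metis less_irrefl)
  have cc: "continuous_on UNIV (\<lambda>x. f x * ln (f x))" "continuous_on UNIV (\<lambda>x. (G x $ i)\<^sup>2 / f x)"
    "continuous_on UNIV (\<lambda>x. line_average i f x * ln (line_average i f x))"
    by (intro continuous_intros c line_average_continuous; use ne pos lne in simp)+
  have pp: "periodic (\<lambda>x. f x * ln (f x))" "periodic (\<lambda>x. (G x $ i)\<^sup>2 / f x)"
    using p by (auto simp: periodic_def)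
  have *: "line_average i (\<lambda>x. f x * ln (f x)) x - line_average i f x * ln (line_average i f x)
      \<le> line_average i (\<lambda>x. (G x $ i)\<^sup>2 / f x) x / (8 * pi\<^sup>2)" for x
    unfolding line_average_def
  proof (rule circle_log_sobolev)
    show "((\<lambda>s. f (x + s *\<^sub>R axis i 1)) has_real_derivative G (x + s *\<^sub>R axis i 1) $ i) (at s)" for s
      by (rule torus_C1_line[OF f])
    show "continuous_on UNIV (\<lambda>s. G (x + s *\<^sub>R axis i 1) $ i)"
      by (intro continuous_intros line_continuous c)
  qed (auto simp: pos periodic_line[OF p(1)])
  have "(\<integral>x. f x * ln (f x) \<partial>torus) - (\<integral>x. line_average i f x * ln (line_average i f x) \<partial>torus)
    = (\<integral>x. line_average i (\<lambda>x. f x * ln (f x)) x - line_average i f x * ln (line_average i f x) \<partial>torus)"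
    unfolding torus_line_average[OF cc(1) pp(1), of i, symmetric]
    by (intro Bochner_Integration.integral_diff[symmetric] torus_integrable cc line_average_continuous)
  also have "\<dots> \<le> (\<integral>x. line_average i (\<lambda>x. (G x $ i)\<^sup>2 / f x) x / (8 * pi\<^sup>2) \<partial>torus)"
    by (intro torus_mono * continuous_on_diff cc line_average_continuous continuous_on_divide continuous_on_const) auto
  also have "\<dots> = (\<integral>x. (G x $ i)\<^sup>2 / f x \<partial>torus) / (8 * pi\<^sup>2)"
    using torus_line_average[OF cc(2) pp(2), of i] by (simp only: integral_divide_zero)
  finally show ?thesis .
qed

text \<open>The map taking \<open>(p, r)\<close> to \<open>p\<^sup>2 / r\<close> is jointly convex,
  so averaging both the derivative and the function cannot raise the Fisher information in direction
  \<open>k\<close>.\<close>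

lemma line_average_fisher:
  fixes f :: "real^'d \<Rightarrow> real"
  assumes f: "torus_C1 f G" and pos: "\<And>x. 0 < f x"
  shows "(\<integral>x. (line_average i (\<lambda>y. G y $ k) x)\<^sup>2 / line_average i f x \<partial>torus) \<le> (\<integral>x. (G x $ k)\<^sup>2 / f x \<partial>torus)"
proof -
  note c = torus_C1_continuous[OF f] torus_C1_D(2)[OF f]
  note p = torus_C1_D(1)[OF f] torus_C1_periodic[OF f]
  have ne: "f x \<noteq> 0" for x using pos[of x] by simp
  have lpos: "0 < line_average i f x" for x by (rule line_average_pos[OF c(1) p(1) pos])
  then have lne: "line_average i f x \<noteq> 0" for x by (metis less_irrefl)
  have cG: "continuous_on UNIV (\<lambda>x. G x $ k)" by (intro continuous_intros c)
  have cc: "continuous_on UNIV (\<lambda>x. (G x $ k)\<^sup>2 / f x)"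
    by (intro continuous_intros c) (use ne in simp)
  have pp: "periodic (\<lambda>x. (G x $ k)\<^sup>2 / f x)"
    using p by (auto simp: periodic_def)
  have "(\<integral>x. (line_average i (\<lambda>y. G y $ k) x)\<^sup>2 / line_average i f x \<partial>torus) \<le> (\<integral>x. line_average i (\<lambda>x. (G x $ k)\<^sup>2 / f x) x \<partial>torus)"
  proof (rule torus_mono)
    show "continuous_on UNIV (\<lambda>x. (line_average i (\<lambda>y. G y $ k) x)\<^sup>2 / line_average i f x)"
      by (intro continuous_intros line_average_continuous c) (use lne in simp)
    show "continuous_on UNIV (line_average i (\<lambda>x. (G x $ k)\<^sup>2 / f x))"
      by (rule line_average_continuous[OF cc])
    show "(line_average i (\<lambda>y. G y $ k) x)\<^sup>2 / line_average i f x \<le> line_average i (\<lambda>x. (G x $ k)\<^sup>2 / f x) x" for x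
      unfolding line_average_def
      by (rule integral_square_over_weight) (intro line_continuous cG c pos)+
  qed
  then show ?thesis using torus_line_average[OF cc pp, of i] by simp
qed

text \<open>The logarithmic Sobolev inequality is tensorized by averaging out one coordinate at a time.\<close>

lemma torus_log_sobolev_coordinates:
  fixes f :: "real^'d \<Rightarrow> real"
  assumes "finite S" "torus_C1 f G" "\<And>x. 0 < f x" "\<And>k x. k \<notin> S \<Longrightarrow> G x $ k = 0"
  shows "(\<integral>x. f x * ln (f x) \<partial>torus) - (\<integral>x. f x \<partial>torus) * ln (\<integral>x. f x \<partial>torus)
    \<le> (\<Sum>k\<in>S. (\<integral>x. (G x $ k)\<^sup>2 / f x \<partial>torus) / (8 * pi\<^sup>2))"
  using assms
proof (induction S arbitrary: f G)
  case empty
  then have "G x = 0" for x by (simp add: vec_eq_iff)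
  then have "(f has_derivative (\<lambda>h. 0)) (at x within UNIV)" for x
    using torus_C1_D(3)[OF empty(1), of x] by (simp add: gderiv_def)
  then have "\<exists>c. \<forall>x\<in>UNIV. f x = c"
    by (intro has_derivative_zero_constant) auto
  then obtain c where "f = (\<lambda>x. c)" by auto
  then show ?case by (simp add: torus.prob_space)
next
  case (insert i S)
  note f = insert.prems(1)
  define g where "g = line_average i f"
  define H where "H x = (\<chi> k. line_average i (\<lambda>y. G y $ k) x)" for x
  have g: "torus_C1 g H" unfolding g_def H_def by (rule torus_C1_line_average[OF f])
  have gpos: "0 < g x" for x unfolding g_def
    by (rule line_average_pos[OF torus_C1_continuous[OF f] torus_C1_D(1)[OF f] insert.prems(2)])
  \<comment> \<open>The average no longer varies in direction \<open>i\<close>, and directions in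
    which \<open>f\<close> was constant stay so; this fits the induction hypothesis for
    \<open>S\<close> without \<open>i\<close>.\<close>
  have H0: "H x $ k = 0" if "k \<notin> S" for k x
  proof (cases "k = i")
    case True then show ?thesis using line_average_gradient[OF f] by (simp add: H_def)
  next
    case False then show ?thesis using that insert.prems(3) by (simp add: H_def line_average_def)
  qed
  have mass: "(\<integral>x. g x \<partial>torus) = (\<integral>x. f x \<partial>torus)"
    unfolding g_def by (rule torus_line_average[OF torus_C1_continuous[OF f] torus_C1_D(1)[OF f]])
  have "(\<integral>x. g x * ln (g x) \<partial>torus) - (\<integral>x. g x \<partial>torus) * ln (\<integral>x. g x \<partial>torus)
     \<le> (\<Sum>k\<in>S. (\<integral>x. (H x $ k)\<^sup>2 / g x \<partial>torus) / (8 * pi\<^sup>2))"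
    by (rule insert.IH[OF g gpos H0])
  also have "\<dots> \<le> (\<Sum>k\<in>S. (\<integral>x. (G x $ k)\<^sup>2 / f x \<partial>torus) / (8 * pi\<^sup>2))"
    using line_average_fisher[OF f insert.prems(2), of i]
    by (intro sum_mono divide_right_mono) (simp_all add: H_def g_def)
  finally have "(\<integral>x. g x * ln (g x) \<partial>torus) - (\<integral>x. f x \<partial>torus) * ln (\<integral>x. f x \<partial>torus)
     \<le> (\<Sum>k\<in>S. (\<integral>x. (G x $ k)\<^sup>2 / f x \<partial>torus) / (8 * pi\<^sup>2))" unfolding mass .
  moreover have "(\<integral>x. f x * ln (f x) \<partial>torus) - (\<integral>x. g x * ln (g x) \<partial>torus)
    \<le> (\<integral>x. (G x $ i)\<^sup>2 / f x \<partial>torus) / (8 * pi\<^sup>2)"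
    unfolding g_def by (rule line_log_sobolev[OF f insert.prems(2)])
  ultimately show ?case using insert.hyps by simp
qed

lemma norm_vec_power2: "(norm (v::real^'d))\<^sup>2 = (\<Sum>k\<in>UNIV. (v $ k)\<^sup>2)"
  unfolding power2_norm_eq_inner inner_vec_def by (simp add: power2_eq_square)

theorem torus_log_sobolev:
  fixes f :: "real^'d \<Rightarrow> real"
  assumes f: "torus_C1 f G" and pos: "\<And>x. 0 < f x"
  shows "(\<integral>x. f x * ln (f x) \<partial>torus) - (\<integral>x. f x \<partial>torus) * ln (\<integral>x. f x \<partial>torus)
    \<le> (\<integral>x. (norm (G x))\<^sup>2 / f x \<partial>torus) / (8 * pi\<^sup>2)"
proof -
  note c = torus_C1_continuous[OF f] torus_C1_D(2)[OF f]
  have ne: "f x \<noteq> 0" for x using pos[of x] by simp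
  have "(\<Sum>k\<in>UNIV. (\<integral>x. (G x $ k)\<^sup>2 / f x \<partial>torus) / (8 * pi\<^sup>2)) = (\<Sum>k\<in>UNIV. \<integral>x. (G x $ k)\<^sup>2 / f x \<partial>torus) / (8 * pi\<^sup>2)"
    by (simp only: sum_divide_distrib)
  also have "(\<Sum>k\<in>UNIV. \<integral>x. (G x $ k)\<^sup>2 / f x \<partial>torus) = (\<integral>x. (\<Sum>k\<in>UNIV. (G x $ k)\<^sup>2 / f x) \<partial>torus)"
    by (rule Bochner_Integration.integral_sum[symmetric])
      (auto intro!: torus_integrable continuous_intros c simp: ne)
  also have "(\<lambda>x. \<Sum>k\<in>UNIV. (G x $ k)\<^sup>2 / f x) = (\<lambda>x. (norm (G x))\<^sup>2 / f x)"
    by (simp add: norm_vec_power2 sum_divide_distrib)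
  finally show ?thesis using torus_log_sobolev_coordinates[OF finite_class.finite_UNIV f pos] by simp
qed

text \<open>Taylor expansion at 1: the second derivative \<open>1 / x\<close> of
  \<open>x * ln x\<close> is at least \<open>1 / c\<close> up to \<open>c\<close>.\<close>

lemma xlnx_quadratic_lower_bound:
  fixes x c :: real
  assumes x: "0 < x" "x \<le> c" and c: "1 \<le> c"
  shows "(x - 1)\<^sup>2 / (2 * c) \<le> x * ln x - x + 1"
proof -
  define \<phi> where "\<phi> x = x * ln x - x + 1 - (x - 1)\<^sup>2 / (2 * c)" for x
  have d: "(\<phi> has_real_derivative (ln y - (y - 1) / c)) (at y)" if "y > 0" for y
    unfolding \<phi>_def using that c by (auto intro!: derivative_eq_intros simp: field_simps)
  have "\<phi> 1 \<le> \<phi> x"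
  proof (cases "1 \<le> x")
    case True
    show ?thesis
    proof (rule DERIV_nonneg_imp_nondecreasing[OF True])
      fix y assume y: "1 \<le> y" "y \<le> x"
      have "(y - 1) / c \<le> (y - 1) / y" using y x by (intro divide_left_mono) auto
      also have "\<dots> \<le> ln y" using ln_le_minus_one[of "1 / y"] y by (simp add: ln_div field_simps)
      finally show "\<exists>z. (\<phi> has_real_derivative z) (at y) \<and> 0 \<le> z" using d[of y] y by auto
    qed
  next
    case False
    then have le: "x \<le> 1" by simp
    show ?thesis
    proof (rule DERIV_nonpos_imp_nonincreasing[OF le])
      fix y assume y: "x \<le> y" "y \<le> 1"
      have "ln y \<le> y - 1" using ln_le_minus_one[of y] x y by simp
      also have "\<dots> \<le> (y - 1) / c"
      proof -
        have "(1 - y) / c \<le> (1 - y) / 1" using y c by (intro divide_left_mono) auto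
        then show ?thesis by (simp add: minus_divide_left[symmetric] diff_divide_distrib)
      qed
      finally show "\<exists>z. (\<phi> has_real_derivative z) (at y) \<and> z \<le> 0" using d[of y] x y by auto
    qed
  qed
  then show ?thesis by (simp add: \<phi>_def)
qed

text \<open>The Poincare inequality is the linearization of the logarithmic Sobolev inequality at the
  constant function 1.\<close>

theorem torus_poincare:
  fixes u :: "real^'d \<Rightarrow> real"
  assumes u: "torus_C1 u G" and mean: "(\<integral>x. u x \<partial>torus) = 0"
  shows "4 * pi\<^sup>2 * (\<integral>x. (u x)\<^sup>2 \<partial>torus) \<le> (\<integral>x. (norm (G x))\<^sup>2 \<partial>torus)"
proof -
  note c = torus_C1_continuous[OF u] torus_C1_D(2)[OF u]
  obtain B where B: "B > 0" "\<And>x. norm (u x) \<le> B" using periodic_bounded[OF c(1) torus_C1_D(1)[OF u]] by blast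
  define U where "U = (\<integral>x. (u x)\<^sup>2 \<partial>torus)"
  define D where "D = (\<integral>x. (norm (G x))\<^sup>2 \<partial>torus)"
  have main: "4 * pi\<^sup>2 * ((1 - \<delta>) * U) \<le> (1 + \<delta>) * D" if \<delta>: "0 < \<delta>" "\<delta> < 1" for \<delta>
  proof -
    \<comment> \<open>Keeps \<open>1 + \<epsilon> * u x\<close> within \<delta> of 1. Both sides of
      the resulting inequality carry the factor \<open>\<epsilon>\<^sup>2\<close>, which cancels, so
      that only \<delta> has to tend to 0.\<close>
    define \<epsilon> where "\<epsilon> = \<delta> / B"
    have \<epsilon>: "\<epsilon> > 0" using \<delta> B by (simp add: \<epsilon>_def)
    have eu: "\<bar>\<epsilon> * u x\<bar> \<le> \<delta>" for x
      using B(2)[of x] B(1) \<delta> by (simp add: \<epsilon>_def abs_mult field_simps)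
    define f where "f x = 1 + \<epsilon> * u x" for x
    have f: "torus_C1 f (\<lambda>x. \<epsilon> *\<^sub>R G x)"
      unfolding f_def using torus_C1_add[OF torus_C1_const torus_C1_cmult[OF u]] by simp
    have b: "1 - \<delta> \<le> f x" "f x \<le> 1 + \<delta>" for x using eu[of x] by (auto simp: f_def abs_le_iff)
    have pos: "0 < f x" for x using b(1)[of x] \<delta> by linarith
    have ne: "f x \<noteq> 0" for x using pos[of x] by simp
    note cf = torus_C1_continuous[OF f]
    have m: "(\<integral>x. f x \<partial>torus) = 1"
      unfolding f_def by (subst Bochner_Integration.integral_add)
        (auto intro!: torus_integrable continuous_intros c simp: mean torus.prob_space)
    have "\<epsilon>\<^sup>2 / (2 * (1 + \<delta>)) * U = (\<integral>x. \<epsilon>\<^sup>2 / (2 * (1 + \<delta>)) * (u x)\<^sup>2 \<partial>torus)" by (simp add: U_def)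
    also have "\<dots> \<le> (\<integral>x. f x * ln (f x) - f x + 1 \<partial>torus)"
    proof (rule torus_mono)
      show "\<epsilon>\<^sup>2 / (2 * (1 + \<delta>)) * (u x)\<^sup>2 \<le> f x * ln (f x) - f x + 1" for x
        using xlnx_quadratic_lower_bound[OF pos b(2), of x] \<delta> by (simp add: f_def power_mult_distrib)
    qed (intro continuous_intros c cf; use ne pos \<delta> in simp)+
    also have "\<dots> = (\<integral>x. f x * ln (f x) \<partial>torus) - (\<integral>x. f x \<partial>torus) + 1"
    proof -
      have i: "integrable torus (\<lambda>x. f x * ln (f x))" "integrable torus f"
        by (intro torus_integrable continuous_intros cf; use ne in simp)+
      show ?thesis using i by (simp add: torus.prob_space)
    qed
    also have "\<dots> = (\<integral>x. f x * ln (f x) \<partial>torus) - (\<integral>x. f x \<partial>torus) * ln (\<integral>x. f x \<partial>torus)" by (simp add: m)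
    also have "\<dots> \<le> (\<integral>x. (norm (\<epsilon> *\<^sub>R G x))\<^sup>2 / f x \<partial>torus) / (8 * pi\<^sup>2)"
      by (rule torus_log_sobolev[OF f pos])
    also have "\<dots> \<le> (\<integral>x. \<epsilon>\<^sup>2 / (1 - \<delta>) * (norm (G x))\<^sup>2 \<partial>torus) / (8 * pi\<^sup>2)"
    proof (intro divide_right_mono torus_mono)
      show "(norm (\<epsilon> *\<^sub>R G x))\<^sup>2 / f x \<le> \<epsilon>\<^sup>2 / (1 - \<delta>) * (norm (G x))\<^sup>2" for x
      proof -
        have "(norm (\<epsilon> *\<^sub>R G x))\<^sup>2 / f x \<le> (norm (\<epsilon> *\<^sub>R G x))\<^sup>2 / (1 - \<delta>)"
          using b(1)[of x] pos[of x] \<delta> by (intro divide_left_mono) auto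
        then show ?thesis by (simp add: power_mult_distrib)
      qed
      show "0 \<le> 8 * pi\<^sup>2" by simp
    qed (intro continuous_intros c cf; use ne \<delta> in simp)+
    also have "\<dots> = \<epsilon>\<^sup>2 / (1 - \<delta>) * D / (8 * pi\<^sup>2)" by (simp add: D_def)
    finally have "\<epsilon>\<^sup>2 * (U / (2 * (1 + \<delta>))) \<le> \<epsilon>\<^sup>2 * (D / ((1 - \<delta>) * (8 * pi\<^sup>2)))" by simp
    then have "U / (2 * (1 + \<delta>)) \<le> D / ((1 - \<delta>) * (8 * pi\<^sup>2))"
      by (simp only: mult_le_cancel_left_pos[OF zero_less_power[OF \<epsilon>]])
    moreover have "U / a \<le> D / b \<Longrightarrow> U * b \<le> D * a" if "a > 0" "b > 0" for a b
      using that by (simp add: field_simps)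
    ultimately have "U * ((1 - \<delta>) * (8 * pi\<^sup>2)) \<le> D * (2 * (1 + \<delta>))"
      using \<delta> by simp
    moreover have "U * ((1 - \<delta>) * (8 * pi\<^sup>2)) = 2 * (4 * pi\<^sup>2 * ((1 - \<delta>) * U))" "D * (2 * (1 + \<delta>)) = 2 * ((1 + \<delta>) * D)"
      by simp_all
    ultimately show ?thesis by linarith
  qed
  have "4 * pi\<^sup>2 * ((1 - 0) * U) \<le> (1 + 0) * D"
  proof (rule LIMSEQ_le)
    show "(\<lambda>n. 4 * pi\<^sup>2 * ((1 - 1 / real (n + 2)) * U)) \<longlonglongrightarrow> 4 * pi\<^sup>2 * ((1 - 0) * U)"
      by (intro tendsto_intros, real_asymp)
    show "(\<lambda>n. (1 + 1 / real (n + 2)) * D) \<longlonglongrightarrow> (1 + 0) * D"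
      by (intro tendsto_intros, real_asymp)
    show "\<exists>N. \<forall>n\<ge>N. 4 * pi\<^sup>2 * ((1 - 1 / real (n + 2)) * U) \<le> (1 + 1 / real (n + 2)) * D"
      by (intro exI[of _ 0] allI impI main) auto
  qed
  then show ?thesis by (simp add: U_def D_def)
qed

section \<open>Weak form of the equation\<close>

lemma torus_integral_zero:
  fixes f :: "real^'d \<Rightarrow> real"
  assumes c: "continuous_on UNIV f" and p: "periodic f" and nn: "\<And>x. 0 \<le> f x" and 0: "(\<integral>x. f x \<partial>torus) = 0"
  shows "f x = 0"
proof -
  have "box 0 (1::real^'d) \<noteq> {}"
  proof -
    have "(\<chi> i. 1/2) \<in> box 0 (1::real^'d)" by (simp add: mem_box_cart)
    then show ?thesis by blast
  qed
  moreover have "continuous_on (cbox 0 1) f" by (rule continuous_on_subset[OF c]) simp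
  ultimately have "integral (cbox 0 1) f = 0 \<longleftrightarrow> (\<forall>x\<in>cbox 0 1. f x = 0)"
    using nn by (intro integral_cbox_eq_0_iff) auto
  then have "\<forall>x\<in>cbox 0 1. f x = 0" using 0 torus_integral_eq[OF c] by simp
  moreover obtain y where "y \<in> cbox 0 1" "f y = f x" using periodic_unit_cube[OF p] by blast
  ultimately show ?thesis by metis
qed

text \<open>\<open>Linf_norm\<close> is an essential supremum, while the estimates below are
  pointwise; continuity closes the gap.\<close>

lemma torus_AE_le:
  fixes f :: "real^'d \<Rightarrow> real"
  assumes c: "continuous_on UNIV f" and p: "periodic f" and ae: "AE x in torus. f x \<le> r"
  shows "f x \<le> r"
proof -
  have "(\<integral>x. max 0 (f x - r) \<partial>torus) = 0"
  proof -
    have "AE x in torus. max 0 (f x - r) = 0" using ae by eventually_elim simp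
    moreover have "(\<lambda>x. max 0 (f x - r)) \<in> borel_measurable torus"
      by (intro borel_measurable_integrable torus_integrable continuous_intros c)
    ultimately show ?thesis using integral_cong_AE[of "\<lambda>x. max 0 (f x - r)" torus "\<lambda>x. 0"] by simp
  qed
  then have "max 0 (f x - r) = 0"
    by (intro torus_integral_zero[of "\<lambda>x. max 0 (f x - r)"] continuous_intros c)
      (use p in \<open>auto simp: periodic_def\<close>)
  then show ?thesis by simp
qed

lemma norm_le_Linf_norm:
  fixes f :: "real^'d \<Rightarrow> 'b::euclidean_space"
  assumes c: "continuous_on UNIV f" and p: "periodic f"
  shows "norm (f x) \<le> Linf_norm f"
proof -
  obtain B where B: "B > 0" "\<And>x. norm (f x) \<le> B" using periodic_bounded[OF c p] by blast
  define e where "e = esssup torus (\<lambda>x. ereal (norm (f x)))"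
  have m: "(\<lambda>x. ereal (norm (f x))) \<in> borel_measurable torus"
    by (intro borel_measurable_ereal borel_measurable_integrable torus_integrable continuous_intros c)
  have ae: "AE x in torus. ereal (norm (f x)) \<le> e" unfolding e_def by (rule esssup_AE)
  \<comment> \<open>\<open>real_of_ereal\<close> sends infinite values to 0, so \<open>e\<close>
    must be seen to be finite before it can serve as a bound.\<close>
  have "e \<le> ereal B" unfolding e_def by (rule esssup_I[OF m]) (simp add: B)
  moreover have "0 \<le> e"
  proof -
    have "AE x in (torus :: (real^'d) measure). 0 \<le> e" using ae by eventually_elim (meson ereal_less_eq(5) norm_ge_zero order_trans)
    then show ?thesis by simp
  qed
  ultimately obtain r where r: "e = ereal r" by (cases e) auto
  have "AE x in torus. norm (f x) \<le> r" using ae by (simp add: r)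
  then have "norm (f x) \<le> r"
    by (intro torus_AE_le[of "\<lambda>x. norm (f x)"] continuous_intros c) (use p in \<open>auto simp: periodic_def\<close>)
  then show ?thesis by (simp add: Linf_norm_def e_def[symmetric] r)
qed

lemma Linf_norm_nonneg:
  fixes f :: "real^'d \<Rightarrow> 'b::euclidean_space"
  assumes "continuous_on UNIV f" "periodic f"
  shows "0 \<le> Linf_norm f"
  using norm_le_Linf_norm[OF assms] norm_ge_zero order_trans by blast

section \<open>Classical derivatives, convolutions and the flux\<close>

lemma torus_C1_of_C1:
  assumes C1: "C1 f" and p: "periodic f"
  shows "torus_C1 f (grad f)"
  unfolding torus_C1_def
proof (intro conjI allI p)
  show "continuous_on UNIV (grad f)"
    using C1 unfolding C1_def grad_def[abs_def] by (intro continuous_on_vec_lambda) blast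
  fix x
  let ?D = "frechet_derivative f (at x)"
  have D: "(f has_derivative ?D) (at x)" using C1 by (simp add: C1_def frechet_derivative_works)
  then have lin: "linear ?D" by (rule has_derivative_linear)
  have "?D h = h \<bullet> grad f x" for h
  proof -
    have "h = (\<Sum>i\<in>UNIV. (h $ i) *\<^sub>R axis i 1)" using basis_expansion[of h] by (simp add: scalar_mult_eq_scaleR)
    then have "?D h = (\<Sum>i\<in>UNIV. h $ i * ?D (axis i 1))"
      using linear_sum[OF lin, of "\<lambda>i. (h $ i) *\<^sub>R axis i 1" UNIV] by (simp add: linear_cmul[OF lin])
    then show ?thesis by (simp add: inner_vec_def grad_def partial_def)
  qed
  then have "?D = (\<lambda>h. h \<bullet> grad f x)" by (rule ext)
  then show "GDERIV f x :> grad f x" using D by (simp add: gderiv_def)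
qed

lemma torus_C1_partial:
  assumes "torus_C1 f G"
  shows "partial i f x = G x $ i"
proof -
  have "(\<lambda>h. h \<bullet> G x) = frechet_derivative f (at x)"
    using torus_C1_D(3)[OF assms, of x] unfolding gderiv_def by (rule frechet_derivative_at)
  from fun_cong[OF this, of "axis i 1"] show ?thesis by (simp add: partial_def inner_axis')
qed

lemma torus_C1_C2:
  assumes C2: "C2 f" and p: "periodic f"
  shows "torus_C1 f (grad f)" "torus_C1 (\<lambda>x. grad f x $ i) (grad (partial i f))"
    "laplacian f x = (\<Sum>i\<in>UNIV. grad (partial i f) x $ i)"
proof -
  show f: "torus_C1 f (grad f)" using C2 p by (intro torus_C1_of_C1) (auto simp: C2_def)
  have "(\<lambda>x. grad f x $ i) = partial i f" for i by (simp add: grad_def)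
  moreover have "periodic (partial i f)" for i
    using torus_C1_periodic[OF f] by (auto simp: grad_def periodic_def vec_eq_iff)
  ultimately show "torus_C1 (\<lambda>x. grad f x $ i) (grad (partial i f))"
    using C2 torus_C1_of_C1 by (auto simp: C2_def)
  show "laplacian f x = (\<Sum>i\<in>UNIV. grad (partial i f) x $ i)"
    by (simp add: laplacian_def grad_def)
qed

lemma conv_integrand_continuous:
  fixes K :: "real^'d \<Rightarrow> 'b::euclidean_space"
  assumes K: "continuous_on UNIV K" and f: "continuous_on UNIV f"
  shows "continuous_on UNIV (\<lambda>y. f y *\<^sub>R K (x - y))"
  by (intro continuous_intros f continuous_on_compose2[OF K]) auto

lemma conv_continuous:
  fixes K :: "real^'d \<Rightarrow> 'b::euclidean_space"
  assumes K: "continuous_on UNIV K" and f: "continuous_on UNIV f"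
  shows "continuous_on UNIV (conv K f)"
proof -
  have "continuous_on UNIV (\<lambda>x. integral (cbox 0 1) (\<lambda>y. f y *\<^sub>R K (x - y)))"
    by (rule integral_continuous_on_param)
      (auto simp: case_prod_beta intro!: continuous_intros continuous_on_compose2[OF K] continuous_on_compose2[OF f])
  then show ?thesis by (simp add: conv_def[abs_def] torus_integral_eq[OF conv_integrand_continuous[OF K f]])
qed

lemma conv_periodic: "periodic K \<Longrightarrow> periodic (conv K f)"
proof -
  assume p: "periodic K"
  have "K (x + axis i 1 - y) = K (x - y)" for x i y
  proof -
    have "x + axis i 1 - y = (x - y) + axis i 1" by (simp only: diff_add_eq)
    then show ?thesis using p by (simp only: periodic_def)
  qed
  then show ?thesis by (simp add: periodic_def conv_def)
qed

lemma conv_component: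
  fixes K :: "real^'d \<Rightarrow> real^'e"
  assumes K: "continuous_on UNIV K" and f: "continuous_on UNIV f"
  shows "conv K f x $ i = conv (\<lambda>x. K x $ i) f x"
  using integral_bounded_linear[OF bounded_linear_vec_nth[of i] torus_integrable[OF conv_integrand_continuous[OF K f, of x]]]
  by (simp add: conv_def)

lemma norm_conv_le:
  fixes K :: "real^'d \<Rightarrow> 'b::euclidean_space"
  assumes K: "continuous_on UNIV K" and f: "continuous_on UNIV f" and B: "\<And>x. norm (K x) \<le> B"
  shows "norm (conv K f x) \<le> B * (\<integral>y. \<bar>f y\<bar> \<partial>torus)"
proof -
  have "norm (conv K f x) \<le> (\<integral>y. norm (f y *\<^sub>R K (x - y)) \<partial>torus)"
    unfolding conv_def by (rule integral_norm_bound)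
  also have "\<dots> \<le> (\<integral>y. B * \<bar>f y\<bar> \<partial>torus)"
  proof (rule torus_mono)
    show "continuous_on UNIV (\<lambda>y. norm (f y *\<^sub>R K (x - y)))" by (rule continuous_on_norm[OF conv_integrand_continuous[OF K f]])
    show "continuous_on UNIV (\<lambda>y. B * \<bar>f y\<bar>)" by (intro continuous_intros f)
    show "norm (f y *\<^sub>R K (x - y)) \<le> B * \<bar>f y\<bar>" for y
      using mult_right_mono[OF B[of "x - y"], of "\<bar>f y\<bar>"] by (simp add: mult.commute)
  qed
  finally show ?thesis by simp
qed

lemma conv_diff:
  fixes K :: "real^'d \<Rightarrow> 'b::euclidean_space"
  assumes K: "continuous_on UNIV K" and f: "continuous_on UNIV f" and g: "continuous_on UNIV g"
  shows "conv K (\<lambda>x. f x - g x) x = conv K f x - conv K g x"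
  unfolding conv_def
  using Bochner_Integration.integral_diff[OF torus_integrable[OF conv_integrand_continuous[OF K f, of x]]
      torus_integrable[OF conv_integrand_continuous[OF K g, of x]]]
  by (simp only: scaleR_diff_left)

lemma torus_C1_conv:
  fixes K :: "real^'d \<Rightarrow> real"
  assumes K: "torus_C1 K G" and f: "continuous_on UNIV f"
  shows "torus_C1 (conv K f) (conv G f)"
  unfolding torus_C1_def
proof (intro conjI allI)
  note cK = torus_C1_continuous[OF K] and cG = torus_C1_D(2)[OF K]
  show "periodic (conv K f)" by (rule conv_periodic[OF torus_C1_D(1)[OF K]])
  show "continuous_on UNIV (conv G f)" by (rule conv_continuous[OF cG f])
  fix x
  have "((\<lambda>x. integral (cbox 0 1) (\<lambda>y. f y *\<^sub>R K (x - y))) has_derivative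
     blinfun_apply (integral (cbox 0 1) (\<lambda>y. blinfun_inner_left (f y *\<^sub>R G (x - y))))) (at x within UNIV)"
  proof (rule leibniz_rule)
    fix x y
    have "(K has_derivative (\<lambda>h. h \<bullet> G (x - y))) (at (x - y))"
      using torus_C1_D(3)[OF K] by (simp add: gderiv_def)
    moreover have "((\<lambda>x. x - y) has_derivative (\<lambda>h. h)) (at x)"
      by (auto intro!: derivative_eq_intros)
    ultimately have "((\<lambda>x. K (x - y)) has_derivative (\<lambda>h. h \<bullet> G (x - y))) (at x)"
      by (rule has_derivative_compose[rotated])
    from has_derivative_scaleR_right[OF this, of "f y"]
    show "((\<lambda>x. f y *\<^sub>R K (x - y)) has_derivative blinfun_apply (blinfun_inner_left (f y *\<^sub>R G (x - y)))) (at x within UNIV)"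
      by simp
  next
    show "(\<lambda>y. f y *\<^sub>R K (x - y)) integrable_on cbox 0 1" for x
      by (intro integrable_continuous continuous_on_subset[OF conv_integrand_continuous[OF cK f]]) auto
    have "continuous_on (UNIV \<times> cbox 0 1) (\<lambda>p. blinfun_inner_left (f (snd p) *\<^sub>R G (fst p - snd p)))"
      by (intro bounded_linear.continuous_on[OF bounded_linear_blinfun_inner_left] continuous_on_scaleR
          continuous_on_compose2[OF cG] continuous_on_compose2[OF f] continuous_intros) auto
    then show "continuous_on (UNIV \<times> cbox 0 1) (\<lambda>(x, y). blinfun_inner_left (f y *\<^sub>R G (x - y)))"
      by (simp add: case_prod_beta)
  qed auto
  moreover have "blinfun_apply (integral (cbox 0 1) (\<lambda>y. blinfun_inner_left (f y *\<^sub>R G (x - y)))) = (\<lambda>h. h \<bullet> conv G f x)"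
  proof -
    have I: "(\<lambda>y. f y *\<^sub>R G (x - y)) integrable_on cbox 0 1"
      by (intro integrable_continuous continuous_on_subset[OF conv_integrand_continuous[OF cG f]]) auto
    have "integral (cbox 0 1) (\<lambda>y. blinfun_inner_left (f y *\<^sub>R G (x - y)))
       = blinfun_inner_left (integral (cbox 0 1) (\<lambda>y. f y *\<^sub>R G (x - y)))"
      using integral_linear[OF I bounded_linear_blinfun_inner_left] by (simp add: o_def)
    moreover have "conv G f x = integral (cbox 0 1) (\<lambda>y. f y *\<^sub>R G (x - y))"
      unfolding conv_def by (rule torus_integral_eq[OF conv_integrand_continuous[OF cG f]])
    ultimately show ?thesis by (simp add: fun_eq_iff)
  qed
  moreover have "conv K f = (\<lambda>x. integral (cbox 0 1) (\<lambda>y. f y *\<^sub>R K (x - y)))"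
    unfolding conv_def using torus_integral_eq[OF conv_integrand_continuous[OF cK f]] by (intro ext)
  ultimately show "GDERIV (conv K f) x :> conv G f x"
    by (simp add: gderiv_def)
qed

text \<open>The vector field whose divergence is the right-hand side of the equation. The
  dissipation estimates see the equation only through it.\<close>

definition flux :: "real \<Rightarrow> (real^'d \<Rightarrow> real) \<Rightarrow> (real^'d \<Rightarrow> real) \<Rightarrow> (real^'d \<Rightarrow> real) \<Rightarrow> real^'d \<Rightarrow> real^'d" where
  "flux \<beta> V W f x = f x *\<^sub>R (grad V x + conv (grad W) f x) + inverse \<beta> *\<^sub>R grad f x"

lemma flux_continuous:
  assumes "C2 V" "periodic V" "C2 W" "periodic W" "C2 f" "periodic f"
  shows "continuous_on UNIV (flux \<beta> V W f)"
proof -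
  note f = torus_C1_C2(1)[OF assms(5,6)]
  show ?thesis unfolding flux_def
    by (intro continuous_intros torus_C1_continuous[OF f] torus_C1_D(2)[OF f] conv_continuous
        torus_C1_D(2)[OF torus_C1_C2(1)[OF assms(1,2)]] torus_C1_D(2)[OF torus_C1_C2(1)[OF assms(3,4)]])
qed

lemma mckean_vlasov_weak:
  assumes V: "C2 V" "periodic V" and W: "C2 W" "periodic W" and C2f: "C2 f" "periodic f"
    and \<phi>: "torus_C1 \<phi> \<Phi>"
  shows "(\<integral>x. \<phi> x * mckean_vlasov_rhs \<beta> V W f x \<partial>torus) = - (\<integral>x. \<Phi> x \<bullet> flux \<beta> V W f x \<partial>torus)"
proof -
  note f = torus_C1_C2[OF C2f] and cf = torus_C1_continuous[OF torus_C1_C2(1)[OF C2f]]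
  define a where "a i y = f y * grad V y $ i + f y * conv (\<lambda>x. grad W x $ i) f y" for i y
  \<comment> \<open>Differentiability of each drift component makes \<open>partial\<close> inside
    \<open>divergence\<close> meaningful; the form of the gradient is irrelevant, since the
    integration by parts moves the derivative to the test function.\<close>
  have "\<exists>A. torus_C1 (a i) A" for i
    unfolding a_def
    using torus_C1_add[OF torus_C1_mult[OF f(1) torus_C1_C2(2)[OF V]] torus_C1_mult[OF f(1) torus_C1_conv[OF torus_C1_C2(2)[OF W] cf]]]
    by blast
  then obtain A where A: "\<And>i. torus_C1 (a i) (A i)" by metis
  have ai: "(\<lambda>y. (f y *\<^sub>R grad V y + f y *\<^sub>R conv (grad W) f y) $ i) = a i" for i
    using conv_component[OF torus_C1_D(2)[OF torus_C1_C2(1)[OF W]] cf] by (simp add: a_def fun_eq_iff)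
  have B: "torus_C1 (\<lambda>x. a i x + inverse \<beta> * grad f x $ i) (\<lambda>x. A i x + inverse \<beta> *\<^sub>R grad (partial i f) x)" for i
    by (intro torus_C1_add A torus_C1_cmult f)
  have rhs: "mckean_vlasov_rhs \<beta> V W f x = (\<Sum>i\<in>UNIV. (A i x + inverse \<beta> *\<^sub>R grad (partial i f) x) $ i)" for x
    unfolding mckean_vlasov_rhs_def divergence_def ai torus_C1_partial[OF A] f(3)
    by (simp add: sum.distrib sum_distrib_left)
  have flux: "flux \<beta> V W f x $ i = a i x + inverse \<beta> * grad f x $ i" for x i
    unfolding flux_def ai[THEN fun_cong, symmetric] by (simp add: algebra_simps)
  note c\<phi> = torus_C1_continuous[OF \<phi>] torus_C1_D(2)[OF \<phi>]
  have "(\<integral>x. \<phi> x * mckean_vlasov_rhs \<beta> V W f x \<partial>torus)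
    = (\<integral>x. (\<Sum>i\<in>UNIV. \<phi> x * (A i x + inverse \<beta> *\<^sub>R grad (partial i f) x) $ i) \<partial>torus)"
    by (simp only: rhs sum_distrib_left)
  also have "\<dots> = (\<Sum>i\<in>UNIV. \<integral>x. \<phi> x * (A i x + inverse \<beta> *\<^sub>R grad (partial i f) x) $ i \<partial>torus)"
    by (rule Bochner_Integration.integral_sum) (intro torus_integrable continuous_on_mult c\<phi> continuous_on_component torus_C1_D(2)[OF B])
  also have "\<dots> = (\<Sum>i\<in>UNIV. - (\<integral>x. \<Phi> x $ i * (a i x + inverse \<beta> * grad f x $ i) \<partial>torus))"
    by (intro sum.cong refl torus_by_parts[OF \<phi> B])
  also have "\<dots> = - (\<integral>x. (\<Sum>i\<in>UNIV. \<Phi> x $ i * (a i x + inverse \<beta> * grad f x $ i)) \<partial>torus)"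
    unfolding sum_negf
    by (subst Bochner_Integration.integral_sum) (intro refl torus_integrable continuous_on_mult c\<phi> continuous_on_component torus_C1_continuous[OF B])+
  also have "(\<lambda>x. \<Sum>i\<in>UNIV. \<Phi> x $ i * (a i x + inverse \<beta> * grad f x $ i)) = (\<lambda>x. \<Phi> x \<bullet> flux \<beta> V W f x)"
    by (simp add: inner_vec_def flux)
  finally show ?thesis .
qed

section \<open>Dissipation of convex functionals\<close>

text \<open>Integrating factor argument for a functional that is differentiable only at positive
  times and need not be continuous at 0: all that is known initially is an upper bound \<rho> with
  limit \<open>y0\<close>. The sign of \<open>A\<close> is left open, hence the crude factor with
  \<open>\<bar>A\<bar>\<close> on the source term.\<close>

lemma gronwall_initial:
  fixes y y' \<rho> :: "real \<Rightarrow> real"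
  assumes d: "\<And>t. 0 < t \<Longrightarrow> (y has_real_derivative y' t) (at t)"
    and le: "\<And>t. 0 < t \<Longrightarrow> y' t \<le> A * y t + B" and B: "0 \<le> B"
    and ini: "\<And>s. 0 < s \<Longrightarrow> y s \<le> \<rho> s" and lim: "(\<rho> \<longlongrightarrow> y0) (at_right 0)" and t: "0 < t"
  shows "y t \<le> exp (A * t) * (y0 + B * t * exp (\<bar>A\<bar> * t))"
proof -
  define K where "K = B * exp (\<bar>A\<bar> * t)"
  define z where "z s = exp (- A * s) * y s - K * s" for s
  have dz: "(z has_real_derivative (exp (- A * s) * (y' s - A * y s) - K)) (at s)" if "0 < s" for s
    unfolding z_def by (auto intro!: derivative_eq_intros d that simp: algebra_simps)
  have zle: "exp (- A * s) * (y' s - A * y s) - K \<le> 0" if s: "0 < s" "s \<le> t" for s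
  proof -
    have "exp (- A * s) * (y' s - A * y s) \<le> exp (- A * s) * B"
      using le[OF s(1)] by (intro mult_left_mono) auto
    also have "\<dots> \<le> exp (\<bar>A\<bar> * t) * B"
    proof (intro mult_right_mono B)
      have "- A * s \<le> \<bar>A\<bar> * s" using s by (intro mult_right_mono abs_ge_minus_self) simp
      also have "\<dots> \<le> \<bar>A\<bar> * t" using s by (intro mult_left_mono) auto
      finally show "exp (- A * s) \<le> exp (\<bar>A\<bar> * t)" by simp
    qed
    finally show ?thesis by (simp add: K_def mult.commute)
  qed
  have zt: "z t \<le> exp (- A * s) * \<rho> s - K * s" if s: "0 < s" "s < t" for s
  proof -
    have "z t \<le> z s"
    proof (rule DERIV_nonpos_imp_nonincreasing[of s t z])
      show "s \<le> t" using s by simp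
      fix r assume "s \<le> r" "r \<le> t"
      then show "\<exists>D. (z has_real_derivative D) (at r) \<and> D \<le> 0" using dz[of r] zle[of r] s by auto
    qed
    also have "\<dots> \<le> exp (- A * s) * \<rho> s - K * s"
      unfolding z_def using ini[OF s(1)] by simp
    finally show ?thesis .
  qed
  have "z t \<le> exp (- A * 0) * y0 - K * 0"
  proof (rule tendsto_lowerbound)
    show "((\<lambda>s. exp (- A * s) * \<rho> s - K * s) \<longlongrightarrow> exp (- A * 0) * y0 - K * 0) (at_right 0)"
      by (intro tendsto_intros lim)
    show "\<forall>\<^sub>F s in at_right 0. z t \<le> exp (- A * s) * \<rho> s - K * s"
      using eventually_at_right_less[of "0::real"] eventually_at_right[OF t] zt
      by (auto simp: eventually_at_right[OF t] intro!: exI[of _ t] t)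
  qed simp
  then have "exp (- A * t) * y t \<le> y0 + K * t" by (simp add: z_def)
  then have "exp (A * t) * (exp (- A * t) * y t) \<le> exp (A * t) * (y0 + K * t)" by (intro mult_left_mono) auto
  moreover have "exp (A * t) * exp (- A * t) = 1" by (simp flip: exp_add)
  then have "exp (A * t) * (exp (- A * t) * y t) = y t" by (simp only: mult.assoc[symmetric] mult_1)
  ultimately have "y t \<le> exp (A * t) * (y0 + K * t)" by metis
  then show ?thesis by (simp add: K_def mult_ac)
qed

text \<open>Completing the square: the diffusion pays for an arbitrary drift \<open>Y\<close> in the
  flux.\<close>

lemma young_flux:
  fixes X Y :: "'a::real_inner"
  assumes "\<beta> > 0"
  shows "- (inverse \<beta> * (norm X)\<^sup>2 + X \<bullet> Y) \<le> \<beta> * (norm Y)\<^sup>2 / 4"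
proof -
  have "0 \<le> inverse \<beta> * (norm (X + (\<beta> / 2) *\<^sub>R Y))\<^sup>2" using assms by simp
  also have "\<dots> = inverse \<beta> * (norm X)\<^sup>2 + X \<bullet> Y + \<beta> * (norm Y)\<^sup>2 / 4"
    using assms by (simp add: power2_norm_eq_inner inner_add_left inner_add_right inner_commute field_simps)
  finally show ?thesis by simp
qed

section \<open>The invariant density\<close>

locale mckean_vlasov =
  fixes \<beta> :: real and V W :: "real^'d \<Rightarrow> real" and f :: "real \<Rightarrow> real^'d \<Rightarrow> real" and g :: "real^'d \<Rightarrow> real"
  assumes \<beta>: "\<beta> > 0" and V: "C2 V" "periodic V" and W: "C2 W" "periodic W"
    and f0: "prob_density (f 0)" and sol: "mckean_vlasov_solution \<beta> V W f"
    and inv: "invariant_density \<beta> V W g"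
begin

abbreviation "a \<equiv> Linf_norm (grad V)"
abbreviation "b \<equiv> Linf_norm (grad W)"
abbreviation "\<Gamma> \<equiv> Gamma_const \<beta> V W"

definition "drift x = grad V x + conv (grad W) g x"

lemma V_C1: "torus_C1 V (grad V)" and W_C1: "torus_C1 W (grad W)"
  using torus_C1_C2(1)[OF V] torus_C1_C2(1)[OF W] by auto

lemmas grad_W_continuous = torus_C1_D(2)[OF W_C1]

lemma norm_grad_V: "norm (grad V x) \<le> a" and norm_grad_W: "norm (grad W x) \<le> b"
  and norm_V: "\<bar>V x\<bar> \<le> Linf_norm V" and norm_W: "\<bar>W x\<bar> \<le> Linf_norm W"
  using norm_le_Linf_norm[OF torus_C1_D(2) torus_C1_periodic] norm_le_Linf_norm[OF torus_C1_continuous torus_C1_D(1)]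
    V_C1 W_C1 by (metis, metis, metis real_norm_def, metis real_norm_def)

lemma a_nonneg: "0 \<le> a" and b_nonneg: "0 \<le> b"
  using norm_grad_V norm_grad_W norm_ge_zero order_trans by blast+

lemma f_C2: "t > 0 \<Longrightarrow> C2 (f t)" and f_periodic: "t \<ge> 0 \<Longrightarrow> periodic (f t)"
  using sol by (auto simp: mckean_vlasov_solution_def)

lemma f_C1: "t > 0 \<Longrightarrow> torus_C1 (f t) (grad (f t))"
  using torus_C1_C2(1)[OF f_C2 f_periodic] by simp

lemmas f_continuous = torus_C1_continuous[OF f_C1]

lemma f_derivative: "t > 0 \<Longrightarrow> ((\<lambda>s. f s x) has_real_derivative mckean_vlasov_rhs \<beta> V W (f t) x) (at t)"
  using sol by (auto simp: mckean_vlasov_solution_def)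

lemma f_continuous_joint: "continuous_on ({0<..} \<times> UNIV) (\<lambda>p. f (fst p) (snd p))"
  using sol by (simp add: mckean_vlasov_solution_def case_prod_beta)

lemma rhs_continuous: "continuous_on ({0<..} \<times> UNIV) (\<lambda>p. mckean_vlasov_rhs \<beta> V W (f (fst p)) (snd p))"
proof -
  have "continuous_on ({0<..} \<times> UNIV) (\<lambda>p. deriv (\<lambda>s. f s (snd p)) (fst p))"
    using sol by (simp add: mckean_vlasov_solution_def case_prod_beta)
  then show ?thesis
    by (rule continuous_on_cong[THEN iffD1, rotated -1]) (auto simp: DERIV_imp_deriv[OF f_derivative])
qed

lemma f0_integrable: "integrable torus (f 0)" and f0_mass: "(\<integral>x. f 0 x \<partial>torus) = 1" and f0_nonneg: "0 \<le> f 0 x"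
  using f0 by (auto simp: prob_density_def has_bochner_integral_iff)

lemma initial_L1: "((\<lambda>t. \<integral>x. \<bar>f t x - f 0 x\<bar> \<partial>torus) \<longlongrightarrow> 0) (at_right 0)"
  using sol by (simp add: mckean_vlasov_solution_def L1_norm_def)

lemma g_C2: "C2 g"
  using inv zero_less_one unfolding invariant_density_def mckean_vlasov_solution_def by blast

lemma g_periodic: "periodic g" and g_nonneg: "0 \<le> g x" and g_mass: "(\<integral>x. g x \<partial>torus) = 1"
  using inv by (auto simp: invariant_density_def mckean_vlasov_solution_def prob_density_def has_bochner_integral_iff)

lemma g_C1: "torus_C1 g (grad g)" by (rule torus_C1_C2(1)[OF g_C2 g_periodic])

lemmas g_continuous = torus_C1_continuous[OF g_C1]

lemma rhs_g: "mckean_vlasov_rhs \<beta> V W g x = 0"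
proof -
  have "((\<lambda>s. g x) has_real_derivative mckean_vlasov_rhs \<beta> V W g x) (at 1)"
    using inv by (auto simp: invariant_density_def mckean_vlasov_solution_def)
  then show ?thesis using DERIV_unique DERIV_const by blast
qed

lemma potential_C1: "torus_C1 (\<lambda>x. V x + conv W g x) drift"
  unfolding drift_def by (rule torus_C1_add[OF V_C1 torus_C1_conv[OF W_C1 g_continuous]])

text \<open>Testing stationarity with \<open>\<phi> = g e\<^bsup>\<beta>(V + W * g)\<^esup>\<close> gives a vanishing weighted
  integral of \<open>\<bar>\<nabla>\<phi>\<bar>\<^sup>2\<close>.\<close>

lemma flux_g: "flux \<beta> V W g x = 0"
proof -
  let ?e = "\<lambda>x. exp (\<beta> * (V x + conv W g x))"
  have e: "torus_C1 ?e (\<lambda>x. ?e x *\<^sub>R (\<beta> *\<^sub>R drift x))"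
    by (rule torus_C1_compose[OF torus_C1_cmult[OF potential_C1]])
      (auto intro!: DERIV_exp continuous_intros torus_C1_continuous[OF potential_C1])
  note \<phi> = torus_C1_mult[OF g_C1 e]
  have grad: "g x *\<^sub>R (?e x *\<^sub>R (\<beta> *\<^sub>R drift x)) + ?e x *\<^sub>R grad g x = (\<beta> * ?e x) *\<^sub>R flux \<beta> V W g x" for x
    using \<beta> by (simp add: flux_def drift_def algebra_simps)
  have c: "continuous_on UNIV (\<lambda>x. \<beta> * ?e x * (norm (flux \<beta> V W g x))\<^sup>2)"
    by (intro continuous_intros torus_C1_continuous[OF potential_C1] flux_continuous[OF V W g_C2 g_periodic])
  have "(\<integral>x. \<beta> * ?e x * (norm (flux \<beta> V W g x))\<^sup>2 \<partial>torus) = 0"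
    using mckean_vlasov_weak[OF V W g_C2 g_periodic \<phi>, of \<beta>] unfolding grad rhs_g
    by (simp add: power2_norm_eq_inner)
  moreover have "periodic (\<lambda>x. \<beta> * ?e x * (norm (flux \<beta> V W g x))\<^sup>2)"
    using torus_C1_D(1)[OF potential_C1] torus_C1_periodic[OF potential_C1] torus_C1_periodic[OF g_C1] g_periodic
    unfolding periodic_def flux_def drift_def by simp
  ultimately have "\<beta> * ?e x * (norm (flux \<beta> V W g x))\<^sup>2 = 0"
    using \<beta> by (intro torus_integral_zero[OF c]) auto
  then show ?thesis using \<beta> by simp
qed

lemma grad_g: "grad g x = - (\<beta> * g x) *\<^sub>R drift x"
proof -
  have "\<beta> *\<^sub>R (g x *\<^sub>R drift x + inverse \<beta> *\<^sub>R grad g x) = 0"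
    using flux_g[of x] by (simp add: flux_def drift_def)
  then show ?thesis using \<beta> by (simp add: scaleR_add_right eq_neg_iff_add_eq_0 add.commute)
qed

text \<open>Vanishing flux means that \<open>g\<close> divided by the Boltzmann factor has zero
  gradient. The resulting constant is nonnegative with \<open>g\<close> and nonzero because
  \<open>g\<close> has mass 1.\<close>

lemma g_gibbs: "\<exists>c>0. \<forall>x. g x = c * exp (- (\<beta> * (V x + conv W g x)))"
proof -
  let ?e = "\<lambda>x. exp (\<beta> * (V x + conv W g x))"
  have e: "torus_C1 ?e (\<lambda>x. ?e x *\<^sub>R (\<beta> *\<^sub>R drift x))"
    by (rule torus_C1_compose[OF torus_C1_cmult[OF potential_C1]])
      (auto intro!: DERIV_exp continuous_intros torus_C1_continuous[OF potential_C1])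
  have "GDERIV (\<lambda>x. g x * ?e x) x :> 0" for x
    using torus_C1_D(3)[OF torus_C1_mult[OF g_C1 e], of x] by (simp add: grad_g mult_ac)
  then have "((\<lambda>x. g x * ?e x) has_derivative (\<lambda>h. 0)) (at x within UNIV)" for x
    by (simp add: gderiv_def)
  then have "\<exists>c. \<forall>x\<in>UNIV. g x * ?e x = c"
    by (intro has_derivative_zero_constant) auto
  then obtain c where c: "\<And>x. g x * ?e x = c" by auto
  have g: "g x = c * exp (- (\<beta> * (V x + conv W g x)))" for x
    unfolding c[of x, symmetric] by (simp add: exp_minus)
  have "c \<noteq> 0" using g_mass g by auto
  moreover have "0 \<le> c" unfolding c[of 0, symmetric] using g_nonneg by simp
  ultimately show ?thesis using g by (intro exI[of _ c]) auto
qed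

lemma \<Gamma>_pos: "\<Gamma> > 0" by (simp add: Gamma_const_def)

text \<open>As \<open>g\<close> has mass 1, convolution with it does not raise the sup norm of
  \<open>W\<close>. The potential thus lies between \<open>- q\<close> and \<open>q\<close>, and its
  Boltzmann factor varies by at most \<open>exp (2 * \<beta> * q)\<close>, which is \<Gamma>. Mass 1
  on a cube of volume 1 forces the minimum below 1.\<close>

lemma g_bounds: "\<exists>m>0. m \<le> 1 \<and> (\<forall>x. m \<le> g x \<and> g x \<le> \<Gamma> * m)"
proof -
  obtain c where c: "c > 0" "\<And>x. g x = c * exp (- (\<beta> * (V x + conv W g x)))" using g_gibbs by blast
  define q where "q = Linf_norm V + Linf_norm W"
  have "\<bar>conv W g x\<bar> \<le> Linf_norm W" for x
    using norm_conv_le[OF torus_C1_continuous[OF W_C1] g_continuous, of "Linf_norm W" x] norm_W g_nonneg g_mass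
    by simp
  then have "\<bar>V x + conv W g x\<bar> \<le> q" for x
    unfolding q_def using norm_V[of x] by (meson abs_triangle_ineq add_mono order_trans)
  then have q: "- q \<le> V x + conv W g x" "V x + conv W g x \<le> q" for x by (simp_all add: abs_le_iff) (metis add.inverse_inverse minus_add_distrib neg_le_iff_le add_uminus_conv_diff)+
  define m where "m = c * exp (- (\<beta> * q))"
  have m: "m > 0" using c by (simp add: m_def)
  have lo: "m \<le> g x" for x
    unfolding m_def c(2)[of x] using c(1) \<beta> q[of x] by simp
  have hi: "g x \<le> \<Gamma> * m" for x
  proof -
    have "g x \<le> c * exp (\<beta> * q)"
      unfolding c(2)[of x] using c(1) \<beta> q(1)[of x] mult_left_mono[OF q(1)[of x], of \<beta>] by simp
    also have "\<dots> = \<Gamma> * m"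
      by (simp add: m_def Gamma_const_def q_def[symmetric] flip: exp_add)
    finally show ?thesis .
  qed
  have "(\<integral>x. m \<partial>(torus :: (real^'d) measure)) \<le> (\<integral>x. g x \<partial>torus)"
    by (rule torus_mono) (intro continuous_intros g_continuous lo)+
  then have "m \<le> 1" by (simp add: g_mass torus.prob_space)
  then show ?thesis using m lo hi by blast
qed

lemma g_pos: "0 < g x" and g_le: "g x \<le> \<Gamma>"
proof -
  obtain m where m: "m > 0" "m \<le> 1" "\<And>x. m \<le> g x" "\<And>x. g x \<le> \<Gamma> * m" using g_bounds by blast
  show "0 < g x" using m(1) m(3)[of x] by linarith
  have "\<Gamma> * m \<le> \<Gamma>" using m(2) \<Gamma>_pos by simp
  then show "g x \<le> \<Gamma>" using m(4)[of x] by linarith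
qed

section \<open>Deviation from equilibrium and derivatives of functionals\<close>

definition "u t x = f t x - g x"
definition "v t = conv (grad W) (u t)"
definition "L t = (\<integral>x. \<bar>u t x\<bar> \<partial>torus)"

lemma u_C1: "t > 0 \<Longrightarrow> torus_C1 (u t) (\<lambda>x. grad (f t) x - grad g x)"
  unfolding u_def by (rule torus_C1_diff[OF f_C1 g_C1])

lemmas u_continuous = torus_C1_continuous[OF u_C1]

lemma v_continuous: "t > 0 \<Longrightarrow> continuous_on UNIV (v t)"
  unfolding v_def by (intro conv_continuous grad_W_continuous u_continuous)

lemma norm_v: "t > 0 \<Longrightarrow> norm (v t x) \<le> b * L t"
  unfolding v_def L_def by (rule norm_conv_le[OF grad_W_continuous u_continuous norm_grad_W])

lemma drift_continuous: "continuous_on UNIV drift" by (rule torus_C1_D(2)[OF potential_C1])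

lemma norm_drift: "norm (drift x) \<le> a + b"
proof -
  have "norm (conv (grad W) g x) \<le> b"
    using norm_conv_le[OF grad_W_continuous g_continuous norm_grad_W, of x] g_nonneg g_mass by simp
  then show ?thesis unfolding drift_def using norm_grad_V[of x] by (meson add_mono norm_triangle_ineq order_trans)
qed

lemma flux_f: 
  assumes "t > 0"
  shows "flux \<beta> V W (f t) x = f t x *\<^sub>R (drift x + v t x) + inverse \<beta> *\<^sub>R grad (f t) x"
proof -
  have "conv (grad W) (f t) x = conv (grad W) g x + v t x"
    using conv_diff[OF grad_W_continuous f_continuous[OF assms] g_continuous, of x] by (simp add: v_def u_def[abs_def])
  then show ?thesis by (simp add: flux_def drift_def add.assoc)
qed

text \<open>The weight \<open>w\<close> cancels the denominator produced by the chain rule, so the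
  time derivative tests the equation with \<open>j'\<close> of the ratio, and the weak form turns
  this into \<open>j''\<close> times a gradient. The set \<open>D\<close> admits functions that are
  smooth only on the values taken, such as shifted entropies on the half-line.\<close>

lemma functional_derivative:
  fixes w p :: "real^'d \<Rightarrow> real" and j j' j'' :: "real \<Rightarrow> real"
  assumes w: "torus_C1 w w'" "\<And>x. 0 < w x" and p: "torus_C1 p p'"
    and \<Psi>: "\<And>t. t > 0 \<Longrightarrow> torus_C1 (\<lambda>x. (f t x - p x) / w x) (\<Psi> t)"
    and D: "\<And>t x. t > 0 \<Longrightarrow> (f t x - p x) / w x \<in> D"
    and j: "\<And>r. r \<in> D \<Longrightarrow> (j has_real_derivative j' r) (at r)"
    and j': "\<And>r. r \<in> D \<Longrightarrow> (j' has_real_derivative j'' r) (at r)"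
    and j'': "continuous_on D j''" and t: "t > 0"
  shows "((\<lambda>t. \<integral>x. w x * j ((f t x - p x) / w x) \<partial>torus) has_real_derivative
    - (\<integral>x. j'' ((f t x - p x) / w x) * (\<Psi> t x \<bullet> flux \<beta> V W (f t) x) \<partial>torus)) (at t)"
proof -
  note cw = torus_C1_continuous[OF w(1)] and cp = torus_C1_continuous[OF p]
  have wne: "w x \<noteq> 0" for x using w(2)[of x] by simp
  have cj: "continuous_on D j" "continuous_on D j'"
    using j j' by (meson DERIV_isCont continuous_at_imp_continuous_on)+
  let ?\<psi> = "\<lambda>t x. (f t x - p x) / w x"
  let ?R = "\<lambda>t x. mckean_vlasov_rhs \<beta> V W (f t) x"
  have c1: "continuous_on UNIV (\<lambda>x. w x * j (?\<psi> t x))" if "t > 0" for t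
    by (intro continuous_on_mult cw continuous_on_compose2[OF cj(1) torus_C1_continuous[OF \<Psi>[OF that]]])
      (use D[OF that] in auto)
  have "((\<lambda>t. integral (cbox 0 1) (\<lambda>x. w x * j (?\<psi> t x))) has_real_derivative
      integral (cbox 0 1) (\<lambda>x. j' (?\<psi> t x) * ?R t x)) (at t within {0<..})"
  proof (rule leibniz_rule_field_derivative)
    fix t :: real and x :: "real^'d" assume "t \<in> {0<..}"
    then have t: "t > 0" by simp
    have "((\<lambda>t. ?\<psi> t x) has_real_derivative ?R t x / w x) (at t)"
      by (auto intro!: derivative_eq_intros f_derivative t simp: wne)
    from DERIV_cmult[OF DERIV_chain2[OF j[OF D[OF t]] this], of "w x"]
    have "((\<lambda>t. w x * j (?\<psi> t x)) has_real_derivative j' (?\<psi> t x) * ?R t x) (at t)"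
      using wne[of x] by (simp add: field_simps)
    then show "((\<lambda>t. w x * j (?\<psi> t x)) has_real_derivative j' (?\<psi> t x) * ?R t x) (at t within {0<..})"
      by (rule has_field_derivative_at_within)
  next
    show "(\<lambda>x. w x * j (?\<psi> t x)) integrable_on cbox 0 1" if "t \<in> {0<..}" for t
      using that by (intro integrable_continuous continuous_on_subset[OF c1]) auto
    have "continuous_on ({0<..} \<times> UNIV) (\<lambda>z. j' (?\<psi> (fst z) (snd z)) * ?R (fst z) (snd z))"
    proof (intro continuous_on_mult rhs_continuous continuous_on_compose2[OF cj(2)])
      show "continuous_on ({0<..} \<times> UNIV) (\<lambda>z. ?\<psi> (fst z) (snd z))"
        by (intro continuous_on_divide continuous_on_diff f_continuous_joint continuous_on_compose2[OF cp]
            continuous_on_compose2[OF cw] continuous_on_snd continuous_on_id) (auto simp: wne)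
    qed (use D in auto)
    then show "continuous_on ({0<..} \<times> cbox 0 1) (\<lambda>(t, x). j' (?\<psi> t x) * ?R t x)"
      unfolding case_prod_beta by (rule continuous_on_subset) auto
  qed (use t in auto)
  then have d: "((\<lambda>t. integral (cbox 0 1) (\<lambda>x. w x * j (?\<psi> t x))) has_real_derivative
      integral (cbox 0 1) (\<lambda>x. j' (?\<psi> t x) * ?R t x)) (at t)"
    using t by (simp add: at_within_open[of t "{0<..}"])
  have d2: "((\<lambda>t. \<integral>x. w x * j (?\<psi> t x) \<partial>torus) has_real_derivative
      integral (cbox 0 1) (\<lambda>x. j' (?\<psi> t x) * ?R t x)) (at t)"
    by (rule has_field_derivative_transform_within_open[OF d, of "{0<..}"])
      (use t torus_integral_eq[OF c1] in auto)
  have c\<psi>: "continuous_on UNIV (\<lambda>x. j' (?\<psi> t x))" "continuous_on UNIV (\<lambda>x. j'' (?\<psi> t x))"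
    using D[OF t] by (auto intro!: continuous_on_compose2[OF cj(2) torus_C1_continuous[OF \<Psi>[OF t]]]
       continuous_on_compose2[OF j'' torus_C1_continuous[OF \<Psi>[OF t]]])
  have "continuous_on UNIV (\<lambda>x. ?R t x)"
    by (rule continuous_on_compose2[OF rhs_continuous, of UNIV "\<lambda>x. (t, x)", unfolded fst_conv snd_conv])
      (use t in \<open>auto intro!: continuous_intros\<close>)
  then have "integral (cbox 0 1) (\<lambda>x. j' (?\<psi> t x) * ?R t x) = (\<integral>x. j' (?\<psi> t x) * ?R t x \<partial>torus)"
    using c\<psi>(1) by (intro torus_integral_eq[symmetric] continuous_on_mult)
  also have "\<dots> = - (\<integral>x. (j'' (?\<psi> t x) *\<^sub>R \<Psi> t x) \<bullet> flux \<beta> V W (f t) x \<partial>torus)"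
    by (rule mckean_vlasov_weak[OF V W f_C2[OF t] f_periodic])
      (use t torus_C1_compose[OF \<Psi>[OF t], of j' j''] j' D[OF t] c\<psi> in auto)
  finally show ?thesis using d2 by simp
qed

end

lemma torus_integral_square:
  fixes h :: "real^'d \<Rightarrow> real"
  assumes h: "integrable torus h" and h2: "integrable torus (\<lambda>x. (h x)\<^sup>2)"
  shows "(\<integral>x. h x \<partial>torus)\<^sup>2 \<le> (\<integral>x. (h x)\<^sup>2 \<partial>torus)"
proof -
  define m where "m = (\<integral>x. h x \<partial>torus)"
  have "0 \<le> (\<integral>x. (h x - m)\<^sup>2 \<partial>torus)" by simp
  also have "(\<lambda>x. (h x - m)\<^sup>2) = (\<lambda>x. ((h x)\<^sup>2 + m\<^sup>2) - (2 * m) * h x)"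
    by (simp add: power2_eq_square algebra_simps)
  also have "(\<integral>x. ((h x)\<^sup>2 + m\<^sup>2) - (2 * m) * h x \<partial>torus) = (\<integral>x. (h x)\<^sup>2 \<partial>torus) + m\<^sup>2 - 2 * m * m"
    using h h2 by (simp add: m_def[symmetric] torus.prob_space)
  finally show ?thesis by (simp add: m_def power2_eq_square)
qed

section \<open>A smoothed absolute value\<close>

lemma sqrt_regularization_DERIV:
  fixes r \<epsilon> :: real
  assumes "\<epsilon> > 0"
  shows "((\<lambda>r. sqrt (r\<^sup>2 + \<epsilon>\<^sup>2)) has_real_derivative r / sqrt (r\<^sup>2 + \<epsilon>\<^sup>2)) (at r)"
    and "((\<lambda>r. r / sqrt (r\<^sup>2 + \<epsilon>\<^sup>2)) has_real_derivative \<epsilon>\<^sup>2 / sqrt (r\<^sup>2 + \<epsilon>\<^sup>2) ^ 3) (at r)"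
proof -
  have p: "0 < r\<^sup>2 + \<epsilon>\<^sup>2" using assms by (simp add: add_nonneg_pos)
  then have s: "sqrt (r\<^sup>2 + \<epsilon>\<^sup>2) > 0" by simp
  have "((\<lambda>r. r\<^sup>2 + \<epsilon>\<^sup>2) has_real_derivative 2 * r) (at r)"
    by (auto intro!: derivative_eq_intros)
  from DERIV_chain2[OF DERIV_real_sqrt[OF p] this]
  show 1: "((\<lambda>r. sqrt (r\<^sup>2 + \<epsilon>\<^sup>2)) has_real_derivative r / sqrt (r\<^sup>2 + \<epsilon>\<^sup>2)) (at r)"
    by (simp add: field_simps)
  have s2: "sqrt (r\<^sup>2 + \<epsilon>\<^sup>2) * sqrt (r\<^sup>2 + \<epsilon>\<^sup>2) = r\<^sup>2 + \<epsilon>\<^sup>2" using p by simp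
  have aux: "(1 * S - r * (r / S)) / (S * S) = \<epsilon>\<^sup>2 / S ^ 3" if "S > 0" "S * S = r\<^sup>2 + \<epsilon>\<^sup>2" for S
  proof -
    have "(1 * S - r * (r / S)) / (S * S) = (S * S - r * r) / S ^ 3"
      using that(1) by (simp add: field_simps power3_eq_cube)
    then show ?thesis using that(2) by (simp add: power2_eq_square)
  qed
  show "((\<lambda>r. r / sqrt (r\<^sup>2 + \<epsilon>\<^sup>2)) has_real_derivative \<epsilon>\<^sup>2 / sqrt (r\<^sup>2 + \<epsilon>\<^sup>2) ^ 3) (at r)"
    using DERIV_divide[OF DERIV_ident 1 less_imp_neq[OF s, symmetric]] unfolding aux[OF s s2] .
qed

text \<open>One family serves two limits. For small \<epsilon> the root approximates the absolute
  value. For large \<epsilon>, \<open>\<epsilon> * (sqrt (r\<^sup>2 + \<epsilon>\<^sup>2) -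
  \<epsilon>)\<close> is a half square with linear growth; the last four bounds compare it and its
  second derivative with the half square.\<close>

lemma sqrt_regularization_bounds:
  fixes r \<epsilon> :: real
  assumes "\<epsilon> > 0"
  shows "\<bar>r\<bar> \<le> sqrt (r\<^sup>2 + \<epsilon>\<^sup>2)" "sqrt (r\<^sup>2 + \<epsilon>\<^sup>2) \<le> \<bar>r\<bar> + \<epsilon>"
    "0 \<le> \<epsilon>\<^sup>2 / sqrt (r\<^sup>2 + \<epsilon>\<^sup>2) ^ 3" "\<epsilon>\<^sup>2 / sqrt (r\<^sup>2 + \<epsilon>\<^sup>2) ^ 3 * r\<^sup>2 \<le> \<epsilon>"
    "\<epsilon> * (\<epsilon>\<^sup>2 / sqrt (r\<^sup>2 + \<epsilon>\<^sup>2) ^ 3) \<le> 1"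
    "\<epsilon> * (\<epsilon>\<^sup>2 / sqrt (r\<^sup>2 + \<epsilon>\<^sup>2) ^ 3) * r\<^sup>2 \<le> 2 * (\<epsilon> * (sqrt (r\<^sup>2 + \<epsilon>\<^sup>2) - \<epsilon>))"
    "\<epsilon> * (sqrt (r\<^sup>2 + \<epsilon>\<^sup>2) - \<epsilon>) \<le> r\<^sup>2 / 2"
    "r\<^sup>2 \<le> (2 + \<bar>r\<bar> / \<epsilon>) * (\<epsilon> * (sqrt (r\<^sup>2 + \<epsilon>\<^sup>2) - \<epsilon>))"
proof -
  define S where "S = sqrt (r\<^sup>2 + \<epsilon>\<^sup>2)"
  have S2: "S\<^sup>2 = r\<^sup>2 + \<epsilon>\<^sup>2" by (simp add: S_def)
  have S\<epsilon>: "\<epsilon> \<le> S" unfolding S_def using assms by (intro real_le_rsqrt) simp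
  have Sp: "S > 0" using S\<epsilon> assms by simp
  show "\<bar>r\<bar> \<le> sqrt (r\<^sup>2 + \<epsilon>\<^sup>2)" by (intro real_le_rsqrt) simp
  show Su: "sqrt (r\<^sup>2 + \<epsilon>\<^sup>2) \<le> \<bar>r\<bar> + \<epsilon>"
    using assms by (intro real_le_lsqrt) (auto simp: power2_sum)
  show "0 \<le> \<epsilon>\<^sup>2 / sqrt (r\<^sup>2 + \<epsilon>\<^sup>2) ^ 3" by simp
  show "\<epsilon>\<^sup>2 / sqrt (r\<^sup>2 + \<epsilon>\<^sup>2) ^ 3 * r\<^sup>2 \<le> \<epsilon>"
  proof -
    have "\<epsilon> * r\<^sup>2 \<le> S * S\<^sup>2" using S\<epsilon> Sp assms by (intro mult_mono) (auto simp: S2)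
    then have "\<epsilon> * (\<epsilon> * r\<^sup>2) \<le> \<epsilon> * (S * S\<^sup>2)" using assms by (intro mult_left_mono) auto
    then show ?thesis unfolding S_def[symmetric] using Sp
      by (simp add: pos_divide_le_eq power2_eq_square power3_eq_cube mult_ac)
  qed
  show "\<epsilon> * (\<epsilon>\<^sup>2 / sqrt (r\<^sup>2 + \<epsilon>\<^sup>2) ^ 3) \<le> 1"
  proof -
    have "\<epsilon> ^ 3 \<le> S ^ 3" using S\<epsilon> assms by (intro power_mono) auto
    then show ?thesis unfolding S_def[symmetric] using Sp by (simp add: power2_eq_square power3_eq_cube)
  qed
  have r2: "r\<^sup>2 = (S - \<epsilon>) * (S + \<epsilon>)" using S2 by (simp add: power2_eq_square algebra_simps)
  show "\<epsilon> * (\<epsilon>\<^sup>2 / sqrt (r\<^sup>2 + \<epsilon>\<^sup>2) ^ 3) * r\<^sup>2 \<le> 2 * (\<epsilon> * (sqrt (r\<^sup>2 + \<epsilon>\<^sup>2) - \<epsilon>))"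
  proof -
    have "\<epsilon>\<^sup>2 * (S + \<epsilon>) \<le> S\<^sup>2 * (S + S)" using S\<epsilon> assms by (intro mult_mono power_mono) auto
    then have "\<epsilon>\<^sup>2 / S ^ 3 * (S + \<epsilon>) \<le> 2"
      using Sp by (simp add: pos_divide_le_eq power2_eq_square power3_eq_cube mult_ac)
    then have "(\<epsilon> * (S - \<epsilon>)) * (\<epsilon>\<^sup>2 / S ^ 3 * (S + \<epsilon>)) \<le> (\<epsilon> * (S - \<epsilon>)) * 2"
      using S\<epsilon> assms by (intro mult_left_mono) auto
    then show ?thesis unfolding S_def[symmetric] unfolding r2 by (simp add: mult_ac)
  qed
  show "\<epsilon> * (sqrt (r\<^sup>2 + \<epsilon>\<^sup>2) - \<epsilon>) \<le> r\<^sup>2 / 2"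
  proof -
    have "(2 * \<epsilon>) * (S - \<epsilon>) \<le> (S + \<epsilon>) * (S - \<epsilon>)" using S\<epsilon> by (intro mult_right_mono) auto
    then show ?thesis unfolding S_def[symmetric] unfolding r2 by (simp add: mult_ac)
  qed
  show "r\<^sup>2 \<le> (2 + \<bar>r\<bar> / \<epsilon>) * (\<epsilon> * (sqrt (r\<^sup>2 + \<epsilon>\<^sup>2) - \<epsilon>))"
  proof -
    have "(S - \<epsilon>) * (S + \<epsilon>) \<le> (S - \<epsilon>) * (2 * \<epsilon> + \<bar>r\<bar>)"
      using S\<epsilon> Su[folded S_def] by (intro mult_left_mono) auto
    also have "\<dots> = (2 + \<bar>r\<bar> / \<epsilon>) * (\<epsilon> * (S - \<epsilon>))" using assms by (simp add: field_simps)
    finally show ?thesis unfolding S_def[symmetric] unfolding r2 .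
  qed
qed

context mckean_vlasov
begin

lemma f_integrable: "t \<ge> 0 \<Longrightarrow> integrable torus (f t)"
  using f0_integrable torus_integrable[OF f_continuous[of t]] by (cases "t = 0") auto

text \<open>The weight cancels against the denominator of the ratio, so for Lipschitz
  \<open>j\<close> the difference is at most \<open>C\<close> times the \<open>L\<^sup>1\<close>
  distance of \<open>f t\<close> to \<open>f 0\<close>, the only convergence granted at time
  0.\<close>

lemma functional_initial:
  fixes w p :: "real^'d \<Rightarrow> real" and j :: "real \<Rightarrow> real"
  assumes w: "\<And>x. 0 < w x"
    and lip: "\<And>r s. r \<in> S \<Longrightarrow> s \<in> S \<Longrightarrow> \<bar>j r - j s\<bar> \<le> C * \<bar>r - s\<bar>"
    and S: "\<And>t x. t \<ge> 0 \<Longrightarrow> (f t x - p x) / w x \<in> S"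
    and int: "\<And>t. t \<ge> 0 \<Longrightarrow> integrable torus (\<lambda>x. w x * j ((f t x - p x) / w x))"
  shows "((\<lambda>t. \<integral>x. w x * j ((f t x - p x) / w x) \<partial>torus) \<longlongrightarrow> (\<integral>x. w x * j ((f 0 x - p x) / w x) \<partial>torus)) (at_right 0)"
proof (rule LIM_zero_cancel, rule Lim_null_comparison)
  let ?J = "\<lambda>t x. w x * j ((f t x - p x) / w x)"
  show "((\<lambda>t. C * (\<integral>x. \<bar>f t x - f 0 x\<bar> \<partial>torus)) \<longlongrightarrow> 0) (at_right 0)"
    using tendsto_mult_left[OF initial_L1, of C] by simp
  have "norm ((\<integral>x. ?J t x \<partial>torus) - (\<integral>x. ?J 0 x \<partial>torus)) \<le> C * (\<integral>x. \<bar>f t x - f 0 x\<bar> \<partial>torus)" if t: "t > 0" for t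
  proof -
    have "norm ((\<integral>x. ?J t x \<partial>torus) - (\<integral>x. ?J 0 x \<partial>torus)) = norm (\<integral>x. ?J t x - ?J 0 x \<partial>torus)"
      using int[of t] int[of 0] t by simp
    also have "\<dots> \<le> (\<integral>x. norm (?J t x - ?J 0 x) \<partial>torus)" by (rule integral_norm_bound)
    also have "\<dots> \<le> (\<integral>x. C * \<bar>f t x - f 0 x\<bar> \<partial>torus)"
    proof (rule integral_mono)
      show "integrable torus (\<lambda>x. norm (?J t x - ?J 0 x))"
        using int[of t] int[of 0] t by simp
      show "integrable torus (\<lambda>x. C * \<bar>f t x - f 0 x\<bar>)"
        using f_integrable[of t] f_integrable[of 0] t by simp
      fix x
      have "\<bar>j ((f t x - p x) / w x) - j ((f 0 x - p x) / w x)\<bar> \<le> C * \<bar>(f t x - p x) / w x - (f 0 x - p x) / w x\<bar>"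
        using t by (intro lip S) auto
      also have "(f t x - p x) / w x - (f 0 x - p x) / w x = (f t x - f 0 x) / w x"
        by (simp add: diff_divide_distrib)
      finally have "w x * \<bar>j ((f t x - p x) / w x) - j ((f 0 x - p x) / w x)\<bar> \<le> w x * (C * (\<bar>f t x - f 0 x\<bar> / w x))"
        using w[of x] by (intro mult_left_mono) (auto simp: abs_divide)
      then show "norm (?J t x - ?J 0 x) \<le> C * \<bar>f t x - f 0 x\<bar>"
        using w[of x] by (simp add: abs_mult right_diff_distrib[symmetric])
    qed
    finally show ?thesis by simp
  qed
  then show "\<forall>\<^sub>F t in at_right 0. norm ((\<integral>x. ?J t x \<partial>torus) - (\<integral>x. ?J 0 x \<partial>torus)) \<le> C * (\<integral>x. \<bar>f t x - f 0 x\<bar> \<partial>torus)"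
    using eventually_at_right_less[of "0::real"] by (rule eventually_mono[rotated])
qed

text \<open>The gradient of the ratio \<open>f t x / g x\<close>.\<close>

definition "\<Phi> t x = inverse (g x) *\<^sub>R (grad (f t) x - (f t x / g x) *\<^sub>R grad g x)"

text \<open>The term \<open>- 0\<close> gives the ratio the shape expected by
  \<open>functional_derivative\<close> with \<open>p\<close> equal to 0.\<close>

lemma ratio_C1: 
  assumes "t > 0"
  shows "torus_C1 (\<lambda>x. (f t x - 0) / g x) (\<Phi> t)"
proof -
  have ne: "g x \<noteq> 0" for x using g_pos[of x] by simp
  have "torus_C1 (\<lambda>x. inverse (g x)) (\<lambda>x. (- (inverse (g x) * inverse (g x))) *\<^sub>R grad g x)"
  proof (rule torus_C1_compose[OF g_C1])
    show "(inverse has_real_derivative - (inverse (g x) * inverse (g x))) (at (g x))" for x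
      using DERIV_inverse[OF ne[of x]] by (simp add: power2_eq_square)
    show "continuous_on UNIV (\<lambda>x. - (inverse (g x) * inverse (g x)))"
      by (intro continuous_intros g_continuous) (use ne in auto)
  qed
  from torus_C1_mult[OF f_C1[OF assms] this]
  have "torus_C1 (\<lambda>x. f t x * inverse (g x)) (\<lambda>x. f t x *\<^sub>R (- (inverse (g x) * inverse (g x))) *\<^sub>R grad g x + inverse (g x) *\<^sub>R grad (f t) x)" .
  moreover have "f t x *\<^sub>R (- (inverse (g x) * inverse (g x))) *\<^sub>R grad g x + inverse (g x) *\<^sub>R grad (f t) x = \<Phi> t x" for x
    by (simp add: \<Phi>_def scaleR_diff_right divide_inverse mult_ac)
  ultimately show ?thesis by (simp add: divide_inverse)
qed

lemma g_\<Phi>: "g x *\<^sub>R \<Phi> t x = grad (f t) x + (\<beta> * f t x) *\<^sub>R drift x"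
proof -
  have "g x *\<^sub>R \<Phi> t x = grad (f t) x - (f t x / g x) *\<^sub>R grad g x"
    using g_pos[of x] by (simp add: \<Phi>_def)
  then show ?thesis using g_pos[of x] by (simp add: grad_g)
qed

text \<open>Written in terms of the ratio, the equilibrium drift disappears from the flux: what
  remains is diffusion of the ratio and the interaction force of the deviation
  \<open>u t\<close>.\<close>

lemma flux_ratio:
  assumes "t > 0"
  shows "flux \<beta> V W (f t) x = g x *\<^sub>R (inverse \<beta> *\<^sub>R \<Phi> t x + (f t x / g x) *\<^sub>R v t x)"
proof -
  have "g x *\<^sub>R (inverse \<beta> *\<^sub>R \<Phi> t x + (f t x / g x) *\<^sub>R v t x) = inverse \<beta> *\<^sub>R (g x *\<^sub>R \<Phi> t x) + f t x *\<^sub>R v t x"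
    using g_pos[of x] by (simp add: scaleR_add_right mult.commute)
  then show ?thesis using \<beta> unfolding flux_f[OF assms] g_\<Phi> by (simp add: scaleR_add_right)
qed

lemma \<Phi>_continuous: "t > 0 \<Longrightarrow> continuous_on UNIV (\<Phi> t)"
  by (rule torus_C1_D(2)[OF ratio_C1])

lemma flux_f_continuous: "t > 0 \<Longrightarrow> continuous_on UNIV (flux \<beta> V W (f t))"
  by (intro flux_continuous V W f_C2 f_periodic) simp_all

text \<open>Here \<open>c\<close> stands for \<open>j''\<close> at the ratio \<open>r\<close>. After
  the square is completed only \<open>j'' r * r\<^sup>2\<close> matters, so a bound on this quantity
  limits the growth of the functional without any information on the gradient.\<close>

lemma convex_dissipation:
  assumes t: "t > 0" and c: "0 \<le> c" and K: "c * (f t x / g x)\<^sup>2 \<le> K" and C: "norm (v t x) \<le> C"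
  shows "- (c * (\<Phi> t x \<bullet> flux \<beta> V W (f t) x)) \<le> g x * (\<beta> * K * C\<^sup>2 / 4)"
proof -
  define r where "r = f t x / g x"
  have "- (c * (\<Phi> t x \<bullet> flux \<beta> V W (f t) x)) = g x * (c * - (inverse \<beta> * (norm (\<Phi> t x))\<^sup>2 + \<Phi> t x \<bullet> (r *\<^sub>R v t x)))"
    unfolding flux_ratio[OF t] r_def by (simp add: inner_add_right power2_norm_eq_inner algebra_simps)
  also have "\<dots> \<le> g x * (c * (\<beta> * (norm (r *\<^sub>R v t x))\<^sup>2 / 4))"
    using g_pos[of x] c by (intro mult_left_mono young_flux \<beta>) (auto simp: less_imp_le)
  also have "\<dots> = g x * (\<beta> * ((c * r\<^sup>2) * (norm (v t x))\<^sup>2) / 4)"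
    by (simp add: power_mult_distrib algebra_simps)
  also have "\<dots> \<le> g x * (\<beta> * (K * C\<^sup>2) / 4)"
  proof -
    have "0 \<le> K" using K c by (meson mult_nonneg_nonneg order_trans zero_le_power2)
    then have "(c * r\<^sup>2) * (norm (v t x))\<^sup>2 \<le> K * C\<^sup>2"
      using K c C unfolding r_def by (intro mult_mono power_mono) auto
    then show ?thesis using g_pos[of x] \<beta> by (intro mult_left_mono divide_right_mono) (auto simp: less_imp_le)
  qed
  finally show ?thesis by (simp add: mult.assoc)
qed

text \<open>For the smoothed absolute value, \<open>j'' r * r\<^sup>2\<close> is at most \<epsilon>,
  so the functional grows at rate at most a multiple of \<epsilon>, which then tends to 0. With
  weight \<open>g\<close> the limiting functional is the \<open>L\<^sup>1\<close> norm of
  \<open>f\<close> itself.\<close>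

lemma L1_decreasing:
  assumes s: "0 < s" and st: "s \<le> t"
  shows "(\<integral>x. \<bar>f t x\<bar> \<partial>torus) \<le> (\<integral>x. \<bar>f s x\<bar> \<partial>torus)"
proof -
  have t: "t > 0" using s st by simp
  \<comment> \<open>The bound of \<open>L\<close> by 2 depends on nonnegativity, which is derived
    from the present lemma; until then the interaction force is bounded by compactness on
    \<open>{s..t}\<close>.\<close>
  have "compact ((\<lambda>p. f (fst p) (snd p)) ` ({s..t} \<times> cbox 0 1))"
    using s by (intro compact_continuous_image compact_Times compact_Icc compact_cbox continuous_on_subset[OF f_continuous_joint]) auto
  then obtain B where B: "\<And>\<tau> x. \<tau> \<in> {s..t} \<Longrightarrow> x \<in> cbox 0 1 \<Longrightarrow> \<bar>f \<tau> x\<bar> \<le> B"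
    using compact_imp_bounded[THEN bounded_iff[THEN iffD1]] by fastforce
  have fB: "\<bar>f \<tau> x\<bar> \<le> B" if \<tau>: "\<tau> \<in> {s..t}" for \<tau> x
  proof -
    have "periodic (f \<tau>)" using f_periodic \<tau> s by simp
    then obtain y where "y \<in> cbox 0 1" "f \<tau> y = f \<tau> x" using periodic_unit_cube by blast
    then show ?thesis using B[OF \<tau>] by metis
  qed
  have LB: "L \<tau> \<le> B + \<Gamma>" if \<tau>: "\<tau> \<in> {s..t}" for \<tau>
  proof -
    have "L \<tau> \<le> (\<integral>x. B + \<Gamma> \<partial>(torus :: (real^'d) measure))"
      unfolding L_def
    proof (rule torus_mono)
      show "continuous_on UNIV (\<lambda>x. \<bar>u \<tau> x\<bar>)" using \<tau> s by (intro continuous_intros u_continuous) simp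
      show "\<bar>u \<tau> x\<bar> \<le> B + \<Gamma>" for x
        using fB[OF \<tau>, of x] g_le[of x] g_nonneg[of x] unfolding u_def by linarith
    qed (intro continuous_intros)
    then show ?thesis by (simp add: torus.prob_space)
  qed
  define C where "C = b * (B + \<Gamma>)"
  have vC: "norm (v \<tau> x) \<le> C" if \<tau>: "\<tau> \<in> {s..t}" for \<tau> x
    using norm_v[of \<tau> x] mult_left_mono[OF LB[OF \<tau>] b_nonneg] \<tau> s by (auto simp: C_def)
  define K where "K = \<beta> * C\<^sup>2 / 4"
  have main: "(\<integral>x. \<bar>f t x\<bar> \<partial>torus) \<le> (\<integral>x. \<bar>f s x\<bar> \<partial>torus) + \<epsilon> * (1 + K * (t - s))" if \<epsilon>: "\<epsilon> > 0" for \<epsilon>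
  proof -
    let ?j = "\<lambda>r. sqrt (r\<^sup>2 + \<epsilon>\<^sup>2)" and ?j'' = "\<lambda>r. \<epsilon>\<^sup>2 / sqrt (r\<^sup>2 + \<epsilon>\<^sup>2) ^ 3"
    define y where "y t = (\<integral>x. g x * ?j ((f t x - 0) / g x) \<partial>torus)" for t
    define y' where "y' t = - (\<integral>x. ?j'' ((f t x - 0) / g x) * (\<Phi> t x \<bullet> flux \<beta> V W (f t) x) \<partial>torus)" for t
    have ne: "r\<^sup>2 + \<epsilon>\<^sup>2 \<noteq> 0" for r using \<epsilon> by (simp add: add_nonneg_eq_0_iff)
    have dy: "(y has_real_derivative y' \<tau>) (at \<tau>)" if "\<tau> > 0" for \<tau>
      unfolding y_def y'_def
      by (rule functional_derivative[where D=UNIV and j'="\<lambda>r. r / sqrt (r\<^sup>2 + \<epsilon>\<^sup>2)", OF g_C1 g_pos torus_C1_const ratio_C1])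
        (use that sqrt_regularization_DERIV[OF \<epsilon>] ne in \<open>auto intro!: continuous_intros\<close>)
    have y'le: "y' \<tau> \<le> \<epsilon> * K" if \<tau>: "\<tau> \<in> {s..t}" for \<tau>
    proof -
      have \<tau>0: "\<tau> > 0" using \<tau> s by simp
      have "y' \<tau> = (\<integral>x. - (?j'' ((f \<tau> x - 0) / g x) * (\<Phi> \<tau> x \<bullet> flux \<beta> V W (f \<tau>) x)) \<partial>torus)"
        by (simp add: y'_def)
      also have "\<dots> \<le> (\<integral>x. g x * (\<beta> * \<epsilon> * C\<^sup>2 / 4) \<partial>torus)"
      proof (rule torus_mono)
        show "continuous_on UNIV (\<lambda>x. - (?j'' ((f \<tau> x - 0) / g x) * (\<Phi> \<tau> x \<bullet> flux \<beta> V W (f \<tau>) x)))"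
          by (intro continuous_intros torus_C1_continuous[OF ratio_C1[OF \<tau>0]] \<Phi>_continuous flux_f_continuous \<tau>0)
            (use ne in auto)
        show "- (?j'' ((f \<tau> x - 0) / g x) * (\<Phi> \<tau> x \<bullet> flux \<beta> V W (f \<tau>) x)) \<le> g x * (\<beta> * \<epsilon> * C\<^sup>2 / 4)" for x
          using sqrt_regularization_bounds(3,4)[OF \<epsilon>, of "f \<tau> x / g x"]
          by (simp only: diff_zero) (rule convex_dissipation[OF \<tau>0 _ _ vC[OF \<tau>]])
      qed (intro continuous_intros g_continuous)
      also have "\<dots> = \<epsilon> * K" by (simp add: g_mass K_def)
      finally show ?thesis .
    qed
    have "y t - \<epsilon> * K * t \<le> y s - \<epsilon> * K * s"
    proof (rule DERIV_nonpos_imp_nonincreasing[of s t "\<lambda>\<tau>. y \<tau> - \<epsilon> * K * \<tau>", OF st])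
      fix \<tau> assume \<tau>: "s \<le> \<tau>" "\<tau> \<le> t"
      have "((\<lambda>\<tau>. y \<tau> - \<epsilon> * K * \<tau>) has_real_derivative y' \<tau> - \<epsilon> * K) (at \<tau>)"
        using \<tau> s by (auto intro!: derivative_eq_intros dy)
      then show "\<exists>D. ((\<lambda>\<tau>. y \<tau> - \<epsilon> * K * \<tau>) has_real_derivative D) (at \<tau>) \<and> D \<le> 0"
        using y'le[of \<tau>] \<tau> by auto
    qed
    moreover have "(\<integral>x. \<bar>f t x\<bar> \<partial>torus) \<le> y t"
      unfolding y_def
    proof (rule torus_mono)
      show "\<bar>f t x\<bar> \<le> g x * ?j ((f t x - 0) / g x)" for x
        using mult_left_mono[OF sqrt_regularization_bounds(1)[OF \<epsilon>, of "f t x / g x"] g_nonneg[of x]] g_pos[of x]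
        by (simp add: abs_divide)
    qed (intro continuous_intros f_continuous g_continuous torus_C1_continuous[OF ratio_C1] t)+
    moreover have "y s \<le> (\<integral>x. \<bar>f s x\<bar> + \<epsilon> * g x \<partial>torus)"
      unfolding y_def
    proof (rule torus_mono)
      show "g x * ?j ((f s x - 0) / g x) \<le> \<bar>f s x\<bar> + \<epsilon> * g x" for x
        using mult_left_mono[OF sqrt_regularization_bounds(2)[OF \<epsilon>, of "f s x / g x"] g_nonneg[of x]] g_pos[of x]
        by (simp add: abs_divide distrib_left mult.commute)
    qed (intro continuous_intros f_continuous g_continuous torus_C1_continuous[OF ratio_C1] s)+
    moreover have "(\<integral>x. \<bar>f s x\<bar> + \<epsilon> * g x \<partial>torus) = (\<integral>x. \<bar>f s x\<bar> \<partial>torus) + \<epsilon>"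
      using f_integrable[of s] s torus_integrable[OF g_continuous] by (simp add: g_mass)
    ultimately show ?thesis by (simp add: algebra_simps)
  qed
  have "0 \<le> K" using \<beta> by (simp add: K_def)
  then have k: "1 + K * (t - s) > 0" using st by (simp add: add_pos_nonneg)
  show ?thesis
  proof (rule field_le_epsilon)
    fix e :: real assume "e > 0"
    then show "(\<integral>x. \<bar>f t x\<bar> \<partial>torus) \<le> (\<integral>x. \<bar>f s x\<bar> \<partial>torus) + e"
      using main[of "e / (1 + K * (t - s))"] k by simp
  qed
qed

section \<open>Conservation of mass and positivity\<close>

lemma mass_tendsto: "((\<lambda>t. \<integral>x. f t x \<partial>torus) \<longlongrightarrow> 1) (at_right 0)"
  using functional_initial[where w="\<lambda>x. 1" and p="\<lambda>x. 0" and j="\<lambda>r. r" and C=1 and S=UNIV] f_integrable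
  by (simp add: f0_mass)

lemma f_mass: assumes "t > 0" shows "(\<integral>x. f t x \<partial>torus) = 1"
proof -
  have d: "((\<lambda>t. \<integral>x. f t x \<partial>torus) has_real_derivative 0) (at t)" if "t > 0" for t
    using functional_derivative[where w="\<lambda>x. 1" and p="\<lambda>x. 0" and j="\<lambda>r. r" and j'="\<lambda>r. 1" and j''="\<lambda>r. 0" and D=UNIV and \<Psi>="\<lambda>t. grad (f t)",
        OF torus_C1_const _ torus_C1_const _ _ _ _ _ that] f_C1 by simp
  have "(\<integral>x. f t x \<partial>torus) \<le> exp (0 * t) * (1 + 0 * t * exp (\<bar>0\<bar> * t))"
    by (rule gronwall_initial[OF d _ _ _ mass_tendsto assms]) auto
  moreover have "- (\<integral>x. f t x \<partial>torus) \<le> exp (0 * t) * (- 1 + 0 * t * exp (\<bar>0\<bar> * t))"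
    by (rule gronwall_initial[OF DERIV_minus[OF d] _ _ _ tendsto_minus[OF mass_tendsto] assms]) auto
  ultimately show ?thesis by simp
qed

text \<open>The \<open>L\<^sup>1\<close> norm never exceeds its initial value 1, which is also the
  conserved mass. The integral of \<open>\<bar>f t x\<bar> - f t x\<close> therefore
  vanishes.\<close>

lemma f_nonneg: assumes "t \<ge> 0" shows "0 \<le> f t x"
proof (cases "t = 0")
  case True then show ?thesis using f0_nonneg by simp
next
  case False
  then have t: "t > 0" using assms by simp
  have "(\<integral>x. \<bar>f t x\<bar> \<partial>torus) \<le> 1 + 0"
  proof (rule tendsto_lowerbound)
    show "((\<lambda>s. 1 + (\<integral>x. \<bar>f s x - f 0 x\<bar> \<partial>torus)) \<longlongrightarrow> 1 + 0) (at_right 0)"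
      by (intro tendsto_intros initial_L1)
    have "(\<integral>x. \<bar>f t x\<bar> \<partial>torus) \<le> 1 + (\<integral>x. \<bar>f s x - f 0 x\<bar> \<partial>torus)" if s: "0 < s" "s < t" for s
    proof -
      have i: "integrable torus (f s)" "integrable torus (f 0)" using f_integrable s by simp_all
      have "(\<integral>x. \<bar>f t x\<bar> \<partial>torus) \<le> (\<integral>x. \<bar>f s x\<bar> \<partial>torus)" using s by (intro L1_decreasing) auto
      also have "\<dots> \<le> (\<integral>x. f 0 x + \<bar>f s x - f 0 x\<bar> \<partial>torus)"
      proof (rule integral_mono)
        show "\<bar>f s x\<bar> \<le> f 0 x + \<bar>f s x - f 0 x\<bar>" for x using f0_nonneg[of x] by linarith
      qed (use i in simp_all)
      also have "\<dots> = 1 + (\<integral>x. \<bar>f s x - f 0 x\<bar> \<partial>torus)" using i by (simp add: f0_mass)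
      finally show ?thesis .
    qed
    then show "\<forall>\<^sub>F s in at_right 0. (\<integral>x. \<bar>f t x\<bar> \<partial>torus) \<le> 1 + (\<integral>x. \<bar>f s x - f 0 x\<bar> \<partial>torus)"
      unfolding eventually_at_right[OF t] using t by blast
  qed simp
  then have "(\<integral>x. \<bar>f t x\<bar> - f t x \<partial>torus) \<le> 0"
    using f_integrable[OF assms] f_mass[OF t] by simp
  moreover have "0 \<le> (\<integral>x. \<bar>f t x\<bar> - f t x \<partial>torus)" by simp
  ultimately have "(\<integral>x. \<bar>f t x\<bar> - f t x \<partial>torus) = 0" by linarith
  then have "\<bar>f t x\<bar> - f t x = 0"
    by (intro torus_integral_zero[of "\<lambda>x. \<bar>f t x\<bar> - f t x"] continuous_intros f_continuous t)
      (use f_periodic[OF assms] in \<open>auto simp: periodic_def\<close>)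
  then show ?thesis by simp
qed

lemma u_mean: "t > 0 \<Longrightarrow> (\<integral>x. u t x \<partial>torus) = 0"
  unfolding u_def using f_mass f_integrable[of t] torus_integrable[OF g_continuous] by (simp add: g_mass)

lemma L_le_2: assumes "t > 0" shows "L t \<le> 2"
proof -
  have "L t \<le> (\<integral>x. f t x + g x \<partial>torus)"
    unfolding L_def u_def
  proof (rule torus_mono)
    show "\<bar>f t x - g x\<bar> \<le> f t x + g x" for x using f_nonneg[of t x] g_nonneg[of x] assms by linarith
  qed (intro continuous_intros f_continuous g_continuous assms)+
  also have "\<dots> = 2"
    using f_mass[OF assms] f_integrable[of t] assms torus_integrable[OF g_continuous] by (simp add: g_mass)
  finally show ?thesis .
qed

lemma L_nonneg: "0 \<le> L t" by (simp add: L_def)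

end

section \<open>Decay from square-integrable data\<close>

lemma lipschitz_from_derivative:
  fixes j j' :: "real \<Rightarrow> real"
  assumes "convex S" "\<And>r. r \<in> S \<Longrightarrow> (j has_real_derivative j' r) (at r)" "\<And>r. r \<in> S \<Longrightarrow> \<bar>j' r\<bar> \<le> C"
    and "r \<in> S" "s \<in> S"
  shows "\<bar>j r - j s\<bar> \<le> C * \<bar>r - s\<bar>"
  using field_differentiable_bound[of S j j' C r s] assms has_field_derivative_at_within by fastforce

context mckean_vlasov
begin

text \<open>The drift part of the flux of \<open>f t\<close> minus that of \<open>g\<close>. The
  flux of \<open>g\<close> is 0, so the flux of \<open>f t\<close> consists of \<open>Y\<close> and
  the scaled gradient of \<open>u t\<close>.\<close>

definition "Y t x = u t x *\<^sub>R (drift x + v t x) + g x *\<^sub>R v t x"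

lemma flux_difference:
  assumes "t > 0"
  shows "flux \<beta> V W (f t) x = inverse \<beta> *\<^sub>R (grad (f t) x - grad g x) + Y t x"
proof -
  have "inverse \<beta> *\<^sub>R grad g x = - (g x *\<^sub>R drift x)" using \<beta> by (simp add: grad_g)
  then show ?thesis unfolding flux_f[OF assms] Y_def u_def
    by (simp add: scaleR_diff_right scaleR_add_right scaleR_diff_left)
qed

text \<open>The factor of \<open>u t x\<close> is the full drift generated by the probability
  density \<open>f t\<close>, hence bounded by \<open>a + b\<close> without \<open>L t\<close>; only
  the part carried by \<open>g\<close> sees \<open>L t\<close>. This grouping produces the
  combination \<open>a + (1 + \<Gamma>) * b\<close> of \<open>zeta_const\<close>.\<close>

lemma norm_Y:
  assumes t: "t > 0"
  shows "norm (Y t x) \<le> \<bar>u t x\<bar> * (a + b) + \<Gamma> * b * L t"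
proof -
  have "drift x + v t x = grad V x + conv (grad W) (f t) x"
    using conv_diff[OF grad_W_continuous f_continuous[OF t] g_continuous, of x]
    by (simp add: v_def u_def[abs_def] drift_def)
  moreover have "norm (conv (grad W) (f t) x) \<le> b"
    using norm_conv_le[OF grad_W_continuous f_continuous[OF t] norm_grad_W, of x] f_nonneg[of t] f_mass[OF t] t by simp
  ultimately have "norm (drift x + v t x) \<le> a + b"
    using norm_grad_V[of x] norm_triangle_ineq[of "grad V x" "conv (grad W) (f t) x"] by simp
  then have "norm (u t x *\<^sub>R (drift x + v t x)) \<le> \<bar>u t x\<bar> * (a + b)"
    by (simp add: mult_left_mono)
  moreover have "norm (g x *\<^sub>R v t x) \<le> \<Gamma> * (b * L t)"
    using norm_v[OF t, of x] g_le[of x] g_nonneg[of x] \<Gamma>_pos by (simp add: mult_mono)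
  ultimately show ?thesis
    unfolding Y_def using norm_triangle_ineq[of "u t x *\<^sub>R (drift x + v t x)" "g x *\<^sub>R v t x"] by simp
qed

lemma L2_functional_derivative:
  assumes j: "\<And>r. (j has_real_derivative j' r) (at r)" "\<And>r. (j' has_real_derivative j'' r) (at r)"
    "continuous_on UNIV j''" and t: "t > 0"
  shows "((\<lambda>t. \<integral>x. j (u t x) \<partial>torus) has_real_derivative
    (\<integral>x. - (j'' (u t x) * ((grad (f t) x - grad g x) \<bullet> flux \<beta> V W (f t) x)) \<partial>torus)) (at t)"
  using functional_derivative[where w="\<lambda>x. 1" and p=g and D=UNIV and j=j and j'=j' and j''=j''
      and \<Psi>="\<lambda>t x. grad (f t) x - grad g x", OF torus_C1_const _ g_C1 _ _ j(1) j(2) j(3) t] u_C1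
  by (simp add: u_def[abs_def])

lemma initial_measurable: "f 0 \<in> borel_measurable torus" "g \<in> borel_measurable torus"
  using f0_integrable torus_integrable[OF g_continuous] by (auto intro: borel_measurable_integrable)

lemma u_integrable: "t \<ge> 0 \<Longrightarrow> integrable torus (u t)"
  unfolding u_def by (intro Bochner_Integration.integrable_diff f_integrable torus_integrable g_continuous)

text \<open>The convex functions \<open>N (sqrt (r\<^sup>2 + N\<^sup>2) - N)\<close> increase to \<open>r\<^sup>2 / 2\<close> and are
  Lipschitz, so that the integrals of \<open>u\<close> under them are continuous at time 0, where
  the initial datum is only attained in \<open>L\<^sup>1\<close>.\<close>

lemma L2_bound:
  assumes U0: "integrable torus (\<lambda>x. (u 0 x)\<^sup>2)" and t: "t > 0"
  defines "A \<equiv> \<beta> * (a + b)\<^sup>2" and "B \<equiv> 2 * \<beta> * \<Gamma>\<^sup>2 * b\<^sup>2"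
  shows "(\<integral>x. (u t x)\<^sup>2 \<partial>torus) \<le> 2 * (exp (A * t) * ((\<integral>x. (u 0 x)\<^sup>2 \<partial>torus) / 2 + B * t * exp (\<bar>A\<bar> * t)))"
proof -
  define R where "R = exp (A * t) * ((\<integral>x. (u 0 x)\<^sup>2 \<partial>torus) / 2 + B * t * exp (\<bar>A\<bar> * t))"
  \<comment> \<open>At the fixed time \<open>t\<close> the deviation is bounded, so its square is at
    most \<open>2 + S / N\<close> times the truncated half square, and the factor tends to
    2.\<close>
  obtain S where S: "S > 0" "\<And>x. norm (u t x) \<le> S"
    using periodic_bounded[OF u_continuous[OF t] torus_C1_D(1)[OF u_C1[OF t]]] by blast
  have main: "(\<integral>x. (u t x)\<^sup>2 \<partial>torus) \<le> (2 + S / N) * R" if N: "N > 0" for N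
  proof -
    let ?j = "\<lambda>r. N * (sqrt (r\<^sup>2 + N\<^sup>2) - N)" and ?j' = "\<lambda>r. N * (r / sqrt (r\<^sup>2 + N\<^sup>2))"
      and ?j'' = "\<lambda>r. N * (N\<^sup>2 / sqrt (r\<^sup>2 + N\<^sup>2) ^ 3)"
    note bd = sqrt_regularization_bounds[OF N]
    have ne: "r\<^sup>2 + N\<^sup>2 \<noteq> 0" for r using N by (simp add: add_nonneg_eq_0_iff)
    have j: "(?j has_real_derivative ?j' r) (at r)" "(?j' has_real_derivative ?j'' r) (at r)" for r
      using DERIV_cmult[OF DERIV_diff[OF sqrt_regularization_DERIV(1)[OF N] DERIV_const[of N]], of N r]
        DERIV_cmult[OF sqrt_regularization_DERIV(2)[OF N], of N r] by simp_all
    have cj'': "continuous_on UNIV ?j''" by (intro continuous_intros) (use ne in auto)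
    define y where "y t = (\<integral>x. ?j (u t x) \<partial>torus)" for t
    define y' where "y' t = (\<integral>x. - (?j'' (u t x) * ((grad (f t) x - grad g x) \<bullet> flux \<beta> V W (f t) x)) \<partial>torus)" for t
    have dy: "(y has_real_derivative y' \<tau>) (at \<tau>)" if "\<tau> > 0" for \<tau>
      unfolding y_def y'_def by (rule L2_functional_derivative[OF j cj'' that])
    have le: "y' \<tau> \<le> A * y \<tau> + B" if \<tau>: "\<tau> > 0" for \<tau>
    proof -
      have cy: "continuous_on UNIV (\<lambda>x. ?j (u \<tau> x))" by (intro continuous_intros u_continuous \<tau>)
      have "y' \<tau> \<le> (\<integral>x. A * ?j (u \<tau> x) + B \<partial>torus)"
        unfolding y'_def
      proof (rule torus_mono)
        show "continuous_on UNIV (\<lambda>x. - (?j'' (u \<tau> x) * ((grad (f \<tau>) x - grad g x) \<bullet> flux \<beta> V W (f \<tau>) x)))"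
          by (intro continuous_intros u_continuous torus_C1_D(2)[OF f_C1] torus_C1_D(2)[OF g_C1] flux_f_continuous \<tau>)
            (use ne in auto)
        show "continuous_on UNIV (\<lambda>x. A * ?j (u \<tau> x) + B)" by (intro continuous_intros u_continuous \<tau>)
        fix x
        define X where "X = grad (f \<tau>) x - grad g x"
        define c where "c = ?j'' (u \<tau> x)"
        have c: "0 \<le> c" "c \<le> 1" "c * (u \<tau> x)\<^sup>2 \<le> 2 * ?j (u \<tau> x)"
          using bd(3)[of "u \<tau> x"] bd(5,6)[of "u \<tau> x"] N unfolding c_def by (simp_all only: mult_nonneg_nonneg less_imp_le)
        have "norm (Y \<tau> x) \<le> \<bar>u \<tau> x\<bar> * (a + b) + \<Gamma> * b * 2"
        proof -
          \<comment> \<open>The truncated functional does not control \<open>L \<tau>\<close>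
            quadratically, so the crude bound 2 is taken. It produces the source term
            \<open>B\<close>, which is harmless since only the limit at time 0 is needed.\<close>
          have "\<Gamma> * b * L \<tau> \<le> \<Gamma> * b * 2"
            using \<Gamma>_pos b_nonneg by (intro mult_left_mono L_le_2 \<tau>) simp
          then show ?thesis using norm_Y[OF \<tau>, of x] by linarith
        qed
        then have "(norm (Y \<tau> x))\<^sup>2 \<le> (\<bar>u \<tau> x\<bar> * (a + b) + \<Gamma> * b * 2)\<^sup>2" by (rule power_mono) simp
        also have "\<dots> \<le> 2 * (\<bar>u \<tau> x\<bar> * (a + b))\<^sup>2 + 2 * (\<Gamma> * b * 2)\<^sup>2"
          using zero_le_power2[of "\<bar>u \<tau> x\<bar> * (a + b) - \<Gamma> * b * 2"] by (simp add: power2_diff power2_sum)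
        finally have Y2: "(norm (Y \<tau> x))\<^sup>2 \<le> 2 * ((u \<tau> x)\<^sup>2 * (a + b)\<^sup>2) + 8 * (\<Gamma>\<^sup>2 * b\<^sup>2)"
          by (simp add: power_mult_distrib)
        have "- (c * (X \<bullet> flux \<beta> V W (f \<tau>) x)) = c * - (inverse \<beta> * (norm X)\<^sup>2 + X \<bullet> Y \<tau> x)"
          unfolding flux_difference[OF \<tau>] X_def
          by (simp add: inner_add_right power2_norm_eq_inner right_diff_distrib distrib_left)
        also have "\<dots> \<le> c * (\<beta> * (norm (Y \<tau> x))\<^sup>2 / 4)"
          by (intro mult_left_mono young_flux \<beta> c)
        also have "\<dots> \<le> c * (\<beta> * (2 * ((u \<tau> x)\<^sup>2 * (a + b)\<^sup>2) + 8 * (\<Gamma>\<^sup>2 * b\<^sup>2)) / 4)"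
          using \<beta> c Y2 by (intro mult_left_mono divide_right_mono) auto
        also have "\<dots> = (A / 2) * (c * (u \<tau> x)\<^sup>2) + B * c"
          by (simp add: A_def B_def field_simps)
        also have "\<dots> \<le> (A / 2) * (2 * ?j (u \<tau> x)) + B * 1"
          using c \<beta> by (intro add_mono mult_left_mono) (auto simp: A_def B_def)
        finally show "- (?j'' (u \<tau> x) * ((grad (f \<tau>) x - grad g x) \<bullet> flux \<beta> V W (f \<tau>) x)) \<le> A * ?j (u \<tau> x) + B"
          by (simp add: c_def X_def)
      qed
      also have "\<dots> = A * y \<tau> + B"
        using torus_integrable[OF cy] by (simp add: y_def torus.prob_space)
      finally show ?thesis .
    qed
    have int: "integrable torus (\<lambda>x. ?j (u s x))" if "s \<ge> 0" for s
    proof (cases "s = 0")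
      case True
      have m: "(\<lambda>x. ?j (u 0 x)) \<in> borel_measurable torus"
        using initial_measurable unfolding u_def by measurable
      have "norm (?j (u 0 x)) \<le> norm (N * u 0 x)" for x
        using bd(2)[of "u 0 x"] bd(7)[of "u 0 x"] N real_le_rsqrt[of N "(u 0 x)\<^sup>2 + N\<^sup>2"]
        by (simp add: abs_mult)
      then have "integrable torus (\<lambda>x. ?j (u 0 x))"
        by (intro Bochner_Integration.integrable_bound[of torus "\<lambda>x. N * u 0 x", OF _ m])
          (use u_integrable[of 0] in auto)
      then show ?thesis using True by simp
    next
      case False
      then show ?thesis using that by (intro torus_integrable continuous_intros u_continuous) simp
    qed
    have lim: "(y \<longlongrightarrow> y 0) (at_right 0)"
    proof -
      have lip: "\<bar>?j r - ?j s\<bar> \<le> N * \<bar>r - s\<bar>" for r s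
      proof (rule lipschitz_from_derivative[OF convex_UNIV j(1)])
        show "\<bar>?j' r\<bar> \<le> N" for r
        proof -
          have "0 < r\<^sup>2 + N\<^sup>2" by (intro add_nonneg_pos) (use N in auto)
          then have "sqrt (r\<^sup>2 + N\<^sup>2) > 0" by (simp only: real_sqrt_gt_0_iff)
          then have "\<bar>r\<bar> / sqrt (r\<^sup>2 + N\<^sup>2) \<le> 1" using bd(1)[of r] by simp
          then have "N * (\<bar>r\<bar> / sqrt (r\<^sup>2 + N\<^sup>2)) \<le> N * 1" using N by (intro mult_left_mono) auto
          then show ?thesis using N by (simp add: abs_mult)
        qed
      qed simp_all
      show ?thesis
        using functional_initial[where w="\<lambda>x. 1" and p=g and j="?j" and C=N and S=UNIV] lip int
        by (simp add: y_def[abs_def] u_def[abs_def])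
    qed
    have y0: "y 0 \<le> (\<integral>x. (u 0 x)\<^sup>2 / 2 \<partial>torus)"
      unfolding y_def by (rule integral_mono) (use int[of 0] U0 bd(7) in auto)
    have "y t \<le> exp (A * t) * (y 0 + B * t * exp (\<bar>A\<bar> * t))"
      by (rule gronwall_initial[OF dy le _ _ lim t]) (use \<beta> in \<open>auto simp: B_def\<close>)
    also have "\<dots> \<le> R"
      unfolding R_def using y0 by (intro mult_left_mono) auto
    finally have yR: "y t \<le> R" .
    have "(\<integral>x. (u t x)\<^sup>2 \<partial>torus) \<le> (\<integral>x. (2 + S / N) * ?j (u t x) \<partial>torus)"
    proof (rule torus_mono)
      fix x
      have "(u t x)\<^sup>2 \<le> (2 + \<bar>u t x\<bar> / N) * ?j (u t x)" by (rule bd(8))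
      also have "\<dots> \<le> (2 + S / N) * ?j (u t x)"
        using S(2)[of x] N real_le_rsqrt[of N "(u t x)\<^sup>2 + N\<^sup>2"]
        by (intro mult_right_mono add_mono divide_right_mono mult_nonneg_nonneg) auto
      finally show "(u t x)\<^sup>2 \<le> (2 + S / N) * ?j (u t x)" .
    qed (intro continuous_intros u_continuous t)+
    also have "\<dots> = (2 + S / N) * y t" by (simp add: y_def)
    also have "\<dots> \<le> (2 + S / N) * R" using S N yR by (intro mult_left_mono) auto
    finally show ?thesis .
  qed
  have "(\<integral>x. (u t x)\<^sup>2 \<partial>torus) \<le> (2 + 0) * R"
  proof (rule tendsto_lowerbound)
    have "((\<lambda>N. S / N) \<longlongrightarrow> 0) at_top" by real_asymp
    then show "((\<lambda>N. (2 + S / N) * R) \<longlongrightarrow> (2 + 0) * R) at_top" by (intro tendsto_intros)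
    show "\<forall>\<^sub>F N in at_top. (\<integral>x. (u t x)\<^sup>2 \<partial>torus) \<le> (2 + S / N) * R"
      using eventually_gt_at_top[of "0::real"] by (rule eventually_mono) (rule main)
  qed simp
  then show ?thesis by (simp add: R_def)
qed

text \<open>The exact square functional now satisfies Gronwall with no source term;
  \<open>L2_bound\<close> enters only as the bound near time 0, whose limit is the initial square
  integral.\<close>

lemma L2_decay:
  assumes U0: "integrable torus (\<lambda>x. (u 0 x)\<^sup>2)" and t: "t > 0"
  shows "(\<integral>x. (u t x)\<^sup>2 \<partial>torus) \<le> exp (- 2 * zeta_const \<beta> V W * t) * (\<integral>x. (u 0 x)\<^sup>2 \<partial>torus)"
proof -
  define y where "y t = (\<integral>x. (u t x)\<^sup>2 \<partial>torus)" for t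
  define y' where "y' t = (\<integral>x. - (2 * ((grad (f t) x - grad g x) \<bullet> flux \<beta> V W (f t) x)) \<partial>torus)" for t
  define p where "p = a + b"
  define q where "q = \<Gamma> * b"
  have pq: "0 \<le> p" "0 \<le> q" using a_nonneg b_nonneg \<Gamma>_pos by (simp_all add: p_def q_def)
  have dy: "(y has_real_derivative y' \<tau>) (at \<tau>)" if "\<tau> > 0" for \<tau>
    unfolding y_def y'_def
    by (rule L2_functional_derivative[where j'="\<lambda>r. 2 * r" and j''="\<lambda>r. 2"]) (use that in \<open>auto intro!: derivative_eq_intros\<close>)
  have le: "y' \<tau> \<le> (- 2 * zeta_const \<beta> V W) * y \<tau> + 0" if \<tau>: "\<tau> > 0" for \<tau>
  proof -
    note cu = u_continuous[OF \<tau>]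
    have cX: "continuous_on UNIV (\<lambda>x. grad (f \<tau>) x - grad g x)" by (rule torus_C1_D(2)[OF u_C1[OF \<tau>]])
    define D where "D = (\<integral>x. (norm (grad (f \<tau>) x - grad g x))\<^sup>2 \<partial>torus)"
    have y0: "0 \<le> y \<tau>" by (simp add: y_def)
    have L2: "(L \<tau>)\<^sup>2 \<le> y \<tau>"
    proof -
      have "integrable torus (\<lambda>x. \<bar>u \<tau> x\<bar>)" "integrable torus (\<lambda>x. \<bar>u \<tau> x\<bar>\<^sup>2)"
        by (intro torus_integrable continuous_intros cu)+
      from torus_integral_square[OF this] show ?thesis by (simp add: L_def y_def)
    qed
    have "y' \<tau> \<le> (\<integral>x. (p\<^sup>2 * \<beta> * (u \<tau> x)\<^sup>2 + (2 * p * q * \<beta> * L \<tau>) * \<bar>u \<tau> x\<bar> + \<beta> * q\<^sup>2 * (L \<tau>)\<^sup>2)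
        - inverse \<beta> * (norm (grad (f \<tau>) x - grad g x))\<^sup>2 \<partial>torus)"
      unfolding y'_def
    proof (rule torus_mono)
      show "continuous_on UNIV (\<lambda>x. - (2 * ((grad (f \<tau>) x - grad g x) \<bullet> flux \<beta> V W (f \<tau>) x)))"
        by (intro continuous_intros cX flux_f_continuous \<tau>)
      show "continuous_on UNIV (\<lambda>x. (p\<^sup>2 * \<beta> * (u \<tau> x)\<^sup>2 + (2 * p * q * \<beta> * L \<tau>) * \<bar>u \<tau> x\<bar> + \<beta> * q\<^sup>2 * (L \<tau>)\<^sup>2)
        - inverse \<beta> * (norm (grad (f \<tau>) x - grad g x))\<^sup>2)"
        by (intro continuous_intros cX cu)
      fix x
      define X where "X = grad (f \<tau>) x - grad g x"
      \<comment> \<open>Half of the diffusion absorbs \<open>Y\<close>, the other half is kept for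
        the Poincare inequality.\<close>
      have "- (2 * (X \<bullet> flux \<beta> V W (f \<tau>) x)) = - (inverse \<beta> * (norm X)\<^sup>2 + X \<bullet> (2 *\<^sub>R Y \<tau> x)) - inverse \<beta> * (norm X)\<^sup>2"
        unfolding flux_difference[OF \<tau>] X_def by (simp add: inner_add_right power2_norm_eq_inner)
      also have "\<dots> \<le> \<beta> * (norm (2 *\<^sub>R Y \<tau> x))\<^sup>2 / 4 - inverse \<beta> * (norm X)\<^sup>2"
        by (intro diff_right_mono young_flux \<beta>)
      also have "\<beta> * (norm (2 *\<^sub>R Y \<tau> x))\<^sup>2 / 4 = \<beta> * (norm (Y \<tau> x))\<^sup>2" by (simp add: power_mult_distrib)
      also have "\<beta> * (norm (Y \<tau> x))\<^sup>2 - inverse \<beta> * (norm X)\<^sup>2 \<le> \<beta> * (\<bar>u \<tau> x\<bar> * p + q * L \<tau>)\<^sup>2 - inverse \<beta> * (norm X)\<^sup>2"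
        using \<beta> norm_Y[OF \<tau>, of x] by (intro diff_right_mono mult_left_mono power_mono) (auto simp: p_def q_def)
      also have "\<beta> * (\<bar>u \<tau> x\<bar> * p + q * L \<tau>)\<^sup>2 = p\<^sup>2 * \<beta> * (u \<tau> x)\<^sup>2 + (2 * p * q * \<beta> * L \<tau>) * \<bar>u \<tau> x\<bar> + \<beta> * q\<^sup>2 * (L \<tau>)\<^sup>2"
        by (simp add: power2_sum power_mult_distrib algebra_simps)
      finally show "- (2 * ((grad (f \<tau>) x - grad g x) \<bullet> flux \<beta> V W (f \<tau>) x))
         \<le> (p\<^sup>2 * \<beta> * (u \<tau> x)\<^sup>2 + (2 * p * q * \<beta> * L \<tau>) * \<bar>u \<tau> x\<bar> + \<beta> * q\<^sup>2 * (L \<tau>)\<^sup>2) - inverse \<beta> * (norm (grad (f \<tau>) x - grad g x))\<^sup>2"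
        unfolding X_def .
    qed
    also have "\<dots> = (p\<^sup>2 * \<beta> * y \<tau> + (2 * p * q * \<beta> * L \<tau>) * L \<tau> + \<beta> * q\<^sup>2 * (L \<tau>)\<^sup>2) - inverse \<beta> * D"
    proof -
      have i: "integrable torus (\<lambda>x. (u \<tau> x)\<^sup>2)" "integrable torus (\<lambda>x. \<bar>u \<tau> x\<bar>)"
        "integrable torus (\<lambda>x. (norm (grad (f \<tau>) x - grad g x))\<^sup>2)"
        by (intro torus_integrable continuous_intros cu cX)+
      show ?thesis
        using i by (simp add: y_def L_def[symmetric] D_def torus.prob_space)
    qed
    also have "\<dots> \<le> \<beta> * (p + q)\<^sup>2 * y \<tau> - inverse \<beta> * (4 * pi\<^sup>2 * y \<tau>)"
    proof -
      have "4 * pi\<^sup>2 * y \<tau> \<le> D"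
        unfolding y_def D_def by (rule torus_poincare[OF u_C1[OF \<tau>] u_mean[OF \<tau>]])
      then have 1: "inverse \<beta> * (4 * pi\<^sup>2 * y \<tau>) \<le> inverse \<beta> * D" using \<beta> by (intro mult_left_mono) auto
      have 2: "(2 * p * q * \<beta> + \<beta> * q\<^sup>2) * (L \<tau>)\<^sup>2 \<le> (2 * p * q * \<beta> + \<beta> * q\<^sup>2) * y \<tau>"
        using L2 pq \<beta> by (intro mult_left_mono) auto
      have 3: "p\<^sup>2 * \<beta> * y \<tau> + (2 * p * q * \<beta> * L \<tau>) * L \<tau> + \<beta> * q\<^sup>2 * (L \<tau>)\<^sup>2
         = p\<^sup>2 * \<beta> * y \<tau> + (2 * p * q * \<beta> + \<beta> * q\<^sup>2) * (L \<tau>)\<^sup>2" by (simp add: power2_eq_square algebra_simps)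
      have 4: "\<beta> * (p + q)\<^sup>2 * y \<tau> = p\<^sup>2 * \<beta> * y \<tau> + (2 * p * q * \<beta> + \<beta> * q\<^sup>2) * y \<tau>"
        by (simp add: power2_eq_square algebra_simps)
      show ?thesis unfolding 3 4 using 1 2 by linarith
    qed
    \<comment> \<open>The rate obtained is stronger: \<open>pi\<^sup>2 / (2 * \<beta>)\<close> is
      weaker than \<open>4 * pi\<^sup>2 / \<beta>\<close>, and the drift term enters
      \<open>2 * zeta_const\<close> with a factor 2.\<close>
    also have "\<dots> \<le> (- 2 * zeta_const \<beta> V W) * y \<tau>"
    proof -
      have z: "zeta_const \<beta> V W = inverse \<beta> * (pi\<^sup>2 / 4) - \<beta> * (p + q)\<^sup>2"
        unfolding zeta_const_def p_def q_def using \<beta> by (simp add: field_simps)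
      have "0 \<le> inverse \<beta> * pi\<^sup>2" "0 \<le> \<beta> * (p + q)\<^sup>2" using \<beta> by simp_all
      then have "\<beta> * (p + q)\<^sup>2 - inverse \<beta> * (4 * pi\<^sup>2) \<le> - 2 * zeta_const \<beta> V W" unfolding z by simp
      from mult_right_mono[OF this y0] show ?thesis by (simp add: algebra_simps)
    qed
    finally show ?thesis by simp
  qed
  define A where "A = \<beta> * (a + b)\<^sup>2"
  define B where "B = 2 * \<beta> * \<Gamma>\<^sup>2 * b\<^sup>2"
  have "y t \<le> exp ((- 2 * zeta_const \<beta> V W) * t) * (y 0 + 0 * t * exp (\<bar>- 2 * zeta_const \<beta> V W\<bar> * t))"
  proof (rule gronwall_initial[OF dy le order_refl _ _ t])
    show "y s \<le> 2 * (exp (A * s) * (y 0 / 2 + B * s * exp (\<bar>A\<bar> * s)))" if "0 < s" for s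
      unfolding y_def A_def B_def by (rule L2_bound[OF U0 that])
    show "((\<lambda>s. 2 * (exp (A * s) * (y 0 / 2 + B * s * exp (\<bar>A\<bar> * s)))) \<longlongrightarrow> y 0) (at_right 0)"
      by (auto intro!: tendsto_eq_intros)
  qed
  then show ?thesis by (simp add: y_def)
qed

theorem L1_decay_from_L2:
  assumes "in_L2 (\<lambda>x. f 0 x - g x)" and t: "t \<ge> 0"
  shows "L1_norm (\<lambda>x. f t x - g x) \<le> L2_norm (\<lambda>x. f 0 x - g x) * exp (- zeta_const \<beta> V W * t)"
proof -
  have U0: "integrable torus (\<lambda>x. (u 0 x)\<^sup>2)" using assms by (simp add: in_L2_def u_def)
  have Lt: "L1_norm (\<lambda>x. f t x - g x) = L t" by (simp add: L1_norm_def L_def u_def)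
  have U: "L2_norm (\<lambda>x. f 0 x - g x) = sqrt (\<integral>x. (u 0 x)\<^sup>2 \<partial>torus)" by (simp add: L2_norm_def u_def)
  have "integrable torus (\<lambda>x. (u t x)\<^sup>2)"
    using U0 t torus_integrable[OF continuous_on_power[OF u_continuous[of t]], of 2] by (cases "t = 0") auto
  then have "(L t)\<^sup>2 \<le> (\<integral>x. (u t x)\<^sup>2 \<partial>torus)"
    using torus_integral_square[of "\<lambda>x. \<bar>u t x\<bar>"] u_integrable[OF t] by (simp add: L_def)
  also have "\<dots> \<le> exp (- 2 * zeta_const \<beta> V W * t) * (\<integral>x. (u 0 x)\<^sup>2 \<partial>torus)"
    using L2_decay[OF U0, of t] t by (cases "t = 0") auto
  also have "\<dots> = (sqrt (\<integral>x. (u 0 x)\<^sup>2 \<partial>torus) * exp (- zeta_const \<beta> V W * t))\<^sup>2"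
    by (simp add: power_mult_distrib power2_eq_square[of "exp _"] flip: exp_add)
  finally show ?thesis unfolding Lt U by (rule power2_le_imp_le) simp
qed

end

section \<open>Decay from data of finite entropy\<close>

text \<open>The inequality \<open>ln y \<le> y - 1\<close> at \<open>y = sqrt c / sqrt x\<close>,
  multiplied by \<open>2 * x\<close>. The right side is the Bregman divergence of
  \<open>x * ln x\<close>; besides the Hellinger bound the lemma supplies its nonnegativity.\<close>

lemma hellinger_le_entropy:
  fixes x c :: real
  assumes x: "0 < x" and c: "0 < c"
  shows "(sqrt x - sqrt c)\<^sup>2 \<le> x * ln x - x * ln c - x + c"
proof -
  have "ln (sqrt c / sqrt x) \<le> sqrt c / sqrt x - 1" using x c by (intro ln_le_minus_one) simp
  then have "ln c / 2 - ln x / 2 \<le> sqrt c / sqrt x - 1" using x c by (simp add: ln_div ln_sqrt)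
  then have "(2 * x) * (ln c / 2 - ln x / 2) \<le> (2 * x) * (sqrt c / sqrt x - 1)" using x by (intro mult_left_mono) auto
  also have "\<dots> = 2 * (sqrt x * sqrt c) - 2 * x"
  proof -
    have "x * (sqrt c / sqrt x) = x / sqrt x * sqrt c" by simp
    also have "x / sqrt x = sqrt x" using x by (intro real_div_sqrt) simp
    finally have "x * (sqrt c / sqrt x) = sqrt x * sqrt c" .
    then show ?thesis by (simp add: right_diff_distrib)
  qed
  finally have "x * ln c - x * ln x \<le> 2 * (sqrt x * sqrt c) - 2 * x" by (simp add: algebra_simps)
  moreover have "(sqrt x - sqrt c)\<^sup>2 = x + c - 2 * (sqrt x * sqrt c)"
    using x c by (simp add: power2_diff)
  ultimately show ?thesis by linarith
qed

text \<open>The function bounded here vanishes to second order at 0 and has derivative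
  \<open>ln ((r + N) / N)\<close>, which cancels the logarithmic growth of the derivative of the
  entropy function at infinity.\<close>

lemma entropy_cutoff_bounds:
  fixes r N :: real
  assumes r: "0 \<le> r" and N: "0 < N"
  shows "0 \<le> (r + N) * ln ((r + N) / N) - r" "(r + N) * ln ((r + N) / N) - r \<le> r\<^sup>2 / N"
proof -
  have p: "r + N > 0" using assms by simp
  have "ln (N / (r + N)) \<le> N / (r + N) - 1" using p N by (intro ln_le_minus_one) simp
  then have "1 - N / (r + N) \<le> ln ((r + N) / N)" using p N by (simp add: ln_div)
  then have "(r + N) * (1 - N / (r + N)) \<le> (r + N) * ln ((r + N) / N)" using p by (intro mult_left_mono) auto
  then show "0 \<le> (r + N) * ln ((r + N) / N) - r" using p by (simp add: right_diff_distrib)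
  have "ln ((r + N) / N) \<le> (r + N) / N - 1" using p N by (intro ln_le_minus_one) simp
  then have "(r + N) * ln ((r + N) / N) \<le> (r + N) * ((r + N) / N - 1)" using p by (intro mult_left_mono) auto
  then show "(r + N) * ln ((r + N) / N) - r \<le> r\<^sup>2 / N" using N by (simp add: field_simps power2_eq_square)
qed

lemma shifted_entropy_le:
  fixes r \<delta> :: real
  assumes r: "0 \<le> r" and \<delta>: "0 < \<delta>"
  shows "(r + \<delta>) * ln (r + \<delta>) \<le> r * ln r + \<delta> * (r + \<delta>)"
proof (cases "r = 0")
  case True
  have "\<delta> * ln \<delta> \<le> \<delta> * \<delta>" using \<delta> ln_le_minus_one[OF \<delta>] by (intro mult_left_mono) auto
  then show ?thesis using True by simp
next
  case False
  then have r: "r > 0" using r by simp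
  have "ln ((r + \<delta>) / r) \<le> (r + \<delta>) / r - 1" using r \<delta> by (intro ln_le_minus_one) simp
  then have "r * (ln (r + \<delta>) - ln r) \<le> r * ((r + \<delta>) / r - 1)" using r \<delta> by (intro mult_left_mono) (auto simp: ln_div)
  also have "\<dots> = \<delta>" using r by (simp add: field_simps)
  finally have 1: "r * ln (r + \<delta>) \<le> r * ln r + \<delta>" by (simp add: algebra_simps)
  have "\<delta> * ln (r + \<delta>) \<le> \<delta> * (r + \<delta> - 1)" using r \<delta> by (intro mult_left_mono ln_le_minus_one) auto
  with 1 show ?thesis by (simp add: algebra_simps)
qed

context mckean_vlasov
begin

text \<open>Holley--Stroock perturbation of the logarithmic Sobolev inequality by the density \<open>g\<close>.\<close>

lemma weighted_log_sobolev:
  assumes \<psi>: "torus_C1 \<psi> \<Psi>" and pos: "\<And>x. 0 < \<psi> x"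
  defines "m1 \<equiv> (\<integral>x. g x * \<psi> x \<partial>torus)"
  shows "(\<integral>x. g x * (\<psi> x * ln (\<psi> x)) \<partial>torus) - m1 * ln m1 \<le> \<Gamma> / (8 * pi\<^sup>2) * (\<integral>x. g x * ((norm (\<Psi> x))\<^sup>2 / \<psi> x) \<partial>torus)"
proof -
  obtain m where m: "m > 0" "\<And>x. m \<le> g x" "\<And>x. g x \<le> \<Gamma> * m" using g_bounds by blast
  note c\<psi> = torus_C1_continuous[OF \<psi>] and c\<Psi> = torus_C1_D(2)[OF \<psi>]
  have ne: "\<psi> x \<noteq> 0" for x using pos[of x] by simp
  obtain l where l: "l > 0" "\<And>x. l \<le> \<psi> x" using periodic_positive_lower_bound[OF c\<psi> torus_C1_D(1)[OF \<psi>] pos] by blast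
  define c where "c = (\<integral>x. \<psi> x \<partial>torus)"
  have c: "c > 0"
  proof -
    have "(\<integral>x. l \<partial>(torus :: (real^'d) measure)) \<le> c" unfolding c_def
      by (rule torus_mono) (intro continuous_intros c\<psi> l(2))+
    then show ?thesis using l(1) by (simp add: torus.prob_space)
  qed
  have m1: "m1 > 0"
  proof -
    have "(\<integral>x. g x * l \<partial>torus) \<le> m1" unfolding m1_def
      by (rule torus_mono) (intro continuous_intros c\<psi> g_continuous mult_left_mono l(2) g_nonneg)+
    then show ?thesis using l(1) by (simp add: g_mass)
  qed
  \<comment> \<open>The Bregman divergence from the uniform mean \<open>c\<close>. It is nonnegative
    pointwise, which permits replacing \<open>g\<close> by the bounds \<open>\<Gamma> * m\<close>
    and \<open>m\<close>; the entropy itself is an integral without a sign.\<close>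
  let ?B = "\<lambda>x. \<psi> x * ln (\<psi> x) - \<psi> x * ln c - \<psi> x + c"
  have cB: "continuous_on UNIV ?B" by (intro continuous_intros c\<psi>) (use ne in auto)
  have B0: "0 \<le> ?B x" for x
    using hellinger_le_entropy[OF pos[of x] c] zero_le_power2[of "sqrt (\<psi> x) - sqrt c"] by linarith
  have i1: "integrable torus (\<lambda>x. g x * (\<psi> x * ln (\<psi> x)))" "integrable torus (\<lambda>x. g x * \<psi> x)" "integrable torus g"
    "integrable torus (\<lambda>x. \<psi> x * ln (\<psi> x))" "integrable torus \<psi>"
    by (intro torus_integrable continuous_intros c\<psi> g_continuous; use ne in auto)+
  \<comment> \<open>As a function of \<open>c\<close> the right side is least at
    \<open>c = m1\<close>, where it equals the left side.\<close>
  have "(\<integral>x. g x * (\<psi> x * ln (\<psi> x)) \<partial>torus) - m1 * ln m1 \<le> (\<integral>x. g x * (\<psi> x * ln (\<psi> x)) \<partial>torus) - m1 * ln c - m1 + c"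
    using hellinger_le_entropy[OF m1 c] zero_le_power2[of "sqrt m1 - sqrt c"] by linarith
  also have "\<dots> = (\<integral>x. g x * (\<psi> x * ln (\<psi> x)) - ln c * (g x * \<psi> x) - g x * \<psi> x + c * g x \<partial>torus)"
    using i1 by (simp add: m1_def g_mass mult.commute)
  also have "\<dots> = (\<integral>x. g x * ?B x \<partial>torus)"
    by (intro Bochner_Integration.integral_cong refl) (simp add: algebra_simps)
  also have "\<dots> \<le> (\<integral>x. (\<Gamma> * m) * ?B x \<partial>torus)"
    by (rule torus_mono) (intro continuous_on_mult continuous_on_const g_continuous cB mult_right_mono m(3) B0)+
  also have "\<dots> = (\<Gamma> * m) * (\<integral>x. ?B x \<partial>torus)" by simp
  also have "(\<integral>x. ?B x \<partial>torus) = (\<integral>x. \<psi> x * ln (\<psi> x) \<partial>torus) - c * ln c"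
    using i1 by (simp add: c_def torus.prob_space)
  also have "(\<Gamma> * m) * \<dots> \<le> (\<Gamma> * m) * ((\<integral>x. (norm (\<Psi> x))\<^sup>2 / \<psi> x \<partial>torus) / (8 * pi\<^sup>2))"
    unfolding c_def using \<Gamma>_pos m(1) by (intro mult_left_mono torus_log_sobolev[OF \<psi> pos]) auto
  also have "\<dots> = \<Gamma> / (8 * pi\<^sup>2) * (\<integral>x. m * ((norm (\<Psi> x))\<^sup>2 / \<psi> x) \<partial>torus)"
    unfolding integral_mult_right_zero by simp
  also have "\<dots> \<le> \<Gamma> / (8 * pi\<^sup>2) * (\<integral>x. g x * ((norm (\<Psi> x))\<^sup>2 / \<psi> x) \<partial>torus)"
  proof (intro mult_left_mono torus_mono)
    show "m * ((norm (\<Psi> x))\<^sup>2 / \<psi> x) \<le> g x * ((norm (\<Psi> x))\<^sup>2 / \<psi> x)" for x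
      using m(2)[of x] pos[of x] by (intro mult_right_mono) auto
    show "0 \<le> \<Gamma> / (8 * pi\<^sup>2)" using \<Gamma>_pos by simp
  qed (intro continuous_intros c\<Psi> c\<psi> g_continuous; use ne in auto)+
  finally show ?thesis .
qed

text \<open>The interaction constant: \<open>eta_const\<close> is 8 times the difference of
  \<open>pi\<^sup>2 / (\<beta> * \<Gamma>)\<close> and \<open>K\<close>.\<close>

definition "K = Linf_norm (laplacian W) + \<beta> * (a + b) * b"

lemma laplacian_W_continuous: "continuous_on UNIV (laplacian W)" and laplacian_W_periodic: "periodic (laplacian W)"
proof -
  have e: "laplacian W = (\<lambda>x. \<Sum>i\<in>UNIV. grad (partial i W) x $ i)" using torus_C1_C2(3)[OF W] by (intro ext)
  show "continuous_on UNIV (laplacian W)" unfolding e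
    by (intro continuous_intros torus_C1_D(2)[OF torus_C1_C2(2)[OF W]])
  show "periodic (laplacian W)" unfolding e
    using torus_C1_periodic[OF torus_C1_C2(2)[OF W]] by (simp add: periodic_def)
qed

lemma norm_laplacian_W: "\<bar>laplacian W x\<bar> \<le> Linf_norm (laplacian W)"
  using norm_le_Linf_norm[OF laplacian_W_continuous laplacian_W_periodic, of x] by simp

lemma K_nonneg: "0 \<le> K"
  using Linf_norm_nonneg[OF laplacian_W_continuous laplacian_W_periodic] \<beta> a_nonneg b_nonneg by (simp add: K_def)

text \<open>By the equation for \<open>g\<close>, \<open>g x *\<^sub>R \<Phi> t x\<close> is the
  gradient of \<open>u t\<close> plus \<beta> times \<open>u t\<close> times the equilibrium drift.
  In the first part an integration by parts moves the derivative onto the convolution, which brings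
  in the Laplacian of \<open>W\<close>. Both parts are quadratic in \<open>u t\<close> because
  \<open>v t\<close> is linear in it.\<close>

lemma interaction_bound:
  assumes t: "t > 0"
  shows "- (\<integral>x. g x * (\<Phi> t x \<bullet> v t x) \<partial>torus) \<le> K * (L t)\<^sup>2"
proof -
  note cu = u_continuous[OF t] and cv = v_continuous[OF t]
  let ?X = "\<lambda>x. grad (f t) x - grad g x"
  have cX: "continuous_on UNIV ?X" by (rule torus_C1_D(2)[OF u_C1[OF t]])
  let ?G = "\<lambda>i x. grad (partial i W) x $ i"
  have cG: "continuous_on UNIV (grad (partial i W))" "continuous_on UNIV (?G i)" for i
    by (intro continuous_intros torus_C1_D(2)[OF torus_C1_C2(2)[OF W]])+
  have vi: "v t x $ i = conv (\<lambda>x. grad W x $ i) (u t) x" for x i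
    unfolding v_def by (rule conv_component[OF grad_W_continuous cu])
  have conv_i: "torus_C1 (conv (\<lambda>x. grad W x $ i) (u t)) (conv (grad (partial i W)) (u t))" for i
    by (rule torus_C1_conv[OF torus_C1_C2(2)[OF W] cu])
  have "- (\<integral>x. ?X x \<bullet> v t x \<partial>torus) = - (\<integral>x. (\<Sum>i\<in>UNIV. ?X x $ i * v t x $ i) \<partial>torus)"
    by (simp add: inner_vec_def)
  also have "\<dots> = (\<Sum>i\<in>UNIV. - (\<integral>x. ?X x $ i * conv (\<lambda>x. grad W x $ i) (u t) x \<partial>torus))"
    unfolding vi sum_negf
    by (subst Bochner_Integration.integral_sum)
      (intro refl torus_integrable continuous_on_mult continuous_on_component cX torus_C1_continuous[OF conv_i])+
  also have "\<dots> = (\<Sum>i\<in>UNIV. \<integral>x. u t x * conv (?G i) (u t) x \<partial>torus)"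
    using torus_by_parts[OF u_C1[OF t] conv_i] conv_component[OF cG(1) cu] by (intro sum.cong refl) simp
  also have "\<dots> = (\<integral>x. (\<Sum>i\<in>UNIV. u t x * conv (?G i) (u t) x) \<partial>torus)"
    by (rule Bochner_Integration.integral_sum[symmetric])
      (intro torus_integrable continuous_on_mult cu conv_continuous cG)
  also have "\<dots> = (\<integral>x. u t x * conv (laplacian W) (u t) x \<partial>torus)"
  proof (intro Bochner_Integration.integral_cong refl)
    fix x
    have "conv (laplacian W) (u t) x = (\<Sum>i\<in>UNIV. conv (?G i) (u t) x)"
      unfolding conv_def torus_C1_C2(3)[OF W] scaleR_sum_right
      by (rule Bochner_Integration.integral_sum) (intro torus_integrable conv_integrand_continuous cG cu)
    then show "(\<Sum>i\<in>UNIV. u t x * conv (?G i) (u t) x) = u t x * conv (laplacian W) (u t) x"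
      by (simp add: sum_distrib_left)
  qed
  also have "\<dots> \<le> (\<integral>x. (Linf_norm (laplacian W) * L t) * \<bar>u t x\<bar> \<partial>torus)"
  proof (rule torus_mono)
    fix x
    have "\<bar>conv (laplacian W) (u t) x\<bar> \<le> Linf_norm (laplacian W) * L t"
      using norm_conv_le[OF laplacian_W_continuous cu, of "Linf_norm (laplacian W)" x] norm_laplacian_W by (simp add: L_def)
    then have "\<bar>u t x\<bar> * \<bar>conv (laplacian W) (u t) x\<bar> \<le> \<bar>u t x\<bar> * (Linf_norm (laplacian W) * L t)"
      by (intro mult_left_mono) auto
    then show "u t x * conv (laplacian W) (u t) x \<le> (Linf_norm (laplacian W) * L t) * \<bar>u t x\<bar>"
      using abs_ge_self[of "u t x * conv (laplacian W) (u t) x"] by (simp add: abs_mult mult.commute)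
  qed (intro continuous_intros cu conv_continuous laplacian_W_continuous)+
  also have "\<dots> = Linf_norm (laplacian W) * (L t)\<^sup>2" by (simp add: L_def[symmetric] power2_eq_square)
  finally have 1: "- (\<integral>x. ?X x \<bullet> v t x \<partial>torus) \<le> Linf_norm (laplacian W) * (L t)\<^sup>2" .
  have "(\<integral>x. - (\<beta> * u t x * (drift x \<bullet> v t x)) \<partial>torus) \<le> (\<integral>x. (\<beta> * (a + b) * b * L t) * \<bar>u t x\<bar> \<partial>torus)"
  proof (rule torus_mono)
    fix x
    have "\<bar>drift x \<bullet> v t x\<bar> \<le> norm (drift x) * norm (v t x)" by (rule Cauchy_Schwarz_ineq2)
    also have "\<dots> \<le> (a + b) * (b * L t)"
      using norm_drift[of x] norm_v[OF t, of x] a_nonneg b_nonneg by (intro mult_mono) auto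
    finally have "(\<beta> * \<bar>u t x\<bar>) * \<bar>drift x \<bullet> v t x\<bar> \<le> (\<beta> * \<bar>u t x\<bar>) * ((a + b) * (b * L t))"
      using \<beta> by (intro mult_left_mono) auto
    moreover have "- (\<beta> * u t x * (drift x \<bullet> v t x)) \<le> (\<beta> * \<bar>u t x\<bar>) * \<bar>drift x \<bullet> v t x\<bar>"
      using abs_ge_minus_self[of "\<beta> * u t x * (drift x \<bullet> v t x)"] \<beta> by (simp add: abs_mult)
    ultimately show "- (\<beta> * u t x * (drift x \<bullet> v t x)) \<le> (\<beta> * (a + b) * b * L t) * \<bar>u t x\<bar>"
      by (simp add: mult_ac)
  qed (intro continuous_intros cu cv drift_continuous)+
  also have "\<dots> = \<beta> * (a + b) * b * (L t)\<^sup>2" by (simp add: L_def[symmetric] power2_eq_square)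
  finally have 2: "(\<integral>x. - (\<beta> * u t x * (drift x \<bullet> v t x)) \<partial>torus) \<le> \<beta> * (a + b) * b * (L t)\<^sup>2" .
  have "g x * (\<Phi> t x \<bullet> v t x) = ?X x \<bullet> v t x + \<beta> * u t x * (drift x \<bullet> v t x)" for x
  proof -
    have "g x * (\<Phi> t x \<bullet> v t x) = (g x *\<^sub>R \<Phi> t x) \<bullet> v t x" by simp
    also have "g x *\<^sub>R \<Phi> t x = ?X x + (\<beta> * u t x) *\<^sub>R drift x"
      unfolding g_\<Phi> grad_g u_def by (simp add: algebra_simps)
    finally show ?thesis by (simp add: inner_add_left)
  qed
  then have "- (\<integral>x. g x * (\<Phi> t x \<bullet> v t x) \<partial>torus) = - (\<integral>x. ?X x \<bullet> v t x + \<beta> * u t x * (drift x \<bullet> v t x) \<partial>torus)" by simp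
  also have "\<dots> = - (\<integral>x. ?X x \<bullet> v t x \<partial>torus) + (\<integral>x. - (\<beta> * u t x * (drift x \<bullet> v t x)) \<partial>torus)"
  proof -
    have "integrable torus (\<lambda>x. ?X x \<bullet> v t x)" "integrable torus (\<lambda>x. \<beta> * u t x * (drift x \<bullet> v t x))"
      by (intro torus_integrable continuous_intros cX cv cu drift_continuous)+
    then show ?thesis by simp
  qed
  also have "\<dots> \<le> K * (L t)\<^sup>2" using 1 2 by (simp add: K_def distrib_right)
  finally show ?thesis .
qed

text \<open>Relative entropy with respect to \<open>g\<close> of the ratio shifted by \<open>\<delta>\<close>, since \<open>f t\<close> is not
  known to be bounded away from 0.\<close>

definition "Ent \<delta> t = (\<integral>x. g x * ((f t x / g x + \<delta>) * ln (f t x / g x + \<delta>)) \<partial>torus) - (1 + \<delta>) * ln (1 + \<delta>)"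

lemma shifted_ratio:
  assumes t: "t > 0" and \<delta>: "\<delta> > 0"
  shows "torus_C1 (\<lambda>x. f t x / g x + \<delta>) (\<Phi> t)" "0 < f t x / g x + \<delta>"
    "(\<integral>x. g x * (f t x / g x + \<delta>) \<partial>torus) = 1 + \<delta>"
proof -
  show "torus_C1 (\<lambda>x. f t x / g x + \<delta>) (\<Phi> t)"
    using torus_C1_add[OF ratio_C1[OF t] torus_C1_const[of \<delta>]] by simp
  show "0 < f t x / g x + \<delta>"
    using f_nonneg[of t x] g_pos[of x] t \<delta> by (intro add_nonneg_pos divide_nonneg_pos) auto
  have "(\<lambda>x. g x * (f t x / g x + \<delta>)) = (\<lambda>x. f t x + \<delta> * g x)"
    using g_pos by (simp add: fun_eq_iff distrib_left less_imp_neq[OF g_pos, symmetric] mult.commute)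
  then show "(\<integral>x. g x * (f t x / g x + \<delta>) \<partial>torus) = 1 + \<delta>"
    using f_integrable[of t] t torus_integrable[OF g_continuous] f_mass[OF t] g_mass by simp
qed

text \<open>The deviation factors as the difference times the sum of the roots of the shifted ratio
  and its mean. The difference is controlled by the entropy, the sum by the mass; a weighted Young
  inequality under the integral plays the role of Cauchy-Schwarz.\<close>

lemma L_le_entropy:
  assumes t: "t > 0" and \<delta>: "\<delta> > 0"
  shows "0 \<le> Ent \<delta> t" "(L t)\<^sup>2 \<le> 4 * (1 + \<delta>) * Ent \<delta> t"
proof -
  define c where "c = 1 + \<delta>"
  have c: "c > 0" using \<delta> by (simp add: c_def)
  let ?\<psi> = "\<lambda>x. f t x / g x + \<delta>"
  let ?B = "\<lambda>x. ?\<psi> x * ln (?\<psi> x) - ?\<psi> x * ln c - ?\<psi> x + c"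
  note c\<psi> = torus_C1_continuous[OF shifted_ratio(1)[OF t \<delta>]] and pos = shifted_ratio(2)[OF t \<delta>]
  have ne: "?\<psi> x \<noteq> 0" for x using pos[of x] by (metis less_irrefl)
  have i: "integrable torus (\<lambda>x. g x * (?\<psi> x * ln (?\<psi> x)))" "integrable torus (\<lambda>x. g x * ?\<psi> x)" "integrable torus g"
    by (intro torus_integrable continuous_on_mult continuous_on_ln c\<psi> g_continuous; use ne in auto)+
  have E: "(\<integral>x. g x * ?B x \<partial>torus) = Ent \<delta> t"
  proof -
    have "(\<integral>x. g x * ?B x \<partial>torus)
      = (\<integral>x. g x * (?\<psi> x * ln (?\<psi> x)) - ln c * (g x * ?\<psi> x) - g x * ?\<psi> x + c * g x \<partial>torus)"
      by (intro Bochner_Integration.integral_cong refl) (simp add: algebra_simps)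
    also have "\<dots> = (\<integral>x. g x * (?\<psi> x * ln (?\<psi> x)) \<partial>torus) - ln c * c - c + c * 1"
      using i by (simp add: g_mass shifted_ratio(3)[OF t \<delta>] c_def)
    finally show ?thesis by (simp add: Ent_def c_def mult.commute)
  qed
  have B: "(sqrt (?\<psi> x) - sqrt c)\<^sup>2 \<le> ?B x" for x
    by (rule hellinger_le_entropy[OF pos c])
  have cB: "continuous_on UNIV ?B"
    by (intro continuous_on_add continuous_on_diff continuous_on_mult continuous_on_const continuous_on_ln c\<psi>) (use ne in auto)
  have B0: "0 \<le> ?B x" for x
    using B[of x] zero_le_power2[of "sqrt (?\<psi> x) - sqrt c"] by linarith
  show E0: "0 \<le> Ent \<delta> t"
    unfolding E[symmetric] using B0 g_nonneg by (intro Bochner_Integration.integral_nonneg mult_nonneg_nonneg)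
  show "(L t)\<^sup>2 \<le> 4 * (1 + \<delta>) * Ent \<delta> t"
  proof (cases "L t = 0")
    case True then show ?thesis using E0 \<delta> by simp
  next
    case False
    then have L: "L t > 0" using L_nonneg[of t] by simp
    \<comment> \<open>Makes the mass term \<open>2 * c / \<theta>\<close> equal to
      \<open>L t / 2\<close>, which is absorbed on the left.\<close>
    define \<theta> where "\<theta> = 4 * c / L t"
    have \<theta>: "\<theta> > 0" using c L by (simp add: \<theta>_def)
    have "L t \<le> (\<integral>x. \<theta> / 2 * (g x * ?B x) + 1 / \<theta> * (g x * ?\<psi> x + c * g x) \<partial>torus)"
      unfolding L_def
    proof (rule torus_mono)
      show "continuous_on UNIV (\<lambda>x. \<bar>u t x\<bar>)" by (intro continuous_intros u_continuous t)
      show "continuous_on UNIV (\<lambda>x. \<theta> / 2 * (g x * ?B x) + 1 / \<theta> * (g x * ?\<psi> x + c * g x))"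
        by (intro continuous_on_add[of UNIV] continuous_on_mult continuous_on_const g_continuous cB c\<psi>)
      fix x
      define p where "p = \<bar>sqrt (?\<psi> x) - sqrt c\<bar>"
      define q where "q = sqrt (?\<psi> x) + sqrt c"
      have "u t x = g x * (?\<psi> x - c)" using g_pos[of x] by (simp add: u_def c_def right_diff_distrib distrib_left)
      then have "\<bar>u t x\<bar> = g x * \<bar>?\<psi> x - c\<bar>" using g_pos[of x] by (simp add: abs_mult)
      also have "\<bar>?\<psi> x - c\<bar> = p * q"
      proof -
        have "?\<psi> x - c = (sqrt (?\<psi> x) - sqrt c) * (sqrt (?\<psi> x) + sqrt c)"
          using pos[of x] c by (simp add: algebra_simps)
        moreover have "0 \<le> sqrt (?\<psi> x) + sqrt c" using pos[of x] c by simp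
        ultimately show ?thesis by (simp add: p_def q_def abs_mult)
      qed
      also have "p * q \<le> \<theta> / 2 * p\<^sup>2 + 1 / (2 * \<theta>) * q\<^sup>2"
      proof -
        have "0 \<le> (\<theta> * p - q)\<^sup>2 / (2 * \<theta>)" using \<theta> by simp
        also have "\<dots> = \<theta> / 2 * p\<^sup>2 + 1 / (2 * \<theta>) * q\<^sup>2 - p * q" using \<theta> by (simp add: field_simps power2_eq_square)
        finally show ?thesis by simp
      qed
      also have "\<dots> \<le> \<theta> / 2 * ?B x + 1 / (2 * \<theta>) * (2 * (?\<psi> x + c))"
      proof (intro add_mono mult_left_mono)
        show "p\<^sup>2 \<le> ?B x" using B[of x] by (simp add: p_def)
        have "0 \<le> (sqrt (?\<psi> x) - sqrt c)\<^sup>2" by simp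
        then show "q\<^sup>2 \<le> 2 * (?\<psi> x + c)"
          using pos[of x] c by (simp add: q_def power2_diff power2_sum)
      qed (use \<theta> in auto)
      finally have "\<bar>u t x\<bar> \<le> g x * (\<theta> / 2 * ?B x + 1 / (2 * \<theta>) * (2 * (?\<psi> x + c)))"
        using g_nonneg[of x] by (simp add: mult_left_mono)
      also have "\<dots> = \<theta> / 2 * (g x * ?B x) + 1 / \<theta> * (g x * ?\<psi> x + c * g x)"
      proof -
        have "1 / (2 * \<theta>) * (2 * z) = 1 / \<theta> * z" for z using \<theta> by simp
        then show ?thesis by (simp only: distrib_left mult.left_commute mult.commute[of c])
      qed
      finally show "\<bar>u t x\<bar> \<le> \<theta> / 2 * (g x * ?B x) + 1 / \<theta> * (g x * ?\<psi> x + c * g x)" .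
    qed
    also have "\<dots> = \<theta> / 2 * Ent \<delta> t + 1 / \<theta> * (c + c)"
    proof -
      have iB: "integrable torus (\<lambda>x. g x * ?B x)"
        by (intro torus_integrable continuous_on_mult g_continuous cB)
      have "(\<integral>x. g x * ?\<psi> x + c * g x \<partial>torus) = c + c"
        using i by (simp add: g_mass shifted_ratio(3)[OF t \<delta>] c_def)
      moreover have "integrable torus (\<lambda>x. g x * ?\<psi> x + c * g x)" using i by simp
      ultimately show ?thesis using iB E by (subst Bochner_Integration.integral_add) simp_all
    qed
    also have "\<dots> = 2 * c * Ent \<delta> t / L t + L t / 2" using L c by (simp add: \<theta>_def field_simps)
    finally have "L t / 2 \<le> 2 * c * Ent \<delta> t / L t" by simp
    then have "L t / 2 * L t \<le> 2 * c * Ent \<delta> t" using L by (simp add: pos_le_divide_eq)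
    then show ?thesis by (simp add: c_def power2_eq_square algebra_simps)
  qed
qed

end

context mckean_vlasov
begin

lemma ratio_nonneg: "t \<ge> 0 \<Longrightarrow> 0 \<le> f t x / g x"
  using f_nonneg[of t x] g_pos[of x] by simp

text \<open>Subtracting \<open>(r + N) ln ((r + N) / N) - r\<close>, which tends to 0 as \<open>N\<close> grows, from the
  shifted entropy function makes it Lipschitz, so that its integral is continuous at time 0.\<close>

lemma entropy_bound:
  assumes fin: "finite_entropy (f 0) g" and \<delta>: "0 < \<delta>" "\<delta> \<le> 1" and t: "t > 0"
  shows "(\<integral>x. g x * ((f t x / g x + \<delta>) * ln (f t x / g x + \<delta>)) \<partial>torus)
    \<le> rel_entropy (f 0) g + \<delta> * (1 + \<delta>) + \<beta> * b\<^sup>2 * t"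
proof -
  define R where "R = rel_entropy (f 0) g + \<delta> * (1 + \<delta>) + \<beta> * b\<^sup>2 * t"
  let ?h = "\<lambda>r. (r + \<delta>) * ln (r + \<delta>)"
  note c\<phi> = torus_C1_continuous[OF ratio_C1, unfolded diff_zero]
  obtain S where S: "S > 0" "\<And>x. norm ((f t x - 0) / g x) \<le> S"
    using periodic_bounded[OF torus_C1_continuous[OF ratio_C1[OF t]] torus_C1_D(1)[OF ratio_C1[OF t]]] by blast
  have ch: "continuous_on UNIV (\<lambda>x. ?h (f \<tau> x / g x))" if "\<tau> > 0" for \<tau>
    using ratio_nonneg[of \<tau>] that \<delta> by (intro continuous_intros c\<phi>) (auto simp: add_nonneg_eq_0_iff)
  have main: "(\<integral>x. g x * ?h (f t x / g x) \<partial>torus) \<le> R + S\<^sup>2 / N" if N: "N \<ge> 1" for N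
  proof -
    let ?q = "\<lambda>r. (r + N) * ln ((r + N) / N) - r"
    let ?j = "\<lambda>r. ?h r - ?q r" and ?j' = "\<lambda>r. ln (r + \<delta>) + 1 - ln ((r + N) / N)"
      and ?j'' = "\<lambda>r. 1 / (r + \<delta>) - 1 / (r + N)"
    have j: "(?j has_real_derivative ?j' r) (at r)" "(?j' has_real_derivative ?j'' r) (at r)" if "r \<in> {0..}" for r
    proof -
      have p: "r + \<delta> > 0" "r + N > 0" using that \<delta> N by auto
      have l: "((\<lambda>r. ln (r + \<delta>)) has_real_derivative 1 / (r + \<delta>)) (at r)"
        "((\<lambda>r. ln ((r + N) / N)) has_real_derivative 1 / (r + N)) (at r)"
        using p N by (auto intro!: derivative_eq_intros)
      have i: "((\<lambda>r. r + c) has_real_derivative 1) (at r)" for c :: real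
        by (auto intro!: derivative_eq_intros)
      have "(?j has_real_derivative (1 * ln (r + \<delta>) + 1 / (r + \<delta>) * (r + \<delta>))
          - ((1 * ln ((r + N) / N) + 1 / (r + N) * (r + N)) - 1)) (at r)"
        by (intro DERIV_diff DERIV_mult i l DERIV_ident)
      then show "(?j has_real_derivative ?j' r) (at r)" using p by simp
      have "(?j' has_real_derivative (1 / (r + \<delta>) + 0) - 1 / (r + N)) (at r)"
        by (intro DERIV_diff DERIV_add DERIV_const l)
      then show "(?j' has_real_derivative ?j'' r) (at r)" by simp
    qed
    have cj'': "continuous_on {0..} ?j''"
      using \<delta> N by (intro continuous_intros) auto
    have j''0: "0 \<le> ?j'' r" if "r \<ge> 0" for r
    proof -
      have "1 / (r + N) \<le> 1 / (r + \<delta>)" using that \<delta> N by (intro divide_left_mono) auto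
      then show ?thesis by simp
    qed
    \<comment> \<open>Linear in \<open>r\<close>, so after weighting by \<open>g\<close> the bound
      from \<open>convex_dissipation\<close> integrates to a multiple of the mass of
      \<open>f\<close>, uniformly in \<delta> and \<open>N\<close>.\<close>
    have j''r: "?j'' r * r\<^sup>2 \<le> r" if r: "r \<ge> 0" for r
    proof -
      have "0 \<le> 1 / (r + N)" using r N by simp
      then have "?j'' r * r\<^sup>2 \<le> 1 / (r + \<delta>) * r\<^sup>2" by (intro mult_right_mono) auto
      also have "\<dots> \<le> r" using r \<delta> by (simp add: pos_divide_le_eq power2_eq_square distrib_left)
      finally show ?thesis .
    qed
    define y where "y t = (\<integral>x. g x * ?j ((f t x - 0) / g x) \<partial>torus)" for t
    define y' where "y' t = - (\<integral>x. ?j'' ((f t x - 0) / g x) * (\<Phi> t x \<bullet> flux \<beta> V W (f t) x) \<partial>torus)" for t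
    have dy: "(y has_real_derivative y' \<tau>) (at \<tau>)" if "\<tau> > 0" for \<tau>
      unfolding y_def y'_def
      by (rule functional_derivative[where D="{0..}", OF g_C1 g_pos torus_C1_const ratio_C1 _ j cj'' that])
        (use ratio_nonneg in auto)
    have le: "y' \<tau> \<le> 0 * y \<tau> + \<beta> * b\<^sup>2" if \<tau>: "\<tau> > 0" for \<tau>
    proof -
      have "y' \<tau> = (\<integral>x. - (?j'' ((f \<tau> x - 0) / g x) * (\<Phi> \<tau> x \<bullet> flux \<beta> V W (f \<tau>) x)) \<partial>torus)"
        by (simp add: y'_def)
      also have "\<dots> \<le> (\<integral>x. \<beta> * b\<^sup>2 * f \<tau> x \<partial>torus)"
      proof (rule torus_mono)
        have "continuous_on UNIV (\<lambda>x. ?j'' (f \<tau> x / g x))"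
          by (rule continuous_on_compose2[OF cj'' c\<phi>[OF \<tau>]]) (use ratio_nonneg[of \<tau>] \<tau> in auto)
        then show "continuous_on UNIV (\<lambda>x. - (?j'' ((f \<tau> x - 0) / g x) * (\<Phi> \<tau> x \<bullet> flux \<beta> V W (f \<tau>) x)))"
          unfolding diff_zero by (intro continuous_on_minus continuous_on_mult continuous_on_inner \<Phi>_continuous flux_f_continuous \<tau>)
        show "continuous_on UNIV (\<lambda>x. \<beta> * b\<^sup>2 * f \<tau> x)" by (intro continuous_intros f_continuous \<tau>)
        fix x
        define \<phi> where "\<phi> = f \<tau> x / g x"
        have \<phi>0: "0 \<le> \<phi>" unfolding \<phi>_def using ratio_nonneg \<tau> by simp
        have v2: "norm (v \<tau> x) \<le> 2 * b"
          using norm_v[OF \<tau>, of x] mult_left_mono[OF L_le_2[OF \<tau>] b_nonneg] by simp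
        have "- (?j'' \<phi> * (\<Phi> \<tau> x \<bullet> flux \<beta> V W (f \<tau>) x)) \<le> g x * (\<beta> * \<phi> * (2 * b)\<^sup>2 / 4)"
          using convex_dissipation[OF \<tau> j''0[OF \<phi>0] _ v2] j''r[OF \<phi>0] unfolding \<phi>_def by blast
        also have "\<dots> = \<beta> * b\<^sup>2 * f \<tau> x"
          using g_pos[of x] by (simp add: \<phi>_def power_mult_distrib)
        finally show "- (?j'' ((f \<tau> x - 0) / g x) * (\<Phi> \<tau> x \<bullet> flux \<beta> V W (f \<tau>) x)) \<le> \<beta> * b\<^sup>2 * f \<tau> x"
          by (simp add: \<phi>_def)
      qed
      also have "\<dots> = \<beta> * b\<^sup>2" by (simp add: f_mass[OF \<tau>])
      finally show ?thesis by simp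
    qed
    \<comment> \<open>\<open>?j' r\<close> is \<open>1 + ln N\<close> plus the logarithm of
      \<open>(r + \<delta>) / (r + N)\<close>, a quotient between \<open>\<delta> / N\<close> and
      1.\<close>
    define C where "C = 1 + \<bar>ln \<delta>\<bar> + \<bar>ln N\<bar>"
    have lip: "\<bar>?j r - ?j s\<bar> \<le> C * \<bar>r - s\<bar>" if "r \<in> {0..}" "s \<in> {0..}" for r s
    proof (rule lipschitz_from_derivative[OF _ j(1) _ that])
      show "convex {0::real..}" by (rule convex_real_interval)
      fix r :: real assume r: "r \<in> {0..}"
      have "ln (r + \<delta>) - ln ((r + N) / N) = ln ((r + \<delta>) / (r + N)) + ln N"
        using r \<delta> N by (simp add: ln_div)
      moreover have "ln ((r + \<delta>) / (r + N)) \<le> 0" using r \<delta> N by simp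
      moreover have "ln (\<delta> / N) \<le> ln ((r + \<delta>) / (r + N))"
      proof -
        have "r * \<delta> \<le> r * N" using r \<delta> N by (intro mult_left_mono) auto
        then have "\<delta> / N \<le> (r + \<delta>) / (r + N)" using r \<delta> N by (simp add: field_simps)
        then show ?thesis using \<delta> N by (intro ln_mono) auto
      qed
      moreover have "ln (\<delta> / N) = ln \<delta> - ln N" using \<delta> N by (simp add: ln_div)
      ultimately show "\<bar>?j' r\<bar> \<le> C" unfolding C_def by linarith
    qed
    have int: "integrable torus (\<lambda>x. g x * ?j ((f s x - 0) / g x))" if s: "s \<ge> 0" for s
    proof (rule Bochner_Integration.integrable_bound)
      show "integrable torus (\<lambda>x. \<bar>?j 0\<bar> * g x + C * f s x)"
        using f_integrable[OF s] torus_integrable[OF g_continuous] by simp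
      have "f s \<in> borel_measurable torus" using f_integrable[OF s] by (rule borel_measurable_integrable)
      then show "(\<lambda>x. g x * ?j ((f s x - 0) / g x)) \<in> borel_measurable torus"
        using initial_measurable(2) by measurable
      have "norm (g x * ?j ((f s x - 0) / g x)) \<le> \<bar>?j 0\<bar> * g x + C * f s x" for x
      proof -
        have tri: "\<bar>A\<bar> \<le> \<bar>B\<bar> + c" if "\<bar>A - B\<bar> \<le> c" for A B c :: real using that by linarith
        have "\<bar>?j (f s x / g x) - ?j 0\<bar> \<le> C * \<bar>f s x / g x - 0\<bar>"
          using ratio_nonneg[OF s] by (intro lip) auto
        then have "\<bar>?j (f s x / g x)\<bar> \<le> \<bar>?j 0\<bar> + C * (f s x / g x)"
          unfolding diff_zero abs_of_nonneg[OF ratio_nonneg[OF s]] by (rule tri)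
        then have "g x * \<bar>?j (f s x / g x)\<bar> \<le> g x * (\<bar>?j 0\<bar> + C * (f s x / g x))"
          using g_nonneg by (intro mult_left_mono)
        also have "\<dots> = \<bar>?j 0\<bar> * g x + C * f s x" using g_pos[of x] by (simp add: distrib_left mult.commute)
        finally show ?thesis using g_nonneg[of x] unfolding diff_zero by (simp only: real_norm_def abs_mult abs_of_nonneg)
      qed
      then have "norm (g x * ?j ((f s x - 0) / g x)) \<le> norm (\<bar>?j 0\<bar> * g x + C * f s x)" for x
        unfolding real_norm_def[of "\<bar>?j 0\<bar> * g x + C * f s x"] by (rule order_trans[OF _ abs_ge_self])
      then show "AE x in torus. norm (g x * ?j ((f s x - 0) / g x)) \<le> norm (\<bar>?j 0\<bar> * g x + C * f s x)"
        by (rule AE_I2)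
    qed
    have lim: "(y \<longlongrightarrow> y 0) (at_right 0)"
      unfolding y_def[abs_def]
      by (rule functional_initial[where S="{0..}" and C=C, OF g_pos lip _ int]) (use ratio_nonneg in auto)
    have y0: "y 0 \<le> rel_entropy (f 0) g + \<delta> * (1 + \<delta>)"
    proof -
      have i: "integrable torus (\<lambda>x. f 0 x * ln (f 0 x / g x))" using fin by (simp add: finite_entropy_def)
      have "y 0 \<le> (\<integral>x. f 0 x * ln (f 0 x / g x) + (\<delta> * f 0 x + \<delta>\<^sup>2 * g x) \<partial>torus)"
        unfolding y_def
      proof (rule integral_mono[OF int])
        show "integrable torus (\<lambda>x. f 0 x * ln (f 0 x / g x) + (\<delta> * f 0 x + \<delta>\<^sup>2 * g x))"
          using i f0_integrable torus_integrable[OF g_continuous] by simp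
        fix x
        define r where "r = f 0 x / g x"
        have r: "0 \<le> r" using ratio_nonneg by (simp add: r_def)
        have "?j r \<le> r * ln r + \<delta> * (r + \<delta>)"
          using shifted_entropy_le[OF r \<delta>(1)] entropy_cutoff_bounds(1)[OF r, of N] N by linarith
        then have "g x * ?j r \<le> g x * (r * ln r + \<delta> * (r + \<delta>))" using g_nonneg by (intro mult_left_mono)
        also have "\<dots> = f 0 x * ln (f 0 x / g x) + (\<delta> * f 0 x + \<delta>\<^sup>2 * g x)"
        proof -
          have "g x * r = f 0 x" using g_pos[of x] by (simp add: r_def)
          moreover have "g x * (r * ln r + \<delta> * (r + \<delta>)) = (g x * r) * ln r + (\<delta> * (g x * r) + \<delta>\<^sup>2 * g x)"
            by (simp add: power2_eq_square algebra_simps)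
          ultimately show ?thesis by (simp add: r_def)
        qed
        finally show "g x * ?j ((f 0 x - 0) / g x) \<le> f 0 x * ln (f 0 x / g x) + (\<delta> * f 0 x + \<delta>\<^sup>2 * g x)"
          by (simp only: r_def diff_zero)
      qed simp
      also have "\<dots> = rel_entropy (f 0) g + \<delta> * (1 + \<delta>)"
        using i f0_integrable torus_integrable[OF g_continuous]
        by (simp add: rel_entropy_def f0_mass g_mass power2_eq_square algebra_simps)
      finally show ?thesis .
    qed
    have "y t \<le> exp (0 * t) * (y 0 + \<beta> * b\<^sup>2 * t * exp (\<bar>0\<bar> * t))"
      by (rule gronwall_initial[OF dy le _ order_refl lim t]) (use \<beta> in auto)
    then have yR: "y t \<le> R" using y0 by (simp add: R_def)
    \<comment> \<open>At the fixed time \<open>t\<close> the ratio is at most \<open>S\<close>, so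
      undoing the cutoff costs no more than \<open>S\<^sup>2 / N\<close>.\<close>
    have "(\<integral>x. g x * ?h (f t x / g x) \<partial>torus) \<le> (\<integral>x. g x * ?j ((f t x - 0) / g x) + S\<^sup>2 / N * g x \<partial>torus)"
    proof (rule integral_mono)
      show "integrable torus (\<lambda>x. g x * ?h (f t x / g x))"
        by (intro torus_integrable continuous_on_mult g_continuous ch t)
      show "integrable torus (\<lambda>x. g x * ?j ((f t x - 0) / g x) + S\<^sup>2 / N * g x)"
        using int[of t] t torus_integrable[OF g_continuous] by simp
      fix x
      define r where "r = f t x / g x"
      have r: "0 \<le> r" using ratio_nonneg t by (simp add: r_def)
      have "r\<^sup>2 \<le> S\<^sup>2" using r S(2)[of x] unfolding diff_zero real_norm_def r_def[symmetric] by (intro power_mono) simp_all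
      then have "r\<^sup>2 / N \<le> S\<^sup>2 / N" using N by (intro divide_right_mono) auto
      then have "?h r \<le> ?j r + S\<^sup>2 / N" using entropy_cutoff_bounds(2)[OF r, of N] N by linarith
      then have "g x * ?h r \<le> g x * (?j r + S\<^sup>2 / N)" using g_nonneg by (intro mult_left_mono)
      then have "g x * ?h r \<le> g x * ?j r + S\<^sup>2 / N * g x" by (simp only: distrib_left mult.commute[of "S\<^sup>2 / N"])
      then show "g x * ?h (f t x / g x) \<le> g x * ?j ((f t x - 0) / g x) + S\<^sup>2 / N * g x"
        by (simp only: r_def diff_zero)
    qed
    also have "\<dots> = y t + S\<^sup>2 / N"
      using int[of t] t torus_integrable[OF g_continuous] by (simp add: y_def g_mass)
    finally show ?thesis using yR by linarith
  qed
  have "(\<integral>x. g x * ?h (f t x / g x) \<partial>torus) \<le> R + 0"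
  proof (rule tendsto_lowerbound)
    have "((\<lambda>N. S\<^sup>2 / N) \<longlongrightarrow> 0) at_top" by real_asymp
    then show "((\<lambda>N. R + S\<^sup>2 / N) \<longlongrightarrow> R + 0) at_top" by (intro tendsto_intros)
    show "\<forall>\<^sub>F N in at_top. (\<integral>x. g x * ?h (f t x / g x) \<partial>torus) \<le> R + S\<^sup>2 / N"
      using eventually_ge_at_top[of "1::real"] by (rule eventually_mono) (rule main)
  qed simp
  then show ?thesis by (simp add: R_def)
qed

text \<open>With the shift, the interaction term carries the factor
  \<open>(s - \<delta>) / s\<close> instead of 1, where \<open>s\<close> is the shifted ratio. The
  error is split by Young with weight \<epsilon>, the root of \<delta>: it takes \<epsilon> from the
  diffusion coefficient and adds a source of size \<epsilon>, both of which vanish in the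
  limit.\<close>

lemma Ent_derivative_bound:
  assumes t: "t > 0" and \<delta>: "0 < \<delta>" "\<delta> \<le> 1" and \<epsilon>: "0 < \<epsilon>" "\<epsilon>\<^sup>2 = \<delta>" "\<epsilon> \<le> inverse \<beta>"
  shows "\<exists>E'. (Ent \<delta> has_real_derivative E') (at t) \<and>
    E' \<le> - (eta_const \<beta> V W - 8 * pi\<^sup>2 / \<Gamma> * \<epsilon>) * Ent \<delta> t + \<epsilon> * b\<^sup>2"
proof -
  let ?\<psi> = "\<lambda>x. f t x / g x + \<delta>"
  note c\<psi> = torus_C1_continuous[OF shifted_ratio(1)[OF t \<delta>(1)]] and pos = shifted_ratio(2)[OF t \<delta>(1)]
  have ne: "?\<psi> x \<noteq> 0" for x using pos[of x] by (metis less_irrefl)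
  note c\<Phi> = \<Phi>_continuous[OF t] and cv = v_continuous[OF t]
  define I where "I = (\<integral>x. g x * ((norm (\<Phi> t x))\<^sup>2 / ?\<psi> x) \<partial>torus)"
  define E' where "E' = - (\<integral>x. 1 / ?\<psi> x * (\<Phi> t x \<bullet> flux \<beta> V W (f t) x) \<partial>torus)"
  have "((\<lambda>t. \<integral>x. g x * (((f t x - 0) / g x + \<delta>) * ln ((f t x - 0) / g x + \<delta>)) \<partial>torus) has_real_derivative
    - (\<integral>x. 1 / ((f t x - 0) / g x + \<delta>) * (\<Phi> t x \<bullet> flux \<beta> V W (f t) x) \<partial>torus)) (at t)"
  proof (rule functional_derivative[where D="{0..}" and j="\<lambda>r. (r + \<delta>) * ln (r + \<delta>)" and j'="\<lambda>r. ln (r + \<delta>) + 1"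
        and j''="\<lambda>r. 1 / (r + \<delta>)", OF g_C1 g_pos torus_C1_const ratio_C1 _ _ _ _ t])
    show "((\<lambda>r. (r + \<delta>) * ln (r + \<delta>)) has_real_derivative ln (r + \<delta>) + 1) (at r)"
      "((\<lambda>r. ln (r + \<delta>) + 1) has_real_derivative 1 / (r + \<delta>)) (at r)" if "r \<in> {0..}" for r
      using that \<delta> by (auto intro!: derivative_eq_intros)
    show "continuous_on {0..} (\<lambda>r. 1 / (r + \<delta>))" using \<delta> by (intro continuous_intros) auto
  qed (use ratio_nonneg in auto)
  then have d: "(Ent \<delta> has_real_derivative E') (at t)"
    unfolding Ent_def[abs_def] E'_def diff_zero by (auto intro!: derivative_eq_intros)
  have cI: "continuous_on UNIV (\<lambda>x. (inverse \<beta> - \<epsilon>) * (g x * ((norm (\<Phi> t x))\<^sup>2 / ?\<psi> x)))"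
    "continuous_on UNIV (\<lambda>x. g x * (\<Phi> t x \<bullet> v t x))" "continuous_on UNIV (\<lambda>x. \<epsilon> * b\<^sup>2 * g x)"
    "continuous_on UNIV (\<lambda>x. g x * ((norm (\<Phi> t x))\<^sup>2 / ?\<psi> x))"
    by (intro continuous_on_mult continuous_on_const continuous_on_divide continuous_on_power continuous_on_norm
        continuous_on_inner g_continuous c\<Phi> cv c\<psi>; use ne in auto)+
  have "E' = (\<integral>x. - (1 / ?\<psi> x * (\<Phi> t x \<bullet> flux \<beta> V W (f t) x)) \<partial>torus)" by (simp add: E'_def)
  also have "\<dots> \<le> (\<integral>x. (- ((inverse \<beta> - \<epsilon>) * (g x * ((norm (\<Phi> t x))\<^sup>2 / ?\<psi> x))) - g x * (\<Phi> t x \<bullet> v t x)) + \<epsilon> * b\<^sup>2 * g x \<partial>torus)"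
  proof (rule torus_mono)
    show "continuous_on UNIV (\<lambda>x. - (1 / ?\<psi> x * (\<Phi> t x \<bullet> flux \<beta> V W (f t) x)))"
      by (intro continuous_on_minus continuous_on_mult continuous_on_divide continuous_on_const continuous_on_inner
          c\<Phi> flux_f_continuous t c\<psi>) (use ne in auto)
    show "continuous_on UNIV (\<lambda>x. (- ((inverse \<beta> - \<epsilon>) * (g x * ((norm (\<Phi> t x))\<^sup>2 / ?\<psi> x))) - g x * (\<Phi> t x \<bullet> v t x)) + \<epsilon> * b\<^sup>2 * g x)"
      by (intro continuous_on_add[of UNIV] continuous_on_diff continuous_on_minus cI)
    fix x
    define s where "s = ?\<psi> x"
    define X where "X = \<Phi> t x"
    have s: "s > 0" "s \<ge> \<delta>" using pos[of x] ratio_nonneg[of t x] t by (auto simp: s_def)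
    have \<phi>: "f t x / g x = s - \<delta>" by (simp add: s_def)
    have e: "- (1 / s * (X \<bullet> flux \<beta> V W (f t) x)) = g x * (- (inverse \<beta> * ((norm X)\<^sup>2 / s)) - X \<bullet> v t x + \<delta> / s * (X \<bullet> v t x))"
    proof -
      have "X \<bullet> flux \<beta> V W (f t) x = g x * (inverse \<beta> * (norm X)\<^sup>2 + (s - \<delta>) * (X \<bullet> v t x))"
        unfolding flux_ratio[OF t] \<phi> X_def[symmetric] by (simp add: inner_add_right power2_norm_eq_inner)
      moreover have "- (1 / s * (g' * (i * A + (s - \<delta>) * P))) = g' * (- (i * (A / s)) - P + \<delta> / s * P)" for g' i A P :: real
        using s(1) by (simp add: field_simps)
      ultimately show ?thesis by simp
    qed
    \<comment> \<open>After the square is completed the remainder carries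
      \<open>\<delta> / s\<close>, which is at most 1 since the ratio is nonnegative; with
      \<open>norm (v t x)\<close> at most \<open>2 * b\<close> this leaves
      \<open>\<epsilon> * b\<^sup>2\<close>.\<close>
    have "\<delta> / s * (X \<bullet> v t x) \<le> \<epsilon> * ((norm X)\<^sup>2 / s) + \<epsilon> * b\<^sup>2"
    proof -
      have v2: "(norm (v t x))\<^sup>2 \<le> (2 * b)\<^sup>2"
        using norm_v[OF t, of x] mult_left_mono[OF L_le_2[OF t] b_nonneg] by (intro power_mono) auto
      have "0 \<le> \<epsilon> / s * (norm (X - (\<epsilon> / 2) *\<^sub>R v t x))\<^sup>2" using \<epsilon> s by simp
      also have "\<dots> = \<epsilon> * ((norm X)\<^sup>2 / s) - \<epsilon>\<^sup>2 / s * (X \<bullet> v t x) + \<epsilon> * (\<epsilon>\<^sup>2 / s) * (norm (v t x))\<^sup>2 / 4"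
      proof -
        have "(norm (X - (\<epsilon> / 2) *\<^sub>R v t x))\<^sup>2 = (norm X)\<^sup>2 - \<epsilon> * (X \<bullet> v t x) + \<epsilon>\<^sup>2 / 4 * (norm (v t x))\<^sup>2"
          unfolding power2_norm_eq_inner
          by (simp add: inner_diff_left inner_diff_right inner_commute power2_eq_square)
        moreover have "\<epsilon> / s * (A - \<epsilon> * P + \<epsilon>\<^sup>2 / 4 * B) = \<epsilon> * (A / s) - \<epsilon>\<^sup>2 / s * P + \<epsilon> * (\<epsilon>\<^sup>2 / s) * B / 4" for A P B
          using s by (simp add: field_simps power2_eq_square)
        ultimately show ?thesis by simp
      qed
      finally have "\<delta> / s * (X \<bullet> v t x) \<le> \<epsilon> * ((norm X)\<^sup>2 / s) + \<epsilon> * (\<delta> / s) * (norm (v t x))\<^sup>2 / 4" using \<epsilon>(2) by simp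
      also have "\<epsilon> * (\<delta> / s) * (norm (v t x))\<^sup>2 / 4 \<le> \<epsilon> * 1 * (2 * b)\<^sup>2 / 4"
        using s \<epsilon> \<delta> v2 by (intro divide_right_mono mult_mono) auto
      finally show ?thesis by (simp add: power_mult_distrib)
    qed
    then have "g x * (- (inverse \<beta> * ((norm X)\<^sup>2 / s)) - X \<bullet> v t x + \<delta> / s * (X \<bullet> v t x))
       \<le> g x * (- (inverse \<beta> * ((norm X)\<^sup>2 / s)) - X \<bullet> v t x + (\<epsilon> * ((norm X)\<^sup>2 / s) + \<epsilon> * b\<^sup>2))"
      using g_nonneg by (intro mult_left_mono) auto
    also have "\<dots> = (- ((inverse \<beta> - \<epsilon>) * (g x * ((norm X)\<^sup>2 / s))) - g x * (X \<bullet> v t x)) + \<epsilon> * b\<^sup>2 * g x"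
    proof -
      have "g' * (- (i * A) - P + (\<epsilon> * A + B)) = (- ((i - \<epsilon>) * (g' * A)) - g' * P) + B * g'" for g' i A P B :: real
        by (simp add: algebra_simps)
      then show ?thesis .
    qed
    finally show "- (1 / ?\<psi> x * (\<Phi> t x \<bullet> flux \<beta> V W (f t) x))
       \<le> (- ((inverse \<beta> - \<epsilon>) * (g x * ((norm (\<Phi> t x))\<^sup>2 / ?\<psi> x))) - g x * (\<Phi> t x \<bullet> v t x)) + \<epsilon> * b\<^sup>2 * g x"
      using e unfolding s_def X_def by simp
  qed
  also have "\<dots> = (- ((inverse \<beta> - \<epsilon>) * I) - (\<integral>x. g x * (\<Phi> t x \<bullet> v t x) \<partial>torus)) + \<epsilon> * b\<^sup>2"
  proof -
    have "(\<integral>x. (- (i * A x) - P x) + c * g x \<partial>torus) = (- (i * (\<integral>x. A x \<partial>torus)) - (\<integral>x. P x \<partial>torus)) + c"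
      if "integrable torus A" "integrable torus P" for A P i c
      using that torus_integrable[OF g_continuous] by (simp add: g_mass)
    from this[OF torus_integrable[OF cI(4)] torus_integrable[OF cI(2)]] show ?thesis unfolding I_def .
  qed
  also have "\<dots> \<le> - ((inverse \<beta> - \<epsilon>) * (8 * pi\<^sup>2 / \<Gamma> * Ent \<delta> t)) + 8 * K * Ent \<delta> t + \<epsilon> * b\<^sup>2"
  proof -
    have "Ent \<delta> t \<le> \<Gamma> / (8 * pi\<^sup>2) * I"
      using weighted_log_sobolev[OF shifted_ratio(1)[OF t \<delta>(1)] pos] unfolding shifted_ratio(3)[OF t \<delta>(1)]
      by (simp add: Ent_def I_def)
    then have "8 * pi\<^sup>2 / \<Gamma> * Ent \<delta> t \<le> 8 * pi\<^sup>2 / \<Gamma> * (\<Gamma> / (8 * pi\<^sup>2) * I)"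
      using \<Gamma>_pos by (intro mult_left_mono) auto
    also have "\<dots> = I" using \<Gamma>_pos by simp
    finally have 1: "(inverse \<beta> - \<epsilon>) * (8 * pi\<^sup>2 / \<Gamma> * Ent \<delta> t) \<le> (inverse \<beta> - \<epsilon>) * I"
      using \<epsilon>(3) by (intro mult_left_mono) auto
    \<comment> \<open>The factor 8 before the interaction constant in \<open>eta_const\<close>
      arises here, as \<delta> is at most 1.\<close>
    have "K * (L t)\<^sup>2 \<le> K * (4 * (1 + \<delta>) * Ent \<delta> t)"
      using L_le_entropy(2)[OF t \<delta>(1)] K_nonneg by (intro mult_left_mono)
    also have "\<dots> \<le> K * (8 * Ent \<delta> t)"
      using \<delta> K_nonneg L_le_entropy(1)[OF t \<delta>(1)] by (intro mult_left_mono mult_right_mono) auto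
    finally have 2: "- (\<integral>x. g x * (\<Phi> t x \<bullet> v t x) \<partial>torus) \<le> 8 * K * Ent \<delta> t"
      using interaction_bound[OF t] by simp
    show ?thesis using 1 2 by linarith
  qed
  also have "\<dots> = - (eta_const \<beta> V W - 8 * pi\<^sup>2 / \<Gamma> * \<epsilon>) * Ent \<delta> t + \<epsilon> * b\<^sup>2"
  proof -
    have "eta_const \<beta> V W = inverse \<beta> * (8 * pi\<^sup>2 / \<Gamma>) - 8 * K"
      using \<beta> \<Gamma>_pos by (simp add: eta_const_def K_def divide_inverse algebra_simps)
    moreover have "- ((i - \<epsilon>) * (k * E)) + 8 * K * E + c = - ((i * k - 8 * K) - k * \<epsilon>) * E + c" for i k E c
      by (simp add: algebra_simps)
    ultimately show ?thesis by (simp only:)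
  qed
  finally show ?thesis using d by blast
qed

text \<open>For each \<epsilon> the shifted entropy with
  \<open>\<delta> = \<epsilon>\<^sup>2\<close> obeys Gronwall, with \<open>entropy_bound\<close> as
  the bound near time 0. The \<open>L\<^sup>1\<close> distance does not depend on \<epsilon>, so the
  limit is taken only in the final estimate \<open>F\<close>.\<close>

lemma L_decay_entropy:
  assumes fin: "finite_entropy (f 0) g" and t: "t > 0"
  shows "(L t)\<^sup>2 \<le> 8 * rel_entropy (f 0) g * exp (- eta_const \<beta> V W * t)"
proof -
  let ?H = "rel_entropy (f 0) g" and ?\<eta> = "eta_const \<beta> V W"
  define \<kappa> where "\<kappa> = 8 * pi\<^sup>2 / \<Gamma>"
  define F where "F \<epsilon> = 4 * (1 + \<epsilon>\<^sup>2) * (exp (- (?\<eta> - \<kappa> * \<epsilon>) * t) * ((?H + \<epsilon>\<^sup>2 * (1 + \<epsilon>\<^sup>2)) + \<epsilon> * b\<^sup>2 * t * exp (\<bar>- (?\<eta> - \<kappa> * \<epsilon>)\<bar> * t)))" for \<epsilon>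
  have main: "(L t)\<^sup>2 \<le> F \<epsilon>" if \<epsilon>: "0 < \<epsilon>" "\<epsilon> < min 1 (inverse \<beta>)" for \<epsilon>
  proof -
    have \<delta>: "0 < \<epsilon>\<^sup>2" "\<epsilon>\<^sup>2 \<le> 1" using \<epsilon> by (auto intro: power_le_one)
    have ex: "\<exists>E'. (Ent (\<epsilon>\<^sup>2) has_real_derivative E') (at t) \<and> E' \<le> - (?\<eta> - \<kappa> * \<epsilon>) * Ent (\<epsilon>\<^sup>2) t + \<epsilon> * b\<^sup>2"
      if "t > 0" for t
      unfolding \<kappa>_def by (rule Ent_derivative_bound[OF that \<delta> \<epsilon>(1) refl]) (use \<epsilon>(2) in simp)
    define E' where "E' t = (SOME e. (Ent (\<epsilon>\<^sup>2) has_real_derivative e) (at t) \<and> e \<le> - (?\<eta> - \<kappa> * \<epsilon>) * Ent (\<epsilon>\<^sup>2) t + \<epsilon> * b\<^sup>2)" for t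
    have E': "(Ent (\<epsilon>\<^sup>2) has_real_derivative E' t) (at t)" "E' t \<le> - (?\<eta> - \<kappa> * \<epsilon>) * Ent (\<epsilon>\<^sup>2) t + \<epsilon> * b\<^sup>2" if "t > 0" for t
      using someI_ex[OF ex[OF that]] unfolding E'_def by blast+
    have "Ent (\<epsilon>\<^sup>2) t \<le> exp (- (?\<eta> - \<kappa> * \<epsilon>) * t) * ((?H + \<epsilon>\<^sup>2 * (1 + \<epsilon>\<^sup>2)) + \<epsilon> * b\<^sup>2 * t * exp (\<bar>- (?\<eta> - \<kappa> * \<epsilon>)\<bar> * t))"
    proof (rule gronwall_initial[OF E' _ _ _ t])
      show "0 \<le> \<epsilon> * b\<^sup>2" using \<epsilon> by simp
      show "Ent (\<epsilon>\<^sup>2) s \<le> ?H + \<epsilon>\<^sup>2 * (1 + \<epsilon>\<^sup>2) + \<beta> * b\<^sup>2 * s" if "0 < s" for s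
      proof -
        have "0 \<le> (1 + \<epsilon>\<^sup>2) * ln (1 + \<epsilon>\<^sup>2)" by (intro mult_nonneg_nonneg ln_ge_zero) auto
        then show ?thesis unfolding Ent_def using entropy_bound[OF fin \<delta> that] by linarith
      qed
      show "((\<lambda>s. ?H + \<epsilon>\<^sup>2 * (1 + \<epsilon>\<^sup>2) + \<beta> * b\<^sup>2 * s) \<longlongrightarrow> ?H + \<epsilon>\<^sup>2 * (1 + \<epsilon>\<^sup>2)) (at_right 0)"
        by (auto intro!: tendsto_eq_intros)
    qed
    then have "4 * (1 + \<epsilon>\<^sup>2) * Ent (\<epsilon>\<^sup>2) t \<le> F \<epsilon>" unfolding F_def by (intro mult_left_mono) auto
    then show ?thesis using L_le_entropy(2)[OF t \<delta>(1)] by linarith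
  qed
  have "(L t)\<^sup>2 \<le> 4 * (exp (- ?\<eta> * t) * ?H)"
  proof (rule tendsto_lowerbound)
    show "(F \<longlongrightarrow> 4 * (exp (- ?\<eta> * t) * ?H)) (at_right 0)"
    proof -
      have "(F \<longlongrightarrow> 4 * (1 + 0\<^sup>2) * (exp (- (?\<eta> - \<kappa> * 0) * t) * ((?H + 0\<^sup>2 * (1 + 0\<^sup>2)) + 0 * b\<^sup>2 * t * exp (\<bar>- (?\<eta> - \<kappa> * 0)\<bar> * t)))) (at_right 0)"
        unfolding F_def by (intro tendsto_intros)
      then show ?thesis by simp
    qed
    show "\<forall>\<^sub>F \<epsilon> in at_right 0. (L t)\<^sup>2 \<le> F \<epsilon>"
      unfolding eventually_at_right_field using main \<beta> by (intro exI[of _ "min 1 (inverse \<beta>)"]) auto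
  qed simp
  \<comment> \<open>The estimate itself shows that the entropy is nonnegative, which permits passing
    from the factor 4 to 8.\<close>
  moreover from this have "0 \<le> exp (- ?\<eta> * t) * ?H" using zero_le_power2[of "L t"] by linarith
  ultimately show ?thesis by (simp add: mult_ac)
qed

theorem L1_decay_from_entropy:
  assumes fin: "finite_entropy (f 0) g" and t: "t \<ge> 0"
  shows "L1_norm (\<lambda>x. f t x - g x) \<le> 2 * sqrt (2 * rel_entropy (f 0) g) * exp (- (eta_const \<beta> V W / 2) * t)"
proof -
  let ?H = "rel_entropy (f 0) g" and ?\<eta> = "eta_const \<beta> V W"
  let ?R = "\<lambda>t. 2 * sqrt (2 * ?H) * exp (- (?\<eta> / 2) * t)"
  have pos: "L t \<le> ?R t" if t: "t > 0" for t
  proof -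
    have H: "0 \<le> ?H"
    proof -
      have "0 \<le> 8 * ?H * exp (- ?\<eta> * t)"
        by (rule order_trans[OF zero_le_power2 L_decay_entropy[OF fin t]])
      then have "0 \<le> 8 * ?H" using exp_gt_zero[of "- ?\<eta> * t"] by (simp only: zero_le_mult_iff) linarith
      then show ?thesis by simp
    qed
    have e: "(exp (- (?\<eta> / 2) * t))\<^sup>2 = exp (- ?\<eta> * t)" by (simp only: exp_double[symmetric]) simp
    have "(sqrt (2 * ?H))\<^sup>2 = 2 * ?H" using H by (intro real_sqrt_pow2) simp
    then have "(?R t)\<^sup>2 = 8 * ?H * exp (- ?\<eta> * t)"
      unfolding power_mult_distrib e by simp
    then have "(L t)\<^sup>2 \<le> (?R t)\<^sup>2" by (simp only: L_decay_entropy[OF fin t])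
    then show ?thesis by (rule power2_le_imp_le) (use H in simp)
  qed
  have "L t \<le> ?R t"
  proof (cases "t = 0")
    case False then show ?thesis using pos t by simp
  next
    case True
    \<comment> \<open>At time 0 the bound is inherited from small positive times by
      \<open>L\<^sup>1\<close> continuity.\<close>
    have "L 0 \<le> ?R 0 + 0"
    proof (rule tendsto_lowerbound)
      show "((\<lambda>s. ?R s + (\<integral>x. \<bar>f s x - f 0 x\<bar> \<partial>torus)) \<longlongrightarrow> ?R 0 + 0) (at_right 0)"
        by (intro tendsto_intros initial_L1)
      have "L 0 \<le> ?R s + (\<integral>x. \<bar>f s x - f 0 x\<bar> \<partial>torus)" if s: "0 < s" for s
      proof -
        have i: "integrable torus (u 0)" "integrable torus (u s)" "integrable torus (f s)"
          using u_integrable f_integrable s by simp_all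
        have "L 0 \<le> (\<integral>x. \<bar>u s x\<bar> + \<bar>f s x - f 0 x\<bar> \<partial>torus)"
          unfolding L_def
        proof (rule integral_mono)
          show "integrable torus (\<lambda>x. \<bar>u 0 x\<bar>)" using i by simp
          show "integrable torus (\<lambda>x. \<bar>u s x\<bar> + \<bar>f s x - f 0 x\<bar>)" using i f0_integrable by simp
          show "\<bar>u 0 x\<bar> \<le> \<bar>u s x\<bar> + \<bar>f s x - f 0 x\<bar>" for x unfolding u_def by linarith
        qed
        also have "\<dots> = L s + (\<integral>x. \<bar>f s x - f 0 x\<bar> \<partial>torus)" using i f0_integrable by (simp add: L_def)
        finally show ?thesis using pos[OF s] by linarith
      qed
      then show "\<forall>\<^sub>F s in at_right 0. L 0 \<le> ?R s + (\<integral>x. \<bar>f s x - f 0 x\<bar> \<partial>torus)"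
        using eventually_at_right_less[of "0::real"] by (rule eventually_mono[rotated])
    qed simp
    then show ?thesis using True by simp
  qed
  then show ?thesis by (simp add: L1_norm_def L_def u_def)
qed

end

theorem corollary2p17:
  fixes V W :: "real^'d \<Rightarrow> real" and \<beta> :: real
    and f :: "real \<Rightarrow> real^'d \<Rightarrow> real" and f_inf :: "real^'d \<Rightarrow> real"
  assumes "\<beta> > 0"
    and "periodic V" and "periodic W"
    and "C2 V" and "C2 W"
    and "\<And>x. W (- x) = W x"
    and "H_stable W \<or> Linf_norm W < inverse \<beta>"
    and "prob_density (f 0)"
    and "mckean_vlasov_solution \<beta> V W f"
    and "invariant_density \<beta> V W f_inf"
  shows "(in_L2 (\<lambda>x. f 0 x - f_inf x) \<longrightarrow>
           (\<forall>t\<ge>0. L1_norm (\<lambda>x. f t x - f_inf x)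
              \<le> L2_norm (\<lambda>x. f 0 x - f_inf x) * exp (- zeta_const \<beta> V W * t)))
       \<and> (finite_entropy (f 0) f_inf \<longrightarrow>
           (\<forall>t\<ge>0. L1_norm (\<lambda>x. f t x - f_inf x)
              \<le> 2 * sqrt (2 * rel_entropy (f 0) f_inf) * exp (- (eta_const \<beta> V W / 2) * t)))"
proof -
  interpret mckean_vlasov \<beta> V W f f_inf
    by unfold_locales (use assms in simp_all)
  show ?thesis using L1_decay_from_L2 L1_decay_from_entropy by blast
qed

end
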